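(* Let $\ell>0$, $\Omega:=(0,\pi)\times(0,\ell)$, $\Gamma_0:=[0,\pi]\times\{0\}$, $\Gamma_1:=[0,\pi]\times\{\ell\}$, $\Gamma:=\partial\Omega\setminus(\Gamma_0\cup\Gamma_1)$. Let $f_0\in H^{1/2}(\Gamma_0)$ and $g_0\in H^{-1/2}(\Gamma_0)$, with Fourier coefficients $f_{0,k}$, $g_{0,k}$ ($k\ge0$) as in the context. Then the problem $$-\Delta u=0\ \text{in }\Omega,\qquad u=f_0\ \text{on }\Gamma_0,\qquad \frac{\partial u}{\partial\mathbf{n}}=g_0\ \text{on }\Gamma_0,\qquad \frac{\partial u}{\partial\mathbf{n}}=0\ \text{on }\Gamma$$ has a unique solution $u\in H^1(\Omega)$ if, and only if, the Cauchy boundary data $f_0,g_0$ satisfy the compatibility condition $$\sum_{k=1}^\infty k\sinh^2(k\ell)\left(f_{0,k}-\frac{\coth(k\ell)}{k}\,g_{0,k}\right)^2<\infty .$$ Moreover, when this condition is satisfied, the solution $u$ is given by $$u=\sum_{k\ge0}f_{0,k}\psi_{0,k}-\ell g_{0,0}\psi_{1,0}+\sum_{k\ge1}\frac{\sinh^2(k\ell)}{\cosh(k\ell)}\left(f_{0,k}-\frac{\coth(k\ell)}{k}g_{0,k}\right)\psi_{1,k},$$ and there exist two positive constants $c_1,c_2$, independent of $(f_0,g_0)$, such that, denoting $$\|(f_0,g_0)\|_*^2:=|f_{0,0}|^2+|g_{0,0}|^2+\sum_{k=1}^\infty k|f_{0,k}|^2+\sum_{k\ge1}k\sinh^2(k\ell)\left(f_{0,k}-\frac{\coth(k\ell)}{k}g_{0,k}\right)^2,$$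 one has $$c_1\|(f_0,g_0)\|_*^2\le\|u\|_{H^1(\Omega)}^2\le c_2\|(f_0,g_0)\|_*^2 .$$
   Context: $\mathbf{n}$ is the exterior unit normal on $\partial\Omega$; boundary value problems are understood in the usual weak sense in $H^1(\Omega)$, and $H^{-1/2}(\Gamma_0)$ is the dual of $H^{1/2}(\Gamma_0)$. The functions $\psi_{j,k}$ (Steklov eigenfunctions) are $$\psi_{0,0}(x,y)=\frac1{\sqrt\pi},\qquad \psi_{1,0}(x,y)=\frac{y}{\ell\sqrt\pi},$$ and for $k\ge1$ $$\psi_{0,k}(x,y)=\sqrt{\tfrac2\pi}\cos(kx)\frac{\cosh(k(\ell-y))}{\cosh(k\ell)},\qquad \psi_{1,k}(x,y)=\sqrt{\tfrac2\pi}\cos(kx)\frac{\sinh(ky)}{\sinh(k\ell)}.$$ For $k\ge0$, $f_{0,k}:=\int_0^\pi f_0(x)\psi_{0,k}(x,0)\,dx$ and $g_{0,k}:=\int_0^\pi g_0(x)\psi_{0,k}(x,0)\,dx$, the latter integral being understood as the $H^{-1/2}(\Gamma_0)$–$H^{1/2}(\Gamma_0)$ duality bracket. *)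

theory Defs
  imports "HOL-Analysis.Analysis"
begin

section \<open>Sobolev spaces\<close>

text \<open>Elements of Lebesgue and Sobolev spaces are represented by functions on the whole type.
  Their values off the given set are irrelevant, and two representatives describe the same
  element iff they agree almost everywhere on that set.\<close>

definition L2 :: "'a::euclidean_space set \<Rightarrow> ('a \<Rightarrow> real) set" where
  "L2 S = {u \<in> borel_measurable (lebesgue_on S). integrable (lebesgue_on S) (\<lambda>x. (u x)\<^sup>2)}"

primrec C_k :: "nat \<Rightarrow> ('a::euclidean_space \<Rightarrow> real) \<Rightarrow> bool" where
  "C_k 0 f \<longleftrightarrow> continuous_on UNIV f"
| "C_k (Suc n) f \<longleftrightarrow>
     f differentiable_on UNIV \<and> (\<forall>b\<in>Basis. C_k n (\<lambda>x. frechet_derivative f (at x) b))"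

definition smooth :: "('a::euclidean_space \<Rightarrow> real) \<Rightarrow> bool" where
  "smooth f \<longleftrightarrow> (\<forall>n. C_k n f)"

definition test_functions :: "'a::euclidean_space set \<Rightarrow> ('a \<Rightarrow> real) set" where
  "test_functions S =
     {\<phi>. smooth \<phi> \<and> compact (closure {x. \<phi> x \<noteq> 0}) \<and> closure {x. \<phi> x \<noteq> 0} \<subseteq> S}"

definition has_weak_deriv ::
    "'a::euclidean_space set \<Rightarrow> 'a \<Rightarrow> ('a \<Rightarrow> real) \<Rightarrow> ('a \<Rightarrow> real) \<Rightarrow> bool" where
  "has_weak_deriv S b u p \<longleftrightarrow>
     (\<forall>\<phi>\<in>test_functions S.
        (LINT x|lebesgue_on S. u x * frechet_derivative \<phi> (at x) b)
          = - (LINT x|lebesgue_on S. p x * \<phi> x))"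

definition H1 :: "'a::euclidean_space set \<Rightarrow> ('a \<Rightarrow> real) set" where
  "H1 S = {u \<in> L2 S. \<forall>b\<in>Basis. \<exists>p\<in>L2 S. has_weak_deriv S b u p}"

text \<open>The weak derivative is unique up to null sets, so integrals involving it do not depend
  on the choice made here.\<close>

definition weak_deriv ::
    "'a::euclidean_space set \<Rightarrow> 'a \<Rightarrow> ('a \<Rightarrow> real) \<Rightarrow> 'a \<Rightarrow> real" where
  "weak_deriv S b u = (SOME p. p \<in> L2 S \<and> has_weak_deriv S b u p)"

definition H1_norm :: "'a::euclidean_space set \<Rightarrow> ('a \<Rightarrow> real) \<Rightarrow> real" where
  "H1_norm S u = sqrt ((LINT x|lebesgue_on S. (u x)\<^sup>2)
      + (\<Sum>b\<in>Basis. LINT x|lebesgue_on S. (weak_deriv S b u x)\<^sup>2))"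

definition H1_sums ::
    "'a::euclidean_space set \<Rightarrow> (nat \<Rightarrow> 'a \<Rightarrow> real) \<Rightarrow> ('a \<Rightarrow> real) \<Rightarrow> bool" where
  "H1_sums S F s \<longleftrightarrow> (\<forall>k. F k \<in> H1 S) \<and> s \<in> H1 S \<and>
     (\<lambda>n. H1_norm S (\<lambda>x. (\<Sum>k<n. F k x) - s x)) \<longlonglongrightarrow> 0"

definition dirichlet_form ::
    "'a::euclidean_space set \<Rightarrow> ('a \<Rightarrow> real) \<Rightarrow> ('a \<Rightarrow> real) \<Rightarrow> real" where
  "dirichlet_form S u v =
     (\<Sum>b\<in>Basis. LINT x|lebesgue_on S. weak_deriv S b u x * weak_deriv S b v x)"

text \<open>\<open>H\<^sup>1\<^sup>/\<^sup>2\<close> of an interval, with the Sobolev--Slobodeckij (Gagliardo) norm. The value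
  \<open>0 / 0 = 0\<close> of the quotient on the diagonal concerns only a null set.\<close>

definition H_half :: "real set \<Rightarrow> (real \<Rightarrow> real) set" where
  "H_half I = {f \<in> L2 I.
     integrable (lebesgue_on (I \<times> I)) (\<lambda>(x, y). ((f x - f y) / (x - y))\<^sup>2)}"

definition H_half_norm :: "real set \<Rightarrow> (real \<Rightarrow> real) \<Rightarrow> real" where
  "H_half_norm I f = sqrt ((LINT x|lebesgue_on I. (f x)\<^sup>2)
      + (LINT p|lebesgue_on (I \<times> I). (case p of (x, y) \<Rightarrow> ((f x - f y) / (x - y))\<^sup>2)))"

text \<open>The dual of \<open>H_half I\<close>; the duality bracket of \<open>G\<close> and \<open>v\<close> is \<open>G v\<close>. Boundedness and
  linearity force \<open>G v\<close> to depend only on the almost-everywhere class of \<open>v\<close> on \<open>I\<close>.\<close>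

definition H_minus_half :: "real set \<Rightarrow> ((real \<Rightarrow> real) \<Rightarrow> real) set" where
  "H_minus_half I = {G.
     (\<forall>v\<in>H_half I. \<forall>w\<in>H_half I. G (\<lambda>x. v x + w x) = G v + G w) \<and>
     (\<forall>c. \<forall>v\<in>H_half I. G (\<lambda>x. c * v x) = c * G v) \<and>
     (\<exists>C. \<forall>v\<in>H_half I. \<bar>G v\<bar> \<le> C * H_half_norm I v)}"


section \<open>The Cauchy problem on a rectangle\<close>

definition Omega :: "real \<Rightarrow> (real \<times> real) set" where
  "Omega ell = {0<..<pi} \<times> {0<..<ell}"

text \<open>Functions on a horizontal side \<open>[0, \<pi>] \<times> {c}\<close> are identified with functions of the
  abscissa. The trace is the continuous extension to \<open>H\<^sup>1\<close> of the restriction map on functions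
  smooth up to the boundary.\<close>

definition has_trace :: "real \<Rightarrow> real \<Rightarrow> (real \<times> real \<Rightarrow> real) \<Rightarrow> (real \<Rightarrow> real) \<Rightarrow> bool" where
  "has_trace ell c u w \<longleftrightarrow> w \<in> L2 {0..pi} \<and>
     (\<exists>U. (\<forall>n. smooth (U n)) \<and>
        (\<lambda>n. H1_norm (Omega ell) (\<lambda>z. U n z - u z)) \<longlonglongrightarrow> 0 \<and>
        (\<lambda>n. LINT x|lebesgue_on {0..pi}. (U n (x, c) - w x)\<^sup>2) \<longlonglongrightarrow> 0)"

text \<open>Weak solutions of
  \<open>-\<Delta>u = 0\<close> in \<open>\<Omega>\<close>, \<open>u = f0\<close> and \<open>\<partial>u/\<partial>n = g0\<close> on \<open>y = 0\<close>, \<open>\<partial>u/\<partial>n = 0\<close> on the lateral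
  sides. No condition is imposed on \<open>y = ell\<close>, so the test functions vanish there; the Neumann
  conditions are the natural ones. By the trace theorem \<open>w\<close> below lies in \<open>H_half {0..pi}\<close>.\<close>

definition cauchy_solution ::
    "real \<Rightarrow> (real \<Rightarrow> real) \<Rightarrow> ((real \<Rightarrow> real) \<Rightarrow> real) \<Rightarrow> (real \<times> real \<Rightarrow> real) \<Rightarrow> bool" where
  "cauchy_solution ell f0 g0 u \<longleftrightarrow>
     u \<in> H1 (Omega ell) \<and> has_trace ell 0 u f0 \<and>
     (\<forall>v\<in>H1 (Omega ell). \<forall>w. has_trace ell 0 v w \<and> has_trace ell ell v (\<lambda>x. 0) \<longrightarrow>
        dirichlet_form (Omega ell) u v = g0 w)"

definition psi0 :: "real \<Rightarrow> nat \<Rightarrow> real \<times> real \<Rightarrow> real" where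
  "psi0 ell k = (\<lambda>(x, y).
     if k = 0 then 1 / sqrt pi
     else sqrt (2 / pi) * cos (k * x) * (cosh (k * (ell - y)) / cosh (k * ell)))"

definition psi1 :: "real \<Rightarrow> nat \<Rightarrow> real \<times> real \<Rightarrow> real" where
  "psi1 ell k = (\<lambda>(x, y).
     if k = 0 then y / (ell * sqrt pi)
     else sqrt (2 / pi) * cos (k * x) * (sinh (k * y) / sinh (k * ell)))"

definition f_coeff :: "real \<Rightarrow> (real \<Rightarrow> real) \<Rightarrow> nat \<Rightarrow> real" where
  "f_coeff ell f0 k = (LINT x|lebesgue_on {0..pi}. f0 x * psi0 ell k (x, 0))"

definition g_coeff :: "real \<Rightarrow> ((real \<Rightarrow> real) \<Rightarrow> real) \<Rightarrow> nat \<Rightarrow> real" where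
  "g_coeff ell g0 k = g0 (\<lambda>x. psi0 ell k (x, 0))"

definition coth :: "real \<Rightarrow> real" where
  "coth x = cosh x / sinh x"

text \<open>The combination \<open>f\<^sub>0\<^sub>,\<^sub>k - coth (k ell) / k * g\<^sub>0\<^sub>,\<^sub>k\<close>, meaningful for \<open>k \<ge> 1\<close>.\<close>

definition defect :: "real \<Rightarrow> (real \<Rightarrow> real) \<Rightarrow> ((real \<Rightarrow> real) \<Rightarrow> real) \<Rightarrow> nat \<Rightarrow> real" where
  "defect ell f0 g0 k = f_coeff ell f0 k - coth (k * ell) / k * g_coeff ell g0 k"

text \<open>Series over \<open>k \<ge> 1\<close> are indexed by \<open>j\<close> with \<open>k = Suc j\<close>.\<close>

definition compat_term ::
    "real \<Rightarrow> (real \<Rightarrow> real) \<Rightarrow> ((real \<Rightarrow> real) \<Rightarrow> real) \<Rightarrow> nat \<Rightarrow> real" where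
  "compat_term ell f0 g0 k = k * (sinh (k * ell))\<^sup>2 * (defect ell f0 g0 k)\<^sup>2"

definition compatible :: "real \<Rightarrow> (real \<Rightarrow> real) \<Rightarrow> ((real \<Rightarrow> real) \<Rightarrow> real) \<Rightarrow> bool" where
  "compatible ell f0 g0 \<longleftrightarrow> summable (\<lambda>j. compat_term ell f0 g0 (Suc j))"

definition star_norm_sq :: "real \<Rightarrow> (real \<Rightarrow> real) \<Rightarrow> ((real \<Rightarrow> real) \<Rightarrow> real) \<Rightarrow> real" where
  "star_norm_sq ell f0 g0 =
     \<bar>f_coeff ell f0 0\<bar>\<^sup>2 + \<bar>g_coeff ell g0 0\<bar>\<^sup>2
     + (\<Sum>j. Suc j * \<bar>f_coeff ell f0 (Suc j)\<bar>\<^sup>2)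
     + (\<Sum>j. compat_term ell f0 g0 (Suc j))"

end

theory Submission
  imports Defs
begin

text \<open>Expanding in \<open>cos (k x)\<close>, a solution has \<open>k\<close>-th mode
  \<open>f\<^sub>k cosh (k (ell - y)) / cosh (k ell) + \<beta>\<^sub>k sinh (k y) / sinh (k ell)\<close>, and by integration by
  parts the Dirichlet energy of this mode is \<open>k (f\<^sub>k\<^sup>2 tanh (k ell) + \<beta>\<^sub>k\<^sup>2 coth (k ell))\<close>, that is,
  \<open>tanh (k ell)\<close> times the sum of \<open>k f\<^sub>k\<^sup>2\<close> and the \<open>k\<close>-th compatibility term. Hence
  compatibility makes the series converge in \<open>H\<^sup>1\<close> and gives the norm equivalence. Conversely, the
  compatibility terms are the Dirichlet products of a given solution with the growing modes
  \<open>cos (k x) sinh (k y)\<close>, so their sum is controlled by the Cauchy--Schwarz inequality.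
  Uniqueness holds because the moments of a solution against the functions
  \<open>cos (k x) cos (j \<pi> y / ell)\<close>, which are complete, are determined by the data. The trace space
  enters through the equivalence of the Gagliardo seminorm with \<open>\<Sum> k w\<^sub>k\<^sup>2\<close>, read off in the variables
  \<open>(x + y) / 2\<close> and \<open>(x - y) / 2\<close>, where cosine differences become products of sines.\<close>

section \<open>Square-integrable functions\<close>

text \<open>Nothing is prescribed on \<open>y = ell\<close>, and this decides what may be paired
  with a solution: the weak equation admits only profiles that vanish at \<open>ell\<close>, and
  integration by parts only vertical factors that vanish there. Hence the double zeros at
  \<open>ell\<close> in the uniqueness argument and the splitting of the growing mode. On the
  lateral sides no trace is ever formed, because the \<open>x\<close>-derivative of
  \<open>cos (k x)\<close> vanishes there. The flux \<open>g0\<close> is merely a bounded functional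
  on \<open>H_half\<close>. Its values on cosines determine \<open>g0 w\<close> once the cosine
  series of \<open>w\<close> converges in the Gagliardo norm, which asks for
  \<open>\<Sum> k w\<^sub>k\<^sup>2 < \<infinity>\<close>; for traces \<open>w\<close> this is drawn
  from the Dirichlet form. For \<open>f0\<close> the same summability has to be read off the
  Gagliardo norm. There the points \<open>s - h\<close> and \<open>s + h\<close> leave the interval,
  so sine orthogonality in \<open>s\<close> fails; even reflection at both ends restores it. The
  weight \<open>sinh\<^sup>2\<close> measures the instability of the problem: a defect in the data
  excites the growing mode with the factor \<open>sinh\<^sup>2 / cosh\<close>.\<close>

definition ip :: "'a::euclidean_space set \<Rightarrow> ('a \<Rightarrow> real) \<Rightarrow> ('a \<Rightarrow> real) \<Rightarrow> real" where
  "ip S u v = (LINT x|lebesgue_on S. u x * v x)"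

definition nrm :: "'a::euclidean_space set \<Rightarrow> ('a \<Rightarrow> real) \<Rightarrow> real" where
  "nrm S u = sqrt (ip S u u)"

text \<open>Membership in \<open>L2\<close> is part of the notion because the Bochner integral of a
  non-integrable function is 0: otherwise \<open>nrm\<close> could vanish for want of
  integrability.\<close>

definition L2lim :: "'a::euclidean_space set \<Rightarrow> (nat \<Rightarrow> 'a \<Rightarrow> real) \<Rightarrow> ('a \<Rightarrow> real) \<Rightarrow> bool" where
  "L2lim S F f \<longleftrightarrow> (\<forall>n. F n \<in> L2 S) \<and> f \<in> L2 S \<and> (\<lambda>n. nrm S (\<lambda>x. F n x - f x)) \<longlonglongrightarrow> 0"

lemma L2_measurable: "u \<in> L2 S \<Longrightarrow> u \<in> borel_measurable (lebesgue_on S)"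
  by (simp add: L2_def)

lemma L2_square_integrable: "u \<in> L2 S \<Longrightarrow> integrable (lebesgue_on S) (\<lambda>x. (u x)\<^sup>2)"
  by (simp add: L2_def)

lemma L2_mult_integrable:
  assumes "u \<in> L2 S" "v \<in> L2 S"
  shows "integrable (lebesgue_on S) (\<lambda>x. u x * v x)"
proof (rule Bochner_Integration.integrable_bound)
  show "integrable (lebesgue_on S) (\<lambda>x. (u x)\<^sup>2 + (v x)\<^sup>2)"
    using assms by (simp add: L2_square_integrable)
  show "(\<lambda>x. u x * v x) \<in> borel_measurable (lebesgue_on S)"
    using assms[THEN L2_measurable] by measurable
  have "\<bar>a * b\<bar> \<le> \<bar>a\<^sup>2 + b\<^sup>2\<bar>" for a b :: real
    using sum_squares_bound[of "\<bar>a\<bar>" "\<bar>b\<bar>"] zero_le_power2[of a] zero_le_power2[of b]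
    unfolding abs_mult power2_abs by linarith
  then show "AE x in lebesgue_on S. norm (u x * v x) \<le> norm ((u x)\<^sup>2 + (v x)\<^sup>2)"
    by simp
qed

lemma L2_add:
  assumes "u \<in> L2 S" "v \<in> L2 S"
  shows "(\<lambda>x. u x + v x) \<in> L2 S"
proof -
  have "integrable (lebesgue_on S) (\<lambda>x. (u x)\<^sup>2 + (v x)\<^sup>2 + 2 * (u x * v x))"
    using assms by (intro Bochner_Integration.integrable_add integrable_mult_right)
      (auto intro: L2_square_integrable L2_mult_integrable)
  moreover have "(\<lambda>x. u x + v x) \<in> borel_measurable (lebesgue_on S)"
    using assms[THEN L2_measurable] by measurable
  ultimately show ?thesis
    by (simp add: L2_def power2_sum mult.assoc)
qed

lemma L2_scale: "u \<in> L2 S \<Longrightarrow> (\<lambda>x. c * u x) \<in> L2 S"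
  by (auto simp: L2_def power_mult_distrib)

lemma L2_zero [simp]: "(\<lambda>x. 0) \<in> L2 S"
  by (simp add: L2_def)

lemma L2_diff: "u \<in> L2 S \<Longrightarrow> v \<in> L2 S \<Longrightarrow> (\<lambda>x. u x - v x) \<in> L2 S"
  using L2_add[of u S "\<lambda>x. (-1) * v x"] L2_scale[of v S "-1"] by simp

lemma L2_sum: "(\<And>i. i \<in> A \<Longrightarrow> F i \<in> L2 S) \<Longrightarrow> (\<lambda>x. \<Sum>i\<in>A. F i x) \<in> L2 S"
  by (induction A rule: infinite_finite_induct) (auto intro: L2_add)

lemma ip_commute: "ip S u v = ip S v u"
  by (simp add: ip_def mult.commute)

lemma ip_add_left:
  "u \<in> L2 S \<Longrightarrow> v \<in> L2 S \<Longrightarrow> w \<in> L2 S \<Longrightarrow> ip S (\<lambda>x. u x + v x) w = ip S u w + ip S v w"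
  by (simp add: ip_def distrib_right L2_mult_integrable)

lemma ip_diff_left:
  "u \<in> L2 S \<Longrightarrow> v \<in> L2 S \<Longrightarrow> w \<in> L2 S \<Longrightarrow> ip S (\<lambda>x. u x - v x) w = ip S u w - ip S v w"
  by (simp add: ip_def left_diff_distrib L2_mult_integrable)

lemma ip_scale_left: "ip S (\<lambda>x. c * u x) w = c * ip S u w"
  by (simp add: ip_def mult.assoc)

lemma ip_scale_right: "ip S w (\<lambda>x. c * u x) = c * ip S w u"
  by (simp add: ip_commute[of S w] ip_scale_left)

lemma ip_minus_right: "ip S w (\<lambda>x. - u x) = - ip S w u"
  using ip_scale_right[of S w "-1" u] by simp

lemma ip_add_right:
  "u \<in> L2 S \<Longrightarrow> v \<in> L2 S \<Longrightarrow> w \<in> L2 S \<Longrightarrow> ip S w (\<lambda>x. u x + v x) = ip S w u + ip S w v"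
  by (simp add: ip_commute[of S w] ip_add_left)

lemma ip_diff_right:
  "u \<in> L2 S \<Longrightarrow> v \<in> L2 S \<Longrightarrow> w \<in> L2 S \<Longrightarrow> ip S w (\<lambda>x. u x - v x) = ip S w u - ip S w v"
  by (simp add: ip_commute[of S w] ip_diff_left)

lemma ip_zero_left [simp]: "ip S (\<lambda>x. 0) w = 0"
  by (simp add: ip_def)

lemma ip_zero_right [simp]: "ip S w (\<lambda>x. 0) = 0"
  by (simp add: ip_def)

lemma ip_sum_left:
  "(\<And>i. i \<in> A \<Longrightarrow> F i \<in> L2 S) \<Longrightarrow> w \<in> L2 S \<Longrightarrow>
    ip S (\<lambda>x. \<Sum>i\<in>A. F i x) w = (\<Sum>i\<in>A. ip S (F i) w)"
  by (induction A rule: infinite_finite_induct) (auto simp: ip_add_left L2_sum)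

lemma ip_sum_right:
  "(\<And>i. i \<in> A \<Longrightarrow> F i \<in> L2 S) \<Longrightarrow> w \<in> L2 S \<Longrightarrow>
    ip S w (\<lambda>x. \<Sum>i\<in>A. F i x) = (\<Sum>i\<in>A. ip S w (F i))"
  by (simp add: ip_commute[of S w] ip_sum_left)

lemma ip_cong_AE:
  assumes "AE x in lebesgue_on S. u x = u' x" "AE x in lebesgue_on S. v x = v' x"
    and "u \<in> L2 S" "u' \<in> L2 S" "v \<in> L2 S" "v' \<in> L2 S"
  shows "ip S u v = ip S u' v'"
  unfolding ip_def
proof (rule integral_cong_AE)
  show "AE x in lebesgue_on S. u x * v x = u' x * v' x"
    using assms(1,2) by eventually_elim simp
qed (use assms(3-)[THEN L2_measurable] in measurable)

lemma ip_self_nonneg [simp]: "ip S u u \<ge> 0"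
  by (simp add: ip_def)

lemma nrm_nonneg [simp]: "nrm S u \<ge> 0"
  by (simp add: nrm_def)

lemma nrm_power2: "(nrm S u)\<^sup>2 = ip S u u"
  by (simp add: nrm_def)

lemma nrm_eq_integral: "nrm S u = sqrt (LINT x|lebesgue_on S. (u x)\<^sup>2)"
  by (simp add: nrm_def ip_def power2_eq_square)

lemma ip_self: "ip S u u = (LINT x|lebesgue_on S. (u x)\<^sup>2)"
  by (simp add: ip_def power2_eq_square)

lemma nrm_cong_AE:
  assumes "AE x in lebesgue_on S. u x = v x" "u \<in> L2 S" "v \<in> L2 S"
  shows "nrm S u = nrm S v"
  unfolding nrm_def using ip_cong_AE[OF assms(1) assms(1)] assms(2,3) by simp

lemma ip_Cauchy_Schwarz:
  assumes u: "u \<in> L2 S" and v: "v \<in> L2 S"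
  shows "\<bar>ip S u v\<bar> \<le> nrm S u * nrm S v"
proof -
  let ?a = "ip S u u" and ?b = "ip S u v" and ?c = "ip S v v"
  have q: "0 \<le> s\<^sup>2 * ?a - 2 * s * t * ?b + t\<^sup>2 * ?c" for s t
  proof -
    let ?w = "\<lambda>x. s * u x - t * v x"
    have "ip S ?w ?w = s\<^sup>2 * ?a - 2 * s * t * ?b + t\<^sup>2 * ?c"
      using u v by (simp add: ip_diff_left ip_diff_right L2_diff L2_scale ip_scale_left
          ip_scale_right ip_commute[of S v u] power2_eq_square algebra_simps)
    then show ?thesis
      by (metis ip_self_nonneg)
  qed
  have "?b\<^sup>2 \<le> ?a * ?c"
  proof (cases "?a = 0")
    case True
    have "?b = 0"
    proof (rule ccontr)
      \<comment> \<open>With \<open>?a = 0\<close> and \<open>t = 1\<close> the form is affine in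
        \<open>s\<close>, namely \<open>?c - 2 * s * ?b\<close>; the value of \<open>s\<close> below
        makes it equal to -1.\<close>
      assume b: "?b \<noteq> 0"
      have "0 \<le> - 2 * ((?c + 1) / (2 * ?b)) * ?b + ?c"
        using q[of "(?c + 1) / (2 * ?b)" 1] True unfolding True by (simp del: times_divide_eq_right times_divide_eq_left)
      also have "\<dots> = - 1"
        using b by (simp add: field_simps)
      finally show False
        by simp
    qed
    then show ?thesis
      by (simp add: True)
  next
    case False
    then have "?a > 0"
      using ip_self_nonneg[of S u] by linarith
    \<comment> \<open>The form at \<open>s = ?b\<close>, \<open>t = ?a\<close>, where every term has
      the factor \<open>?a\<close>.\<close>
    moreover have "0 \<le> ?a * (?a * ?c - ?b\<^sup>2)"
      using q[of ?b ?a] by (simp add: power2_eq_square algebra_simps)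
    ultimately show ?thesis
      by (simp add: zero_le_mult_iff)
  qed
  then have "\<bar>?b\<bar> \<le> sqrt (?a * ?c)"
    by (metis real_sqrt_abs real_sqrt_le_iff)
  then show ?thesis
    by (simp add: nrm_def real_sqrt_mult)
qed

lemma nrm_triangle:
  assumes u: "u \<in> L2 S" and v: "v \<in> L2 S"
  shows "nrm S (\<lambda>x. u x + v x) \<le> nrm S u + nrm S v"
proof (rule power2_le_imp_le)
  have "(nrm S (\<lambda>x. u x + v x))\<^sup>2 = ip S u u + 2 * ip S u v + ip S v v"
    using u v by (simp add: nrm_power2 ip_add_left ip_add_right L2_add ip_commute[of S v u])
  also have "\<dots> \<le> ip S u u + 2 * (nrm S u * nrm S v) + ip S v v"
    using ip_Cauchy_Schwarz[OF u v] by simp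
  also have "\<dots> = (nrm S u + nrm S v)\<^sup>2"
    by (simp add: power2_sum nrm_power2)
  finally show "(nrm S (\<lambda>x. u x + v x))\<^sup>2 \<le> (nrm S u + nrm S v)\<^sup>2" .
qed simp

lemma nrm_scale: "nrm S (\<lambda>x. c * u x) = \<bar>c\<bar> * nrm S u"
  by (simp add: nrm_def ip_scale_left ip_scale_right real_sqrt_mult flip: mult.assoc)

lemma nrm_zero [simp]: "nrm S (\<lambda>x. 0) = 0"
  by (simp add: nrm_def)

lemma nrm_minus_commute: "nrm S (\<lambda>x. u x - v x) = nrm S (\<lambda>x. v x - u x)"
  using nrm_scale[of S "-1" "\<lambda>x. u x - v x"] by simp

lemma nrm_eq_0_imp_AE:
  assumes "u \<in> L2 S" "nrm S u = 0"
  shows "AE x in lebesgue_on S. u x = 0"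
proof -
  have "(LINT x|lebesgue_on S. (u x)\<^sup>2) = 0"
    using assms(2) by (simp add: nrm_eq_integral)
  then show ?thesis
    using integral_nonneg_eq_0_iff_AE[OF L2_square_integrable[OF assms(1)]] by simp
qed

lemma nrm_nn_integral:
  assumes "u \<in> L2 S"
  shows "(\<integral>\<^sup>+x. ennreal ((u x)\<^sup>2) \<partial>lebesgue_on S) = ennreal ((nrm S u)\<^sup>2)"
  using nn_integral_eq_integral[OF L2_square_integrable[OF assms]]
  by (simp add: nrm_power2 ip_self)

text \<open>Phrased with the nonnegative integral so that membership in \<open>L2\<close> is a
  conclusion; Fatou's lemma and the Gagliardo estimate deliver their bounds in this form.\<close>

lemma L2_bound_nn_integral:
  assumes [measurable]: "u \<in> borel_measurable (lebesgue_on S)" and "c \<ge> 0"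
    and le: "(\<integral>\<^sup>+x. ennreal ((u x)\<^sup>2) \<partial>lebesgue_on S) \<le> ennreal (c\<^sup>2)"
  shows "u \<in> L2 S" "nrm S u \<le> c"
proof -
  show u: "u \<in> L2 S"
  proof -
    have "integrable (lebesgue_on S) (\<lambda>x. (u x)\<^sup>2)"
    proof (rule integrableI_bounded)
      show "(\<integral>\<^sup>+x. ennreal (norm ((u x)\<^sup>2)) \<partial>lebesgue_on S) < \<infinity>"
        using le_less_trans[OF le ennreal_less_top] by simp
    qed measurable
    then show ?thesis
      by (simp add: L2_def assms(1))
  qed
  show "nrm S u \<le> c"
  proof (rule power2_le_imp_le)
    show "(nrm S u)\<^sup>2 \<le> c\<^sup>2"
      using le unfolding nrm_nn_integral[OF u] by (rule ennreal_le_iff[THEN iffD1, rotated]) simp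
  qed (rule \<open>c \<ge> 0\<close>)
qed

section \<open>Convergence in \<open>L2\<close> and completeness\<close>

lemma L2limI_power2:
  assumes "\<And>n. F n \<in> L2 S" "f \<in> L2 S" "(\<lambda>n. LINT x|lebesgue_on S. (F n x - f x)\<^sup>2) \<longlonglongrightarrow> 0"
  shows "L2lim S F f"
  using assms tendsto_real_sqrt[OF assms(3)] by (simp add: L2lim_def nrm_eq_integral)

lemma L2lim_power2:
  assumes "L2lim S F f"
  shows "(\<lambda>n. LINT x|lebesgue_on S. (F n x - f x)\<^sup>2) \<longlonglongrightarrow> 0"
proof -
  have "(\<lambda>n. (nrm S (\<lambda>x. F n x - f x))\<^sup>2) \<longlonglongrightarrow> 0\<^sup>2"
    using assms by (intro tendsto_power) (simp add: L2lim_def)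
  then show ?thesis
    by (simp add: nrm_power2 ip_self)
qed

lemma L2limD: "L2lim S F f \<Longrightarrow> F n \<in> L2 S" "L2lim S F f \<Longrightarrow> f \<in> L2 S"
  "L2lim S F f \<Longrightarrow> (\<lambda>n. nrm S (\<lambda>x. F n x - f x)) \<longlonglongrightarrow> 0"
  by (auto simp: L2lim_def)

lemma L2lim_const: "f \<in> L2 S \<Longrightarrow> L2lim S (\<lambda>n. f) f"
  by (simp add: L2lim_def)

lemma L2lim_ip:
  assumes F: "L2lim S F f" and G: "L2lim S G g"
  shows "(\<lambda>n. ip S (F n) (G n)) \<longlonglongrightarrow> ip S f g"
proof (rule Lim_null[THEN iffD2], rule Lim_null_comparison)
  note [simp] = L2limD(1,2)[OF F] L2limD(1,2)[OF G] L2_diff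
  let ?a = "\<lambda>n. nrm S (\<lambda>x. F n x - f x)" and ?b = "\<lambda>n. nrm S (\<lambda>x. G n x - g x)"
  show "\<forall>\<^sub>F n in sequentially. norm (ip S (F n) (G n) - ip S f g) \<le> ?a n * (?b n + nrm S g) + nrm S f * ?b n"
  proof (rule always_eventually, intro allI)
    fix n
    have "ip S (F n) (G n) - ip S f g = ip S (\<lambda>x. F n x - f x) (G n) + ip S f (\<lambda>x. G n x - g x)"
      by (simp add: ip_diff_left ip_diff_right)
    moreover have "\<bar>ip S (\<lambda>x. F n x - f x) (G n)\<bar> \<le> ?a n * nrm S (G n)"
      by (rule ip_Cauchy_Schwarz) simp_all
    moreover have "\<bar>ip S f (\<lambda>x. G n x - g x)\<bar> \<le> nrm S f * ?b n"
      by (rule ip_Cauchy_Schwarz) simp_all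
    moreover have "nrm S (G n) \<le> ?b n + nrm S g"
      using nrm_triangle[of "\<lambda>x. G n x - g x" S g] by simp
    then have "?a n * nrm S (G n) \<le> ?a n * (?b n + nrm S g)"
      by (intro mult_left_mono) simp_all
    ultimately show "norm (ip S (F n) (G n) - ip S f g) \<le> ?a n * (?b n + nrm S g) + nrm S f * ?b n"
      by simp
  qed
  have "(\<lambda>n. ?a n * (?b n + nrm S g) + nrm S f * ?b n) \<longlonglongrightarrow> 0 * (0 + nrm S g) + nrm S f * 0"
    by (intro tendsto_intros L2limD(3)[OF F] L2limD(3)[OF G])
  then show "(\<lambda>n. ?a n * (?b n + nrm S g) + nrm S f * ?b n) \<longlonglongrightarrow> 0"
    by simp
qed

lemma L2lim_nrm:
  assumes "L2lim S F f"
  shows "(\<lambda>n. nrm S (F n)) \<longlonglongrightarrow> nrm S f"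
  unfolding nrm_def by (intro tendsto_real_sqrt L2lim_ip assms)

lemma L2lim_comparison:
  assumes F: "\<And>n. F n \<in> L2 S" and f: "f \<in> L2 S"
    and le: "\<And>n. nrm S (\<lambda>x. F n x - f x) \<le> e n" and e: "e \<longlonglongrightarrow> 0"
  shows "L2lim S F f"
  unfolding L2lim_def using F f le
  by (auto intro!: Lim_null_comparison[OF _ e] always_eventually)

lemma L2lim_add:
  assumes "L2lim S F f" "L2lim S G g"
  shows "L2lim S (\<lambda>n x. F n x + G n x) (\<lambda>x. f x + g x)"
proof (rule L2lim_comparison)
  note [simp] = assms[THEN L2limD(1)] assms[THEN L2limD(2)]
  show "nrm S (\<lambda>x. F n x + G n x - (f x + g x))
      \<le> nrm S (\<lambda>x. F n x - f x) + nrm S (\<lambda>x. G n x - g x)" for n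
    using nrm_triangle[of "\<lambda>x. F n x - f x" S "\<lambda>x. G n x - g x"]
    by (simp add: L2_diff algebra_simps)
  show "(\<lambda>n. nrm S (\<lambda>x. F n x - f x) + nrm S (\<lambda>x. G n x - g x)) \<longlonglongrightarrow> 0"
    using tendsto_add[OF assms[THEN L2limD(3)]] by simp
qed (use assms in \<open>auto intro!: L2_add dest: L2limD\<close>)

lemma L2lim_scale:
  assumes "L2lim S F f"
  shows "L2lim S (\<lambda>n x. c * F n x) (\<lambda>x. c * f x)"
proof (rule L2lim_comparison)
  show "nrm S (\<lambda>x. c * F n x - c * f x) \<le> \<bar>c\<bar> * nrm S (\<lambda>x. F n x - f x)" for n
    using nrm_scale[of S c "\<lambda>x. F n x - f x"] by (simp add: algebra_simps)
  show "(\<lambda>n. \<bar>c\<bar> * nrm S (\<lambda>x. F n x - f x)) \<longlonglongrightarrow> 0"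
    using tendsto_mult_right_zero[OF assms[THEN L2limD(3)]] .
qed (use assms in \<open>auto intro!: L2_scale dest: L2limD\<close>)

lemma L2lim_diff:
  assumes "L2lim S F f" "L2lim S G g"
  shows "L2lim S (\<lambda>n x. F n x - G n x) (\<lambda>x. f x - g x)"
  using L2lim_add[OF assms(1) L2lim_scale[OF assms(2), of "-1"]] by simp

lemma L2lim_unique:
  assumes F: "L2lim S F f" and G: "L2lim S F g"
  shows "AE x in lebesgue_on S. f x = g x"
proof -
  have "L2lim S (\<lambda>n x. 0) (\<lambda>x. f x - g x)"
    using L2lim_diff[OF F G] by simp
  then have "(\<lambda>n. nrm S (\<lambda>x. 0)) \<longlonglongrightarrow> nrm S (\<lambda>x. f x - g x)"
    by (rule L2lim_nrm)
  then have "nrm S (\<lambda>x. f x - g x) = 0"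
    by (simp add: LIMSEQ_const_iff)
  then show ?thesis
    using nrm_eq_0_imp_AE[of "\<lambda>x. f x - g x" S] F G by (simp add: L2_diff L2limD)
qed

lemma L2lim_AE_subseq:
  assumes F: "L2lim S F f"
  shows "\<exists>r. strict_mono r \<and> (AE x in lebesgue_on S. (\<lambda>n. F (r n) x) \<longlonglongrightarrow> f x)"
proof -
  have "\<exists>r. strict_mono r \<and> (AE x in lebesgue_on S. (\<lambda>n. (F (r n) x - f x)\<^sup>2) \<longlonglongrightarrow> 0)"
    using L2lim_power2[OF F]
    by (intro tendsto_L1_AE_subseq)
      (simp_all add: L2_square_integrable[OF L2_diff[OF L2limD(1)[OF F] L2limD(2)[OF F]]])
  then obtain r :: "nat \<Rightarrow> nat" where "strict_mono r"
    and r: "AE x in lebesgue_on S. (\<lambda>n. (F (r n) x - f x)\<^sup>2) \<longlonglongrightarrow> 0"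
    by blast
  from r have "AE x in lebesgue_on S. (\<lambda>n. F (r n) x) \<longlonglongrightarrow> f x"
  proof eventually_elim
    case (elim x)
    from tendsto_real_sqrt[OF this] show ?case
      by (simp add: tendsto_rabs_zero_iff LIM_zero_iff)
  qed
  with \<open>strict_mono r\<close> show ?thesis
    by blast
qed

lemma L2_imp_integrable:
  assumes "S \<in> lmeasurable" "u \<in> L2 S"
  shows "integrable (lebesgue_on S) u"
proof -
  interpret finite_measure "lebesgue_on S"
    by (rule finite_measure_lebesgue_on[OF assms(1)])
  show ?thesis
    by (rule square_integrable_imp_integrable)
      (use assms(2) in \<open>simp_all add: L2_measurable L2_square_integrable\<close>)
qed

text \<open>Riesz-Fischer. On a set of finite measure Cauchy-Schwarz against the constant 1 bounds
  the \<open>L1\<close> norm by the \<open>L2\<close> norm, so the increments of a fast subsequence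
  are absolutely summable almost everywhere; Fatou's lemma turns the pointwise limit into an
  \<open>L2\<close> limit.\<close>

lemma L2_complete:
  fixes F :: "nat \<Rightarrow> 'a::euclidean_space \<Rightarrow> real"
  assumes S: "S \<in> lmeasurable" and F: "\<And>n. F n \<in> L2 S"
    and Cauchy: "\<And>e. e > 0 \<Longrightarrow> \<exists>N. \<forall>m\<ge>N. \<forall>n\<ge>N. nrm S (\<lambda>x. F m x - F n x) < e"
  shows "\<exists>f. L2lim S F f"
proof -
  interpret finite_measure "lebesgue_on S"
    by (rule finite_measure_lebesgue_on[OF S])
  note [measurable] = F[THEN L2_measurable]
  have "\<exists>N. \<forall>k. (\<forall>n\<ge>N k. nrm S (\<lambda>x. F n x - F (N k) x) < (1/2)^k) \<and> N k < N (Suc k)"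
  proof (rule dependent_nat_choice[where P = "\<lambda>k M. \<forall>n\<ge>M. nrm S (\<lambda>x. F n x - F M x) < (1/2)^k"
        and Q = "\<lambda>k M M'. M < M'"])
    show "\<exists>N. \<forall>n\<ge>N. nrm S (\<lambda>x. F n x - F N x) < (1/2)^0"
      using Cauchy[of 1] by auto
    fix M k
    obtain N where N: "\<forall>m\<ge>N. \<forall>n\<ge>N. nrm S (\<lambda>x. F m x - F n x) < (1/2)^Suc k"
      using Cauchy[of "(1/2)^Suc k"] by auto
    then show "\<exists>N'. (\<forall>n\<ge>N'. nrm S (\<lambda>x. F n x - F N' x) < (1/2)^Suc k) \<and> M < N'"
      by (intro exI[of _ "max N (Suc M)"]) auto
  qed
  then obtain r where r': "\<forall>k. (\<forall>n\<ge>r k. nrm S (\<lambda>x. F n x - F (r k) x) < (1/2)^k) \<and> r k < r (Suc k)"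
    by (rule exE)
  then have r: "nrm S (\<lambda>x. F n x - F (r k) x) < (1/2)^k" if "n \<ge> r k" for n k
    using that by simp
  have r_mono: "r k < r (Suc k)" for k
    using r' by simp
  define G where "G k x = F (r (Suc k)) x - F (r k) x" for k x
  have G: "G k \<in> L2 S" for k
    unfolding G_def by (intro L2_diff F)
  note [measurable] = G[THEN L2_measurable]
  have nG: "nrm S (G k) \<le> (1/2)^k" for k
    using r[of k "r (Suc k)"] r_mono[of k] by (simp add: G_def[abs_def] less_imp_le)
  have one: "(\<lambda>x. 1) \<in> L2 S"
    by (simp add: L2_def)
  have absG: "(\<lambda>x. \<bar>G k x\<bar>) \<in> L2 S" for k
    using G[of k] by (simp add: L2_def)
  have intG: "(\<integral>\<^sup>+x. ennreal \<bar>G k x\<bar> \<partial>lebesgue_on S) \<le> ennreal (nrm S (\<lambda>x. 1) * (1/2)^k)" for k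
  proof -
    have "(\<integral>\<^sup>+x. ennreal \<bar>G k x\<bar> \<partial>lebesgue_on S) = ennreal (LINT x|lebesgue_on S. \<bar>G k x\<bar>)"
      using L2_imp_integrable[OF S absG] by (intro nn_integral_eq_integral) auto
    also have "(LINT x|lebesgue_on S. \<bar>G k x\<bar>) = ip S (\<lambda>x. 1) (\<lambda>x. \<bar>G k x\<bar>)"
      by (simp add: ip_def)
    also have "\<dots> \<le> nrm S (\<lambda>x. 1) * nrm S (\<lambda>x. \<bar>G k x\<bar>)"
      using ip_Cauchy_Schwarz[OF one absG[of k]] by linarith
    also have "nrm S (\<lambda>x. \<bar>G k x\<bar>) = nrm S (G k)"
      by (simp add: nrm_eq_integral)
    also have "nrm S (\<lambda>x. 1) * nrm S (G k) \<le> nrm S (\<lambda>x. 1) * (1/2)^k"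
      by (intro mult_left_mono nG) simp
    finally show ?thesis
      by (simp add: ennreal_leI)
  qed
  have "(\<integral>\<^sup>+x. (\<Sum>k. ennreal \<bar>G k x\<bar>) \<partial>lebesgue_on S) = (\<Sum>k. \<integral>\<^sup>+x. ennreal \<bar>G k x\<bar> \<partial>lebesgue_on S)"
    by (rule nn_integral_suminf) simp
  also have "\<dots> \<le> (\<Sum>k. ennreal (nrm S (\<lambda>x. 1) * (1/2)^k))"
    by (intro suminf_le intG) auto
  also have "\<dots> < \<infinity>"
    by (subst suminf_ennreal2) (auto intro!: summable_mult summable_geometric)
  finally have "AE x in lebesgue_on S. (\<Sum>k. ennreal \<bar>G k x\<bar>) \<noteq> \<infinity>"
    by (intro nn_integral_PInf_AE) auto
  then have conv: "AE x in lebesgue_on S. (\<lambda>k. F (r k) x) \<longlonglongrightarrow> lim (\<lambda>k. F (r k) x)"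
  proof eventually_elim
    case (elim x)
    then have "summable (\<lambda>k. \<bar>G k x\<bar>)"
      by (intro summable_suminf_not_top) (auto simp: infinity_ennreal_def)
    then have "summable (\<lambda>k. G k x)"
      by (rule summable_rabs_cancel)
    then have "convergent (\<lambda>n. (\<Sum>k<n. G k x))"
      by (simp add: summable_iff_convergent)
    also have "(\<lambda>n. (\<Sum>k<n. G k x)) = (\<lambda>n. F (r n) x - F (r 0) x)"
      unfolding G_def by (rule ext) (rule sum_lessThan_telescope[of "\<lambda>k. F (r k) x"])
    finally have "convergent (\<lambda>n. F (r n) x)"
      by (simp add: convergent_diff_const_right_iff)
    then show ?case
      by (simp add: convergent_LIMSEQ_iff)
  qed
  \<comment> \<open>Where the subsequence diverges \<open>lim\<close> is an unspecified value;
    \<open>conv\<close> confines this to a null set.\<close>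
  define f where "f x = lim (\<lambda>k. F (r k) x)" for x
  have f_meas [measurable]: "f \<in> borel_measurable (lebesgue_on S)"
    unfolding f_def[abs_def] by measurable
  \<comment> \<open>Fatou along the subsequence with \<open>n\<close> fixed: the Cauchy tolerance
    bounds the distance from \<open>F n\<close> to the limit, and it also yields the
    square-integrability of the limit.\<close>
  have bound: "(\<lambda>x. F n x - f x) \<in> L2 S \<and> nrm S (\<lambda>x. F n x - f x) \<le> e"
    if e: "e > 0" and ev: "\<forall>\<^sub>F m in sequentially. nrm S (\<lambda>x. F n x - F m x) < e" for n e
  proof -
    have rinf: "filterlim r sequentially sequentially"
      using r_mono by (intro filterlim_subseq) (simp add: strict_mono_Suc_iff)
    have "(\<integral>\<^sup>+x. ennreal ((F n x - f x)\<^sup>2) \<partial>lebesgue_on S)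
        = (\<integral>\<^sup>+x. liminf (\<lambda>k. ennreal ((F n x - F (r k) x)\<^sup>2)) \<partial>lebesgue_on S)"
    proof (intro nn_integral_cong_AE, use conv in eventually_elim)
      case (elim x)
      have "(\<lambda>k. ennreal ((F n x - F (r k) x)\<^sup>2)) \<longlonglongrightarrow> ennreal ((F n x - f x)\<^sup>2)"
        unfolding f_def using elim by (intro tendsto_intros)
      then show ?case
        by (metis lim_imp_Liminf trivial_limit_sequentially)
    qed
    also have "\<dots> \<le> liminf (\<lambda>k. \<integral>\<^sup>+x. ennreal ((F n x - F (r k) x)\<^sup>2) \<partial>lebesgue_on S)"
      by (rule nn_integral_liminf) measurable
    also have "\<dots> = liminf (\<lambda>k. ennreal ((nrm S (\<lambda>x. F n x - F (r k) x))\<^sup>2))"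
      using F by (simp add: nrm_nn_integral L2_diff)
    also have "\<dots> \<le> liminf (\<lambda>k. ennreal (e\<^sup>2))"
    proof (rule Liminf_mono)
      show "\<forall>\<^sub>F k in sequentially. ennreal ((nrm S (\<lambda>x. F n x - F (r k) x))\<^sup>2) \<le> ennreal (e\<^sup>2)"
        using eventually_compose_filterlim[OF ev rinf]
      proof eventually_elim
        case (elim k)
        then show ?case
          using power_mono[of "nrm S (\<lambda>x. F n x - F (r k) x)" e 2] by (simp add: ennreal_leI)
      qed
    qed
    finally have "(\<integral>\<^sup>+x. ennreal ((F n x - f x)\<^sup>2) \<partial>lebesgue_on S) \<le> ennreal (e\<^sup>2)"
      by (simp add: Liminf_const)
    then show ?thesis
      using L2_bound_nn_integral[of "\<lambda>x. F n x - f x" S e] e by simp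
  qed
  have tail: "\<exists>N. \<forall>n\<ge>N. (\<lambda>x. F n x - f x) \<in> L2 S \<and> nrm S (\<lambda>x. F n x - f x) \<le> e" if "e > 0" for e
    using Cauchy[OF that] bound[OF that] by (meson eventually_sequentiallyI)
  have fL2: "f \<in> L2 S"
  proof -
    obtain N where "(\<lambda>x. F N x - f x) \<in> L2 S"
      using tail[of 1] by auto
    then show ?thesis
      using L2_diff[OF F[of N]] by fastforce
  qed
  have "(\<lambda>n. nrm S (\<lambda>x. F n x - f x)) \<longlonglongrightarrow> 0"
  proof (rule LIMSEQ_I)
    fix e :: real
    assume "e > 0"
    then show "\<exists>N. \<forall>n\<ge>N. norm (nrm S (\<lambda>x. F n x - f x) - 0) < e"
      using tail[of "e/2"] by force
  qed
  then show ?thesis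
    using F fL2 unfolding L2lim_def by blast
qed

section \<open>Orthogonality and completeness of the cosines\<close>

lemma integrable_mult_bounded:
  fixes p h :: "'a \<Rightarrow> real"
  assumes "integrable M p" "h \<in> borel_measurable M" "\<And>x. x \<in> space M \<Longrightarrow> \<bar>h x\<bar> \<le> B"
  shows "integrable M (\<lambda>x. p x * h x)"
proof (rule Bochner_Integration.integrable_bound)
  show "integrable M (\<lambda>x. B * \<bar>p x\<bar>)"
    using assms(1) by simp
  show "(\<lambda>x. p x * h x) \<in> borel_measurable M"
    using assms(1,2) by measurable
  have "\<bar>p x * h x\<bar> \<le> \<bar>B * \<bar>p x\<bar>\<bar>" if "x \<in> space M" for x
  proof -
    have "\<bar>p x * h x\<bar> \<le> B * \<bar>p x\<bar>"
      using mult_right_mono[OF assms(3)[OF that], of "\<bar>p x\<bar>"] by (simp add: abs_mult mult.commute)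
    then show ?thesis
      by linarith
  qed
  then show "AE x in M. norm (p x * h x) \<le> norm (B * \<bar>p x\<bar>)"
    by simp
qed

text \<open>The continuous functions \<open>max 0 (1 - n * infdist x K)\<close> take values in
  \<open>[0, 1]\<close> and tend to the indicator of the closed set \<open>K\<close>; dominated
  convergence with majorant \<open>\<bar>p\<bar>\<close> does the rest.\<close>

lemma integral_closed_zero:
  fixes p :: "'a::euclidean_space \<Rightarrow> real"
  assumes p: "integrable (lebesgue_on S) p"
    and orth: "\<And>h. continuous_on UNIV h \<Longrightarrow> (\<And>x. \<bar>h x\<bar> \<le> 1) \<Longrightarrow>
      (LINT x|lebesgue_on S. p x * h x) = 0"
    and K: "closed K"
  shows "(LINT x|lebesgue_on S. p x * indicator K x) = 0"
proof (cases "K = {}")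
  \<comment> \<open>\<open>infdist x {}\<close> is 0 by convention, so the approximation is only
    valid for nonempty \<open>K\<close>.\<close>
  case False
  define h where "h n x = max 0 (1 - real n * infdist x K)" for n x
  have cont: "continuous_on UNIV (h n)" for n
    unfolding h_def[abs_def] by (intro continuous_intros)
  have hle: "\<bar>h n x\<bar> \<le> 1" for n x
    by (simp add: h_def infdist_nonneg)
  have h_meas: "h n \<in> borel_measurable (lebesgue_on S)" for n
  proof -
    have "h n \<in> borel_measurable lborel"
      using borel_measurable_continuous_onI[OF cont[of n]] by simp
    then show ?thesis
      by (intro measurable_restrict_space1 measurable_completion)
  qed
  have lim: "(\<lambda>n. h n x) \<longlonglongrightarrow> indicator K x" for x
  proof (cases "x \<in> K")
    case True
    then show ?thesis by (simp add: h_def)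
  next
    case False
    then have pos: "infdist x K > 0"
      using in_closed_iff_infdist_zero[OF K \<open>K \<noteq> {}\<close>, of x] infdist_nonneg[of x K] by linarith
    then obtain N where N: "real N > 1 / infdist x K"
      using reals_Archimedean2 by blast
    have "h n x = 0" if "n \<ge> N" for n
    proof -
      have "1 / infdist x K \<le> real n"
        using N that by linarith
      then show ?thesis
        using pos by (simp add: h_def field_simps)
    qed
    then show ?thesis
      using False by (auto intro!: tendsto_eventually eventually_sequentiallyI[of N])
  qed
  have "(\<lambda>n. LINT x|lebesgue_on S. p x * h n x) \<longlonglongrightarrow> (LINT x|lebesgue_on S. p x * indicator K x)"
  proof (rule integral_dominated_convergence[where w = "\<lambda>x. \<bar>p x\<bar>"])
    show "AE x in lebesgue_on S. (\<lambda>n. p x * h n x) \<longlonglongrightarrow> p x * indicator K x"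
      by (intro AE_I2 tendsto_intros lim)
    have "\<bar>p x\<bar> * \<bar>h n x\<bar> \<le> \<bar>p x\<bar>" for n x
      using mult_left_mono[OF hle[of n x] abs_ge_zero[of "p x"]] by simp
    then show "AE x in lebesgue_on S. norm (p x * h n x) \<le> \<bar>p x\<bar>" for n
      by (simp add: abs_mult)
    show m: "(\<lambda>x. p x * h n x) \<in> borel_measurable (lebesgue_on S)" for n
      using p h_meas by measurable
    show "(\<lambda>x. p x * indicator K x) \<in> borel_measurable (lebesgue_on S)"
      by (rule borel_measurable_LIMSEQ_real[where u = "\<lambda>n x. p x * h n x", OF _ m]) (intro tendsto_intros lim)
  qed (use p in simp)
  then show ?thesis
    using orth[OF cont hle] by (simp add: LIMSEQ_const_iff)
qed simp

text \<open>Up to a null set, the set where \<open>p > 0\<close> is a countable union of compact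
  sets. On each of them \<open>p\<close> is positive with integral 0, so each of them is
  null.\<close>

lemma AE_nonpos_if_orthogonal:
  fixes p :: "'a::euclidean_space \<Rightarrow> real"
  assumes S: "S \<in> sets lebesgue" and p: "integrable (lebesgue_on S) p"
    and orth: "\<And>h. continuous_on UNIV h \<Longrightarrow> (\<And>x. \<bar>h x\<bar> \<le> 1) \<Longrightarrow>
      (LINT x|lebesgue_on S. p x * h x) = 0"
  shows "AE x in lebesgue_on S. p x \<le> 0"
proof -
  have "{x \<in> space (lebesgue_on S). p x > 0} \<in> sets (lebesgue_on S)"
    using p by measurable
  then have "{x \<in> S. p x > 0} \<in> sets lebesgue"
    using S by (auto simp: sets_restrict_space_iff)
  then obtain C T where C: "fsigma C" and T: "T \<in> null_sets lebesgue" and CT: "C \<union> T = {x \<in> S. p x > 0}"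
    by (rule lebesgue_set_almost_fsigma)
  obtain F :: "nat \<Rightarrow> 'a set" where F: "range F \<subseteq> Collect compact" "C = \<Union> (range F)"
    using fsigma_Union_compact C by metis
  have "AE x in lebesgue_on S. x \<notin> F n" for n
  proof -
    have cl: "closed (F n)"
      using F(1) by (auto intro: compact_imp_closed)
    have sub: "F n \<subseteq> {x \<in> S. p x > 0}"
      using F(2) CT by auto
    have m: "(indicator (F n) :: 'a \<Rightarrow> real) \<in> borel_measurable (lebesgue_on S)"
      using cl by (intro measurable_restrict_space1 borel_measurable_indicator) auto
    have int: "integrable (lebesgue_on S) (\<lambda>x. p x * indicator (F n) x)"
      using p m by (rule integrable_mult_bounded[where B = 1]) (simp add: indicator_def)
    have "(LINT x|lebesgue_on S. p x * indicator (F n) x) = 0"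
      by (rule integral_closed_zero[OF p _ cl]) (rule orth)
    moreover have "AE x in lebesgue_on S. 0 \<le> p x * indicator (F n) x"
      using sub by (intro AE_I2) (auto simp: indicator_def less_imp_le)
    ultimately have "AE x in lebesgue_on S. p x * indicator (F n) x = 0"
      using integral_nonneg_eq_0_iff_AE[OF int] by simp
    then show ?thesis
      by eventually_elim (use sub in \<open>auto simp: indicator_def split: if_splits\<close>)
  qed
  then have "AE x in lebesgue_on S. \<forall>n. x \<notin> F n"
    by (simp add: AE_all_countable)
  moreover have "AE x in lebesgue_on S. x \<notin> T"
    using AE_not_in[OF T] S by (subst AE_restrict_space_iff) auto
  moreover have "AE x in lebesgue_on S. x \<in> S"
    by (rule AE_I2) simp
  ultimately show ?thesis
  proof eventually_elim
    case (elim x)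
    then have "x \<notin> C \<union> T"
      using F(2) by auto
    then show ?case
      using elim(3) CT by auto
  qed
qed

lemma AE_zero_if_orthogonal:
  fixes p :: "'a::euclidean_space \<Rightarrow> real"
  assumes S: "S \<in> sets lebesgue" and p: "integrable (lebesgue_on S) p"
    and orth: "\<And>h. continuous_on UNIV h \<Longrightarrow> (\<And>x. \<bar>h x\<bar> \<le> 1) \<Longrightarrow>
      (LINT x|lebesgue_on S. p x * h x) = 0"
  shows "AE x in lebesgue_on S. p x = 0"
proof -
  have "AE x in lebesgue_on S. p x \<le> 0"
    using assms by (rule AE_nonpos_if_orthogonal)
  moreover have "AE x in lebesgue_on S. - p x \<le> 0"
    using orth by (intro AE_nonpos_if_orthogonal[OF S]) (simp_all add: p)
  ultimately show ?thesis
    by eventually_elim simp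
qed

section \<open>Stone-Weierstrass and the completeness of cosine systems\<close>

inductive_set lspan :: "('a \<Rightarrow> real) set \<Rightarrow> ('a \<Rightarrow> real) set" for B where
  base: "b \<in> B \<Longrightarrow> b \<in> lspan B"
| add: "f \<in> lspan B \<Longrightarrow> g \<in> lspan B \<Longrightarrow> (\<lambda>x. f x + g x) \<in> lspan B"
| scale: "f \<in> lspan B \<Longrightarrow> (\<lambda>x. c * f x) \<in> lspan B"

lemma lspan_mult:
  assumes B: "\<And>b b'. b \<in> B \<Longrightarrow> b' \<in> B \<Longrightarrow> (\<lambda>x. b x * b' x) \<in> lspan B"
    and f: "f \<in> lspan B" and g: "g \<in> lspan B"
  shows "(\<lambda>x. f x * g x) \<in> lspan B"
  using f
proof induction
  case (base b)
  from g show ?case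
  proof induction
    case (add f g)
    then show ?case
      using lspan.add[OF add(3,4)] by (simp add: distrib_left)
  next
    case (scale f c)
    then show ?case
      using lspan.scale[OF scale(2), of c] by (simp add: mult.left_commute)
  qed (use base B in auto)
next
  case (add f g)
  then show ?case
    using lspan.add[OF add(3,4)] by (simp add: distrib_right)
next
  case (scale f c)
  then show ?case
    using lspan.scale[OF scale(2), of c] by (simp add: mult.assoc)
qed

text \<open>The linear span of \<open>B\<close> is an algebra containing the constants and
  separating the points of the compact set \<open>K\<close>, so it is uniformly dense in the
  continuous functions on \<open>K\<close>. Integrability of \<open>p\<close> carries orthogonality
  through uniform limits.\<close>

lemma AE_zero_if_orthogonal_to_algebra:
  fixes p :: "'a::euclidean_space \<Rightarrow> real"
  assumes K: "compact K" and S: "S \<in> sets lebesgue" "S \<subseteq> K"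
    and p: "integrable (lebesgue_on S) p"
    and cont: "\<And>b. b \<in> B \<Longrightarrow> continuous_on K b" and one: "(\<lambda>x. 1) \<in> B"
    and mult: "\<And>b b'. b \<in> B \<Longrightarrow> b' \<in> B \<Longrightarrow> (\<lambda>x. b x * b' x) \<in> lspan B"
    and sep: "\<And>x y. x \<in> K \<Longrightarrow> y \<in> K \<Longrightarrow> x \<noteq> y \<Longrightarrow> \<exists>b\<in>B. b x \<noteq> b y"
    and orth: "\<And>b. b \<in> B \<Longrightarrow> (LINT x|lebesgue_on S. p x * b x) = 0"
  shows "AE x in lebesgue_on S. p x = 0"
proof (rule AE_zero_if_orthogonal[OF S(1) p])
  have span_cont: "continuous_on K f" if "f \<in> lspan B" for f
    using that by induction (auto intro: continuous_on_add continuous_on_mult_left cont)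
  have int: "integrable (lebesgue_on S) (\<lambda>x. p x * f x)" if f: "continuous_on K f" for f
  proof -
    obtain C where "\<And>x. x \<in> K \<Longrightarrow> \<bar>f x\<bar> \<le> C"
      using compact_imp_bounded[OF compact_continuous_image[OF f K]]
      by (auto simp: bounded_iff)
    moreover have "f \<in> borel_measurable (lebesgue_on S)"
      using continuous_on_subset[OF f S(2)] S(1) by (rule continuous_imp_measurable_on_sets_lebesgue)
    ultimately show ?thesis
      using S(2) by (intro integrable_mult_bounded[OF p, where B = C]) auto
  qed
  have span_orth: "(LINT x|lebesgue_on S. p x * f x) = 0" if "f \<in> lspan B" for f
    using that
  proof induction
    case (add f g)
    then show ?case
      by (simp add: distrib_left int span_cont)
  next
    case (scale f c)
    then show ?case
      by (simp add: mult.left_commute[of _ c])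
  qed (simp add: orth)
  interpret function_ring_on "lspan B" K
  proof
    show "(\<lambda>_. c) \<in> lspan B" for c
      using lspan.scale[OF lspan.base[OF one], of c] by simp
    show "\<exists>f\<in>lspan B. f x \<noteq> f y" if "x \<in> K" "y \<in> K" "x \<noteq> y" for x y
      using sep[OF that] lspan.base by blast
  qed (use K span_cont mult in \<open>auto intro: lspan.add lspan_mult\<close>)
  fix h :: "'a \<Rightarrow> real"
  assume h: "continuous_on UNIV h"
  let ?P = "LINT x|lebesgue_on S. \<bar>p x\<bar>"
  have hK: "continuous_on K h"
    using h continuous_on_subset by blast
  have "\<bar>LINT x|lebesgue_on S. p x * h x\<bar> \<le> e" if "e > 0" for e
  proof -
    \<comment> \<open>The summand 1 keeps the tolerance meaningful when the \<open>L1\<close> norm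
      \<open>?P\<close> of \<open>p\<close> is 0.\<close>
    have "e / (?P + 1) > 0"
      using that by (intro divide_pos_pos add_nonneg_pos) auto
    from Stone_Weierstrass_basic[OF hK this] obtain g where g: "g \<in> lspan B"
      and hg: "\<And>x. x \<in> K \<Longrightarrow> \<bar>h x - g x\<bar> < e / (?P + 1)" by blast
    have "(LINT x|lebesgue_on S. p x * h x) = (LINT x|lebesgue_on S. p x * (h x - g x))"
      using span_orth[OF g] int[OF hK] int[OF span_cont[OF g]] by (simp add: right_diff_distrib)
    also have "\<bar>\<dots>\<bar> \<le> (LINT x|lebesgue_on S. e / (?P + 1) * \<bar>p x\<bar>)"
    proof (rule integral_abs_bound_integral)
      show "integrable (lebesgue_on S) (\<lambda>x. p x * (h x - g x))"
        by (intro int continuous_on_diff hK span_cont g)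
      show "integrable (lebesgue_on S) (\<lambda>x. e / (?P + 1) * \<bar>p x\<bar>)"
        using p by simp
      fix x assume "x \<in> space (lebesgue_on S)"
      then have "x \<in> K" using S by auto
      then have "\<bar>h x - g x\<bar> * \<bar>p x\<bar> \<le> e / (?P + 1) * \<bar>p x\<bar>"
        using hg by (intro mult_right_mono) (auto simp: less_imp_le)
      then show "\<bar>p x * (h x - g x)\<bar> \<le> e / (?P + 1) * \<bar>p x\<bar>"
        by (simp add: abs_mult mult.commute)
    qed
    also have "\<dots> = e * (?P / (?P + 1))"
      by simp
    also have "\<dots> \<le> e * 1"
    proof (rule mult_left_mono)
      have frac: "t / (t + 1) \<le> 1" if "t \<ge> 0" for t :: real
        using that by simp
      show "?P / (?P + 1) \<le> 1"
        by (rule frac) simp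
    qed (use that in simp)
    finally show ?thesis by simp
  qed
  then have "\<bar>LINT x|lebesgue_on S. p x * h x\<bar> \<le> 0"
    by (rule field_le_epsilon) simp
  then show "(LINT x|lebesgue_on S. p x * h x) = 0"
    by simp
qed

text \<open>The difference frequency is written as a natural number so that a product of two members
  of the cosine family lies in the span of the same family.\<close>

lemma cos_nat_mult_cos:
  "cos (real j * t) * cos (real k * t)
    = (cos (real (nat \<bar>int j - int k\<bar>) * t) + cos (real (j + k) * t)) / 2"
proof -
  have "cos (real j * t - real k * t) = cos (real (nat \<bar>int j - int k\<bar>) * t)"
  proof (cases "k \<le> j")
    case True
    then have "real (nat \<bar>int j - int k\<bar>) = real j - real k" by simp
    then show ?thesis by (simp add: left_diff_distrib)
  next
    case False
    then have "real (nat \<bar>int j - int k\<bar>) = real k - real j" by simp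
    then have "real (nat \<bar>int j - int k\<bar>) * t = - (real j * t - real k * t)"
      by (simp add: left_diff_distrib)
    then show ?thesis by (metis cos_minus)
  qed
  then show ?thesis
    by (simp add: cos_times_cos distrib_right)
qed

text \<open>Cosines suffice, without sines, because \<open>cos\<close> is injective on
  \<open>{0..pi}\<close>: frequency 1 alone separates the points.\<close>

lemma cos_complete_interval:
  assumes p: "p \<in> L2 {0..pi}" and orth: "\<And>k::nat. ip {0..pi} p (\<lambda>x. cos (k * x)) = 0"
  shows "AE x in lebesgue_on {0..pi}. p x = 0"
proof (rule AE_zero_if_orthogonal_to_algebra[where K = "{0..pi}"
      and B = "range (\<lambda>(k::nat) (x::real). cos (k * x))"])
  show "integrable (lebesgue_on {0..pi}) p"
    using p by (rule L2_imp_integrable[rotated]) simp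
  show "(\<lambda>x. 1) \<in> range (\<lambda>(k::nat) (x::real). cos (k * x))"
    by (rule image_eqI[of _ _ 0]) auto
  fix b b' :: "real \<Rightarrow> real"
  assume "b \<in> range (\<lambda>(k::nat) (x::real). cos (k * x))" "b' \<in> range (\<lambda>(k::nat) (x::real). cos (k * x))"
  then obtain j k :: nat where b: "b = (\<lambda>x::real. cos (j * x))" "b' = (\<lambda>x::real. cos (k * x))"
    by auto
  have "(\<lambda>x. (1/2) * (cos (real (nat \<bar>int j - int k\<bar>) * x) + cos (real (j + k) * x)))
      \<in> lspan (range (\<lambda>(k::nat) (x::real). cos (k * x)))"
    by (intro lspan.scale lspan.add lspan.base rangeI)
  also have "(\<lambda>x. (1/2) * (cos (real (nat \<bar>int j - int k\<bar>) * x) + cos (real (j + k) * x)))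
      = (\<lambda>x. b x * b' x)"
    unfolding b(1) b(2) cos_nat_mult_cos[of j _ k] by (rule ext) (rule times_divide_eq_left[THEN trans], simp only: mult_1_left)
  finally show "(\<lambda>x. b x * b' x) \<in> lspan (range (\<lambda>(k::nat) (x::real). cos (k * x)))" .
next
  fix x y :: real
  assume "x \<in> {0..pi}" "y \<in> {0..pi}" "x \<noteq> y"
  then have "cos (real 1 * x) \<noteq> cos (real 1 * y)"
    using cos_inj_pi[of x y] by auto
  then show "\<exists>b\<in>range (\<lambda>(k::nat) (x::real). cos (k * x)). b x \<noteq> b y"
    by (intro bexI[where x = "\<lambda>x. cos (real 1 * x)"] image_eqI[where x = 1] refl UNIV_I)
qed (use orth in \<open>auto simp: ip_def intro!: continuous_intros\<close>)

lemma Omega_lmeasurable [simp]: "Omega ell \<in> lmeasurable" "Omega ell \<in> sets lebesgue"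
proof -
  have "open (Omega ell)" "bounded (Omega ell)"
    by (auto simp: Omega_def intro!: open_Times bounded_Times)
  then show "Omega ell \<in> lmeasurable" "Omega ell \<in> sets lebesgue"
    by (auto intro: lmeasurable_open lebesgue_openin)
qed

text \<open>The scaling \<open>pi / ell\<close> maps the vertical side to \<open>{0..pi}\<close>,
  where \<open>cos\<close> is injective, so frequency 1 in either variable separates points that
  differ in it. Used both for the uniqueness of weak derivatives and for the uniqueness of
  solutions.\<close>

lemma cos_complete_rectangle:
  assumes ell: "ell > 0" and p: "p \<in> L2 (Omega ell)"
    and orth: "\<And>(k::nat) (j::nat). ip (Omega ell) p (\<lambda>(x, y). cos (k * x) * cos (j * (pi / ell * y))) = 0"
  shows "AE z in lebesgue_on (Omega ell). p z = 0"
proof -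
  define e :: "nat \<times> nat \<Rightarrow> real \<times> real \<Rightarrow> real"
    where "e = (\<lambda>(k, j) (x, y). cos (k * x) * cos (j * (pi / ell * y)))"
  show ?thesis
  proof (rule AE_zero_if_orthogonal_to_algebra[where K = "{0..pi} \<times> {0..ell}" and B = "range e"])
    show "integrable (lebesgue_on (Omega ell)) p"
      using p by (rule L2_imp_integrable[rotated]) simp
    show "Omega ell \<subseteq> {0..pi} \<times> {0..ell}"
      by (auto simp: Omega_def)
    show "compact ({0..pi} \<times> {0..ell})"
      by (intro compact_Times) auto
    show "(\<lambda>x. 1) \<in> range e"
      by (rule image_eqI[of _ _ "(0, 0)"]) (auto simp: e_def)
    show "continuous_on ({0..pi} \<times> {0..ell}) b" if "b \<in> range e" for b
      using that ell by (auto simp: e_def case_prod_unfold intro!: continuous_intros)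
    show "(LINT z|lebesgue_on (Omega ell). p z * b z) = 0" if "b \<in> range e" for b
      using that orth by (auto simp: e_def ip_def)
    fix b b' :: "real \<times> real \<Rightarrow> real"
    assume "b \<in> range e" "b' \<in> range e"
    then obtain k j k' j' where b: "b = e (k, j)" "b' = e (k', j')"
      by auto
    have quarter: "((a + b) / 2) * ((c + d) / 2) = (1/4) * (a * c + (a * d + (b * c + b * d)))"
      for a b c d :: real
      by (simp add: field_simps)
    let ?m = "\<lambda>a b. nat \<bar>int a - int b\<bar>"
    have "(\<lambda>z. (1/4) * (e (?m k k', ?m j j') z + (e (?m k k', j + j') z
        + (e (k + k', ?m j j') z + e (k + k', j + j') z)))) \<in> lspan (range e)"
      by (intro lspan.scale lspan.add lspan.base rangeI)
    moreover have "b z * b' z = (1/4) * (e (?m k k', ?m j j') z + (e (?m k k', j + j') z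
        + (e (k + k', ?m j j') z + e (k + k', j + j') z)))" for z
    proof -
      obtain x y where z: "z = (x, y)" by (cases z)
      have "b z * b' z = (cos (k * x) * cos (k' * x)) * (cos (j * (pi / ell * y)) * cos (j' * (pi / ell * y)))"
        by (simp add: b z e_def)
      also have "\<dots> = (1/4) * (e (?m k k', ?m j j') z + (e (?m k k', j + j') z
        + (e (k + k', ?m j j') z + e (k + k', j + j') z)))"
        unfolding cos_nat_mult_cos quarter by (simp only: z e_def prod.case)
      finally show ?thesis .
    qed
    ultimately show "(\<lambda>z. b z * b' z) \<in> lspan (range e)"
      by (simp only:)
  next
    fix z w :: "real \<times> real"
    assume z: "z \<in> {0..pi} \<times> {0..ell}" and w: "w \<in> {0..pi} \<times> {0..ell}" and "z \<noteq> w"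
    consider "fst z \<noteq> fst w" | "snd z \<noteq> snd w"
      using \<open>z \<noteq> w\<close> by (auto simp: prod_eq_iff)
    then show "\<exists>b\<in>range e. b z \<noteq> b w"
    proof cases
      case 1
      then have "e (1, 0) z \<noteq> e (1, 0) w"
        using z w cos_inj_pi[of "fst z" "fst w"] by (auto simp: e_def)
      then show ?thesis by blast
    next
      case 2
      have "0 \<le> pi / ell * t \<and> pi / ell * t \<le> pi" if "0 \<le> t" "t \<le> ell" for t
        using that ell by (auto simp: field_simps)
      then have "cos (pi / ell * snd z) \<noteq> cos (pi / ell * snd w)"
        using z w 2 ell cos_inj_pi[of "pi / ell * snd z" "pi / ell * snd w"]
        by (auto simp: mem_Times_iff)
      then have "e (0, 1) z \<noteq> e (0, 1) w"
        by (auto simp: e_def case_prod_unfold)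
      then show ?thesis by blast
    qed
  qed simp
qed

section \<open>Smooth functions and cutoffs\<close>

definition pd :: "'a::real_normed_vector \<Rightarrow> ('a \<Rightarrow> real) \<Rightarrow> 'a \<Rightarrow> real" where
  "pd b f x = frechet_derivative f (at x) b"

lemma pd_eqI: "(f has_derivative f') (at x) \<Longrightarrow> pd b f x = f' b"
  by (simp add: pd_def flip: frechet_derivative_at)

lemma C_k_Suc:
  "C_k (Suc n) f \<longleftrightarrow> f differentiable_on UNIV \<and> (\<forall>b\<in>Basis. C_k n (pd b f))"
  by (simp add: pd_def[abs_def])

declare C_k.simps(2) [simp del]

lemma C_k_SucD: "C_k (Suc n) f \<Longrightarrow> C_k n f"
proof (induction n arbitrary: f)
  case 0
  then show ?case by (simp add: C_k_Suc differentiable_imp_continuous_on)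
next
  case (Suc n)
  then show ?case by (subst C_k_Suc) (auto simp: C_k_Suc[of "Suc n"])
qed

lemma differentiable_has_derivative:
  "f differentiable_on UNIV \<Longrightarrow> (f has_derivative frechet_derivative f (at x)) (at x)"
  by (simp add: differentiable_on_def frechet_derivative_works)

lemma pd_add:
  assumes "f differentiable_on UNIV" "g differentiable_on UNIV"
  shows "pd b (\<lambda>x. f x + g x) = (\<lambda>x. pd b f x + pd b g x)"
proof
  fix x
  show "pd b (\<lambda>x. f x + g x) x = pd b f x + pd b g x"
    using pd_eqI[OF has_derivative_add[OF assms[THEN differentiable_has_derivative]]]
    by (simp add: pd_def)
qed

lemma pd_mult:
  assumes "f differentiable_on UNIV" "g differentiable_on UNIV"
  shows "pd b (\<lambda>x. f x * g x) = (\<lambda>x. f x * pd b g x + pd b f x * g x)"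
proof
  fix x
  show "pd b (\<lambda>x. f x * g x) x = f x * pd b g x + pd b f x * g x"
    using pd_eqI[OF has_derivative_mult[OF assms[THEN differentiable_has_derivative]]]
    by (simp add: pd_def)
qed

lemma C_k_const: "C_k n (\<lambda>x. c)"
proof (induction n arbitrary: c)
  case (Suc n)
  have "pd b (\<lambda>x::'a. c) = (\<lambda>x. 0)" for b
    by (simp add: pd_def[abs_def])
  then show ?case using Suc by (simp add: C_k_Suc)
qed simp

lemma C_k_add: "C_k n f \<Longrightarrow> C_k n g \<Longrightarrow> C_k n (\<lambda>x. f x + g x)"
proof (induction n arbitrary: f g)
  case 0
  then show ?case by (auto intro: continuous_on_add)
next
  case (Suc n)
  then show ?case by (auto simp: C_k_Suc pd_add intro: differentiable_on_add)
qed

lemma C_k_mult: "C_k n f \<Longrightarrow> C_k n g \<Longrightarrow> C_k n (\<lambda>x. f x * g x)"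
proof (induction n arbitrary: f g)
  case 0
  then show ?case by (auto intro: continuous_on_mult)
next
  case (Suc n)
  from Suc.prems[THEN C_k_SucD] Suc.prems show ?case
    by (auto simp: C_k_Suc pd_mult intro!: C_k_add Suc.IH differentiable_on_mult)
qed

text \<open>A tower \<open>d\<close> of successive derivatives replaces a general chain rule: a
  partial derivative of \<open>d m (L z + c)\<close> is \<open>d (Suc m) (L z + c)\<close> times a
  constant, so the induction on \<open>n\<close> closes because \<open>m\<close> is
  arbitrary.\<close>

lemma C_k_comp_linear:
  assumes d: "\<And>n t. (d n has_real_derivative d (Suc n) t) (at t)"
    and L: "bounded_linear L"
  shows "C_k n (\<lambda>z. d m (L z + c))"
proof (induction n arbitrary: m)
  case 0
  have "continuous_on UNIV (d m)"
    using d by (intro continuous_at_imp_continuous_on) (auto intro: DERIV_isCont)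
  moreover have "continuous_on UNIV (\<lambda>z. L z + c)"
    by (intro continuous_on_add linear_continuous_on L continuous_on_const)
  ultimately show ?case
    by (auto intro: continuous_on_compose2)
next
  case (Suc n)
  have der: "((\<lambda>z. d m (L z + c)) has_derivative (\<lambda>v. d (Suc m) (L z + c) * L v)) (at z)" for z
  proof -
    have "((\<lambda>z. L z + c) has_derivative L) (at z)"
      using has_derivative_add_const[OF bounded_linear_imp_has_derivative[OF L]] .
    then show ?thesis
      using has_derivative_compose[of "\<lambda>z. L z + c" L z UNIV "d m" "\<lambda>v. d (Suc m) (L z + c) * v"]
        d[of m "L z + c"] by (simp add: has_field_derivative_def)
  qed
  have "(\<lambda>z. d m (L z + c)) differentiable_on UNIV"
    unfolding differentiable_on_def using der by (auto simp: differentiable_def)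
  moreover have "pd b (\<lambda>z. d m (L z + c)) = (\<lambda>z. d (Suc m) (L z + c) * L b)" for b
    using pd_eqI[OF der] by blast
  ultimately show ?case
    using Suc by (simp add: C_k_Suc C_k_mult C_k_const)
qed

lemma smooth_const [simp]: "smooth (\<lambda>x. c)"
  by (simp add: smooth_def C_k_const)

lemma smooth_add: "smooth f \<Longrightarrow> smooth g \<Longrightarrow> smooth (\<lambda>x. f x + g x)"
  by (simp add: smooth_def C_k_add)

lemma smooth_mult: "smooth f \<Longrightarrow> smooth g \<Longrightarrow> smooth (\<lambda>x. f x * g x)"
  by (simp add: smooth_def C_k_mult)

lemma smooth_cmult: "smooth f \<Longrightarrow> smooth (\<lambda>x. c * f x)"
  by (simp add: smooth_mult)

lemma smooth_diff: "smooth f \<Longrightarrow> smooth g \<Longrightarrow> smooth (\<lambda>x. f x - g x)"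
  using smooth_add[of f "\<lambda>x. (-1) * g x"] smooth_cmult[of g "-1"] by simp

lemma smooth_sum: "(\<And>i. i \<in> A \<Longrightarrow> smooth (F i)) \<Longrightarrow> smooth (\<lambda>x. \<Sum>i\<in>A. F i x)"
  by (induction A rule: infinite_finite_induct) (auto intro: smooth_add)

lemma smooth_divide: "smooth f \<Longrightarrow> smooth (\<lambda>x. f x / c)"
  using smooth_cmult[of f "1 / c"] by simp

lemma smooth_comp_linear:
  "(\<And>n t. (d n has_real_derivative d (Suc n) t) (at t)) \<Longrightarrow> bounded_linear L \<Longrightarrow>
    smooth (\<lambda>z. d m (L z + c))"
  by (simp add: smooth_def C_k_comp_linear)

lemma smooth_differentiable: "smooth f \<Longrightarrow> f differentiable_on UNIV"
  unfolding smooth_def using C_k_Suc by blast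

lemma smooth_continuous: "smooth f \<Longrightarrow> continuous_on S f"
  using smooth_differentiable[of f] differentiable_imp_continuous_on continuous_on_subset by blast

lemma smooth_pd: "smooth f \<Longrightarrow> b \<in> Basis \<Longrightarrow> smooth (pd b f)"
  unfolding smooth_def using C_k_Suc by blast

section \<open>Partial derivatives in the plane and elementary smooth functions\<close>

lemma Basis_real_prod: "(Basis :: (real \<times> real) set) = {(1, 0), (0, 1)}"
  by (auto simp: Basis_prod_def)

definition px :: "(real \<times> real \<Rightarrow> real) \<Rightarrow> real \<times> real \<Rightarrow> real" where "px = pd (1, 0)"
definition py :: "(real \<times> real \<Rightarrow> real) \<Rightarrow> real \<times> real \<Rightarrow> real" where "py = pd (0, 1)"

lemma smooth_px: "smooth f \<Longrightarrow> smooth (px f)"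
  by (simp add: px_def smooth_pd Basis_real_prod)

lemma smooth_py: "smooth f \<Longrightarrow> smooth (py f)"
  by (simp add: py_def smooth_pd Basis_real_prod)

lemma px_has_derivative:
  assumes "smooth f"
  shows "((\<lambda>x. f (x, y)) has_real_derivative px f (x, y)) (at x)"
proof -
  let ?D = "frechet_derivative f (at (x, y))"
  have D: "(f has_derivative ?D) (at (x, y))"
    using assms by (intro differentiable_has_derivative smooth_differentiable)
  have "((\<lambda>x. (x, y)) has_derivative (\<lambda>h. (h, 0))) (at x)"
    by (auto intro!: derivative_eq_intros)
  from has_derivative_compose[OF this D]
  have "((\<lambda>x. f (x, y)) has_derivative (\<lambda>h. ?D (h, 0))) (at x)" .
  moreover have "?D (h, 0) = px f (x, y) * h" for h
    using linear_scale[OF has_derivative_linear[OF D], of h "(1, 0)"] by (simp add: px_def pd_def)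
  ultimately show ?thesis
    by (simp add: has_field_derivative_def)
qed

lemma py_has_derivative:
  assumes "smooth f"
  shows "((\<lambda>y. f (x, y)) has_real_derivative py f (x, y)) (at y)"
proof -
  let ?D = "frechet_derivative f (at (x, y))"
  have D: "(f has_derivative ?D) (at (x, y))"
    using assms by (intro differentiable_has_derivative smooth_differentiable)
  have "((\<lambda>y. (x, y)) has_derivative (\<lambda>h. (0, h))) (at y)"
    by (auto intro!: derivative_eq_intros)
  from has_derivative_compose[OF this D]
  have "((\<lambda>y. f (x, y)) has_derivative (\<lambda>h. ?D (0, h))) (at y)" .
  moreover have "?D (0, h) = py f (x, y) * h" for h
    using linear_scale[OF has_derivative_linear[OF D], of h "(0, 1)"] by (simp add: py_def pd_def)
  ultimately show ?thesis
    by (simp add: has_field_derivative_def)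
qed

lemma px_eqI: "smooth f \<Longrightarrow> ((\<lambda>x. f (x, y)) has_real_derivative D) (at x) \<Longrightarrow> px f (x, y) = D"
  using px_has_derivative DERIV_unique by blast

lemma py_eqI: "smooth f \<Longrightarrow> ((\<lambda>y. f (x, y)) has_real_derivative D) (at y) \<Longrightarrow> py f (x, y) = D"
  using py_has_derivative DERIV_unique by blast

lemma px_mult:
  "smooth f \<Longrightarrow> smooth g \<Longrightarrow> px (\<lambda>x. f x * g x) z = f z * px g z + px f z * g z"
  by (simp add: px_def pd_mult smooth_differentiable)

lemma py_mult:
  "smooth f \<Longrightarrow> smooth g \<Longrightarrow> py (\<lambda>x. f x * g x) z = f z * py g z + py f z * g z"
  by (simp add: py_def pd_mult smooth_differentiable)

lemma smooth_linear_cos: assumes "bounded_linear L" shows "smooth (\<lambda>z. cos (L z + c))"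
proof -
  \<comment> \<open>Differentiating a cosine advances its phase by \<open>pi / 2\<close>, so the
    whole tower consists of shifted cosines.\<close>
  have "((\<lambda>t. cos (t + real n * (pi / 2))) has_real_derivative cos (t + real (Suc n) * (pi / 2))) (at t)"
    for n t
  proof -
    have shift: "t + real (Suc n) * (pi / 2) = (t + real n * (pi / 2)) + pi / 2" for t
      by (simp add: field_simps)
    show ?thesis
      unfolding shift cos_add[of _ "pi / 2"] by (auto intro!: derivative_eq_intros)
  qed
  from smooth_comp_linear[where d = "\<lambda>n t. cos (t + real n * (pi / 2))" and m = 0, OF this assms]
  show ?thesis by simp
qed

lemma smooth_linear_exp: "bounded_linear L \<Longrightarrow> smooth (\<lambda>z. exp (L z + c))"
  using smooth_comp_linear[where d = "\<lambda>n. exp" and m = 0] by (auto intro: DERIV_exp)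

lemma smooth_linear_id: assumes "bounded_linear L" shows "smooth (\<lambda>z. L z + c)"
proof -
  define d :: "nat \<Rightarrow> real \<Rightarrow> real" where "d n t = (if n = 0 then t else if n = 1 then 1 else 0)" for n t
  have "(d n has_real_derivative d (Suc n) t) (at t)" for n t
    by (cases n) (auto simp: d_def[abs_def] intro!: derivative_eq_intros)
  from smooth_comp_linear[where d = d and m = 0, OF this assms] show ?thesis
    by (simp add: d_def)
qed

lemma bounded_linear_scaled_fst: "bounded_linear (\<lambda>z::real \<times> real. a * fst z)"
  by (intro bounded_linear_intros)

lemma bounded_linear_scaled_snd: "bounded_linear (\<lambda>z::real \<times> real. a * snd z)"
  by (intro bounded_linear_intros)

lemma smooth_cos_fst: "smooth (\<lambda>z::real \<times> real. cos (a * fst z))"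
  using smooth_linear_cos[OF bounded_linear_scaled_fst, where c = 0] by simp

lemma smooth_sin_fst: "smooth (\<lambda>z::real \<times> real. sin (a * fst z))"
  using smooth_linear_cos[OF bounded_linear_scaled_fst, where c = "- (pi / 2)"]
  by (simp add: cos_diff)

lemma smooth_cos_snd: "smooth (\<lambda>z::real \<times> real. cos (a * snd z))"
  using smooth_linear_cos[OF bounded_linear_scaled_snd, where c = 0] by simp

lemma smooth_snd: "smooth (\<lambda>z::real \<times> real. a * snd z + c)"
  by (rule smooth_linear_id[OF bounded_linear_scaled_snd])

lemma smooth_cosh_snd: "smooth (\<lambda>z::real \<times> real. cosh (a * snd z + c))"
proof -
  have "cosh (a * snd z + c) = (exp (a * snd z + c) + exp ((- a) * snd z + (- c))) / 2"
    for z :: "real \<times> real"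
    by (simp add: cosh_field_def add.commute)
  then show ?thesis
    by (simp only:) (intro smooth_divide smooth_add smooth_linear_exp bounded_linear_scaled_snd)
qed

lemma smooth_sinh_snd: "smooth (\<lambda>z::real \<times> real. sinh (a * snd z + c))"
proof -
  have "sinh (a * snd z + c) = (exp (a * snd z + c) - exp ((- a) * snd z + (- c))) / 2"
    for z :: "real \<times> real"
    by (simp add: sinh_field_def add.commute)
  then show ?thesis
    by (simp only:) (intro smooth_divide smooth_diff smooth_linear_exp bounded_linear_scaled_snd)
qed

section \<open>Flat functions and cutoffs of the rectangle\<close>

definition flat :: "real poly \<Rightarrow> real \<Rightarrow> real" where
  "flat P t = (if t > 0 then poly P (1 / t) * exp (- (1 / t)) else 0)"

lemma poly_mult_exp_minus_tendsto_0: "((\<lambda>s. poly P s * exp (- s)) \<longlongrightarrow> (0::real)) at_top"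
proof -
  have "((\<lambda>s. \<Sum>i\<le>degree P. coeff P i * (s ^ i / exp s)) \<longlongrightarrow> (\<Sum>i\<le>degree P. coeff P i * 0)) at_top"
    by (intro tendsto_intros tendsto_power_div_exp_0)
  then show ?thesis
    by (simp add: poly_altdef exp_minus sum_distrib_right divide_inverse mult.assoc)
qed

text \<open>With \<open>s = 1 / t\<close>, the derivative of \<open>P(s) exp (-s)\<close> in
  \<open>t\<close> is \<open>s\<^sup>2 (P(s) - P'(s)) exp (-s)\<close>. The polynomial parameter
  makes the family closed under differentiation, so that it forms a tower of derivatives.\<close>

lemma flat_has_derivative:
  "(flat P has_real_derivative flat ([:0, 0, 1:] * (P - pderiv P)) t) (at t)"
proof -
  consider "t > 0" | "t < 0" | "t = 0" by linarith
  then show ?thesis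
  proof cases
    case 1
    have "((\<lambda>t. poly P (1 / t) * exp (- (1 / t))) has_real_derivative
        flat ([:0, 0, 1:] * (P - pderiv P)) t) (at t)"
      using 1 by (auto intro!: derivative_eq_intros poly_DERIV[THEN DERIV_chain2]
          simp: flat_def field_simps power2_eq_square)
    then show ?thesis
      by (rule has_field_derivative_transform_within_open[where S = "{0<..}"])
        (use 1 in \<open>auto simp: flat_def\<close>)
  next
    case 2
    have "((\<lambda>t. 0) has_real_derivative flat ([:0, 0, 1:] * (P - pderiv P)) t) (at t)"
      using 2 by (simp add: flat_def)
    then show ?thesis
      by (rule has_field_derivative_transform_within_open[where S = "{..<0}"])
        (use 2 in \<open>auto simp: flat_def\<close>)
  next
    case 3
    \<comment> \<open>From the left the difference quotient at 0 vanishes; from the right it is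
      \<open>s P(s) exp (-s)\<close> with \<open>s = 1 / h\<close> tending to infinity, hence the
      factor \<open>[:0, 1:]\<close>.\<close>
    have "((\<lambda>h. (flat P h - flat P 0) / (h - 0)) \<longlongrightarrow> 0) (at 0)"
    proof (rule filterlim_split_at)
      have "\<forall>\<^sub>F h in at_left 0. (flat P h - flat P 0) / (h - 0) = 0"
        by (auto simp: flat_def eventually_at_filter)
      then show "((\<lambda>h. (flat P h - flat P 0) / (h - 0)) \<longlongrightarrow> 0) (at_left 0)"
        by (rule tendsto_eventually)
      have "((\<lambda>h. poly ([:0, 1:] * P) (inverse h) * exp (- inverse h)) \<longlongrightarrow> 0) (at_right (0::real))"
        by (rule filterlim_compose[OF poly_mult_exp_minus_tendsto_0 filterlim_inverse_at_top_right])
      then show "((\<lambda>h. (flat P h - flat P 0) / (h - 0)) \<longlongrightarrow> 0) (at_right 0)"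
        by (rule Lim_transform_eventually) (auto simp: flat_def eventually_at_filter divide_inverse)
    qed
    then show ?thesis
      using 3 by (simp add: has_field_derivative_iff flat_def)
  qed
qed

lemma smooth_flat_linear:
  assumes "bounded_linear L" shows "smooth (\<lambda>z. flat 1 (L z + c))"
proof -
  define d where "d n = flat (((\<lambda>P. [:0, 0, 1:] * (P - pderiv P)) ^^ n) 1)" for n
  have "(d n has_real_derivative d (Suc n) t) (at t)" for n t
    unfolding d_def using flat_has_derivative by simp
  from smooth_comp_linear[where d = d and m = 0, OF this assms] show ?thesis
    by (simp add: d_def)
qed

lemma flat_1_bounds: "0 \<le> flat 1 t" "flat 1 t \<le> 1"
  by (auto simp: flat_def)

lemma flat_1_eq_0_iff: "flat 1 t = 0 \<longleftrightarrow> t \<le> 0"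
  by (auto simp: flat_def)

lemma flat_1_tendsto:
  assumes "a > 0" shows "(\<lambda>n. flat 1 (real (Suc n) * a - 1)) \<longlonglongrightarrow> 1"
proof -
  have top: "filterlim (\<lambda>n. real (Suc n) * a - 1) at_top sequentially"
  proof -
    have "filterlim (\<lambda>n. real (Suc n)) at_top sequentially"
      by (rule filterlim_compose[OF filterlim_real_sequentially filterlim_Suc])
    from filterlim_tendsto_add_at_top[OF tendsto_const[of "- 1"]
        filterlim_tendsto_pos_mult_at_top[OF tendsto_const assms this]]
    show ?thesis
      by (simp add: mult.commute)
  qed
  have "((\<lambda>s::real. exp (- (1 / s))) \<longlongrightarrow> exp (- 0)) at_top"
    by (intro tendsto_exp tendsto_minus
        tendsto_divide_0[OF tendsto_const filterlim_at_top_imp_at_infinity[OF filterlim_ident]])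
  then have "((\<lambda>s::real. exp (- (1 / s))) \<longlongrightarrow> 1) at_top"
    by simp
  from filterlim_compose[OF this top]
  have "(\<lambda>n. exp (- (1 / (real (Suc n) * a - 1)))) \<longlonglongrightarrow> 1" .
  moreover have "\<forall>\<^sub>F n in sequentially. exp (- (1 / (real (Suc n) * a - 1))) = flat 1 (real (Suc n) * a - 1)"
    using filterlim_at_top_dense[THEN iffD1, OF top, rule_format, of 0]
    by eventually_elim (simp add: flat_def)
  ultimately show ?thesis
    by (rule Lim_transform_eventually)
qed

text \<open>Each factor vanishes where the signed distance to one side is at most
  \<open>1 / Suc n\<close>, and tends to 1 at points of positive distance.\<close>

definition cutoff :: "real \<Rightarrow> nat \<Rightarrow> real \<times> real \<Rightarrow> real" where
  "cutoff ell n z =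
     flat 1 (real (Suc n) * fst z - 1) * flat 1 (real (Suc n) * (pi - fst z) - 1)
     * (flat 1 (real (Suc n) * snd z - 1) * flat 1 (real (Suc n) * (ell - snd z) - 1))"

lemma smooth_cutoff: "smooth (cutoff ell n)"
proof -
  have *: "smooth (\<lambda>z::real \<times> real. flat 1 (a * fst z + c))" "smooth (\<lambda>z::real \<times> real. flat 1 (a * snd z + c))" for a c
    by (rule smooth_flat_linear[OF bounded_linear_scaled_fst] smooth_flat_linear[OF bounded_linear_scaled_snd])+
  have "cutoff ell n = (\<lambda>z. flat 1 (real (Suc n) * fst z + (- 1))
      * flat 1 ((- real (Suc n)) * fst z + (real (Suc n) * pi - 1))
      * (flat 1 (real (Suc n) * snd z + (- 1))
      * flat 1 ((- real (Suc n)) * snd z + (real (Suc n) * ell - 1))))"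
    by (rule ext) (simp add: cutoff_def algebra_simps)
  then show ?thesis
    by (simp only:) (intro smooth_mult *)
qed

lemma cutoff_bounds: "\<bar>cutoff ell n z\<bar> \<le> 1"
  unfolding cutoff_def abs_mult
  by (intro mult_le_one mult_nonneg_nonneg) (auto simp: flat_1_bounds)

lemma cutoff_tendsto:
  assumes "z \<in> Omega ell"
  shows "(\<lambda>n. cutoff ell n z) \<longlonglongrightarrow> 1"
proof -
  have "0 < fst z" "0 < pi - fst z" "0 < snd z" "0 < ell - snd z"
    using assms by (auto simp: Omega_def)
  note * = this[THEN flat_1_tendsto]
  show ?thesis
    unfolding cutoff_def
    using tendsto_mult[OF tendsto_mult[OF *(1,2)] tendsto_mult[OF *(3,4)]] by simp
qed

text \<open>The support lies in the box of points at distance at least \<open>1 / Suc n\<close> from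
  every side. For small \<open>n\<close> this box may be empty, and then the product is identically
  0.\<close>

lemma cutoff_mult_test_function:
  assumes "smooth h"
  shows "(\<lambda>z. cutoff ell n z * h z) \<in> test_functions (Omega ell)"
proof -
  define d where "d = 1 / real (Suc n)"
  have d: "d > 0"
    by (simp add: d_def)
  let ?K = "{d..pi - d} \<times> {d..ell - d}"
  have nonpos: "cutoff ell n z = 0" if "z \<notin> ?K" for z
  proof -
    have "real (Suc n) * a - 1 \<le> 0" if "a < d" for a
      using that by (simp add: d_def field_simps)
    moreover have "fst z < d \<or> pi - fst z < d \<or> snd z < d \<or> ell - snd z < d"
      using that by (auto simp: mem_Times_iff not_le)
    ultimately show ?thesis
      unfolding cutoff_def mult_eq_0_iff flat_1_eq_0_iff by blast
  qed
  have "closed ?K"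
    by (intro closed_Times) auto
  moreover have "{z. cutoff ell n z * h z \<noteq> 0} \<subseteq> ?K"
    using nonpos by auto
  ultimately have sub: "closure {z. cutoff ell n z * h z \<noteq> 0} \<subseteq> ?K"
    by (rule closure_minimal[rotated])
  have "compact ?K"
    by (intro compact_Times) auto
  from compact_Int_closed[OF this closed_closure[of "{z. cutoff ell n z * h z \<noteq> 0}"]]
  have "compact (closure {z. cutoff ell n z * h z \<noteq> 0})"
    unfolding Int_absorb1[OF sub] .
  moreover have "?K \<subseteq> Omega ell"
    using d by (auto simp: Omega_def)
  moreover have "smooth (\<lambda>z. cutoff ell n z * h z)"
    by (intro smooth_mult smooth_cutoff assms)
  ultimately show ?thesis
    using sub unfolding test_functions_def by blast
qed

section \<open>Weak derivatives on the rectangle\<close>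

lemma L2_continuous:
  fixes f :: "'a::euclidean_space \<Rightarrow> real"
  assumes S: "S \<in> lmeasurable" "bounded S" and f: "continuous_on UNIV f"
  shows "f \<in> L2 S"
proof -
  have f_meas: "f \<in> borel_measurable (lebesgue_on S)"
    using S(1) continuous_on_subset[OF f]
    by (intro continuous_imp_measurable_on_sets_lebesgue) auto
  have "compact (f ` closure S)"
    using S(2) by (intro compact_continuous_image continuous_on_subset[OF f]) auto
  then have "bounded (f ` closure S)"
    by (rule compact_imp_bounded)
  then obtain B where "\<forall>x\<in>closure S. \<bar>f x\<bar> \<le> B"
    by (auto simp: bounded_iff)
  then have B: "\<bar>f x\<bar> \<le> B" if "x \<in> closure S" for x
    using that by blast
  have "(f x)\<^sup>2 \<le> B\<^sup>2" if "x \<in> S" for x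
    using power_mono[OF B[of x], of 2] that closure_subset by auto
  moreover have "integrable (lebesgue_on S) (\<lambda>x. 1 :: real)"
    using S(1) by (rule L2_imp_integrable) (use S(1) in
      \<open>simp add: L2_def finite_measure.integrable_const[OF finite_measure_lebesgue_on]\<close>)
  ultimately have "integrable (lebesgue_on S) (\<lambda>x. 1 * (f x)\<^sup>2)"
    using f_meas by (intro integrable_mult_bounded[where B = "B\<^sup>2"]) auto
  then show ?thesis
    using f_meas by (simp add: L2_def)
qed

lemma L2_interval_continuous: "continuous_on UNIV f \<Longrightarrow> f \<in> L2 {a..b::real}"
  by (rule L2_continuous) auto

lemma L2_Omega_continuous: "continuous_on UNIV f \<Longrightarrow> f \<in> L2 (Omega ell)"
  by (rule L2_continuous[OF Omega_lmeasurable(1)]) (auto simp: Omega_def bounded_Times)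

lemma L2_Omega_smooth: "smooth f \<Longrightarrow> f \<in> L2 (Omega ell)"
  by (rule L2_Omega_continuous) (rule smooth_continuous)

lemma smooth_continuous_slice:
  fixes f :: "real \<times> real \<Rightarrow> real"
  shows "smooth f \<Longrightarrow> continuous_on S (\<lambda>x. f (x, y))" "smooth f \<Longrightarrow> continuous_on S (\<lambda>y. f (x, y))"
  by (auto intro!: continuous_on_compose2[OF smooth_continuous[of f UNIV]] continuous_intros)

lemma L2_slice:
  fixes f :: "real \<times> real \<Rightarrow> real"
  shows "smooth f \<Longrightarrow> (\<lambda>x. f (x, y)) \<in> L2 {a..b}"
  by (rule L2_interval_continuous) (rule smooth_continuous_slice)

lemma LINT_interval_continuous:
  fixes f :: "real \<Rightarrow> real"
  shows "continuous_on UNIV f \<Longrightarrow> (LINT x|lebesgue_on {a..b}. f x) = integral {a..b} f"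
  by (rule lebesgue_integral_eq_integral) (auto intro: L2_imp_integrable L2_interval_continuous)

text \<open>Fubini in both orders, because the fundamental theorem of calculus acts on the inner
  integral: in \<open>y\<close> for \<open>integral_py\<close>, in \<open>x\<close> for
  \<open>integral_px\<close>.\<close>

lemma LINT_Omega_continuous:
  fixes f :: "real \<times> real \<Rightarrow> real"
  assumes "continuous_on UNIV f"
  shows "(LINT z|lebesgue_on (Omega ell). f z) = integral {0..pi} (\<lambda>x. integral {0..ell} (\<lambda>y. f (x, y)))"
    and "(LINT z|lebesgue_on (Omega ell). f z) = integral {0..ell} (\<lambda>y. integral {0..pi} (\<lambda>x. f (x, y)))"
proof -
  have box: "Omega ell = box (0, 0) (pi, ell)"
    by (auto simp: Omega_def box_def Basis_real_prod)
  have cont: "continuous_on (cbox (0, 0) (pi, ell)) f"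
    using assms continuous_on_subset by blast
  have "(LINT z|lebesgue_on (Omega ell). f z) = integral (Omega ell) f"
    by (intro lebesgue_integral_eq_integral L2_imp_integrable L2_Omega_continuous assms) simp_all
  also have "\<dots> = integral (cbox (0, 0) (pi, ell)) f"
    unfolding box by (rule integral_open_interval)
  also have "\<dots> = integral {0..pi} (\<lambda>x. integral {0..ell} (\<lambda>y. f (x, y)))"
    using integral_prod_continuous[OF cont] by simp
  finally show 1: "(LINT z|lebesgue_on (Omega ell). f z) = integral {0..pi} (\<lambda>x. integral {0..ell} (\<lambda>y. f (x, y)))" .
  have "continuous_on (cbox (0, 0) (pi, ell)) (\<lambda>(x, y). f (x, y))"
    using cont by simp
  from integral_swap_continuous[OF this]
  show "(LINT z|lebesgue_on (Omega ell). f z) = integral {0..ell} (\<lambda>y. integral {0..pi} (\<lambda>x. f (x, y)))"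
    unfolding 1 by simp
qed

section \<open>Weak gradients on the rectangle\<close>

lemma has_weak_deriv_iff:
  "has_weak_deriv S b u p \<longleftrightarrow> (\<forall>\<phi>\<in>test_functions S. ip S u (pd b \<phi>) = - ip S p \<phi>)"
  by (simp add: has_weak_deriv_def ip_def pd_def)

lemma test_functionD:
  assumes "\<phi> \<in> test_functions S"
  shows "smooth \<phi>" "z \<notin> S \<Longrightarrow> \<phi> z = 0"
  using assms closure_subset[of "{x. \<phi> x \<noteq> 0}"] by (auto simp: test_functions_def)

text \<open>A relation instead of the function \<open>weak_deriv\<close>, whose value is an
  arbitrary choice: gradients of sums and of \<open>L2\<close> limits can then be named
  explicitly.\<close>

definition wgrad ::
    "(real \<times> real) set \<Rightarrow> (real \<times> real \<Rightarrow> real) \<Rightarrow> (real \<times> real \<Rightarrow> real) \<Rightarrow> (real \<times> real \<Rightarrow> real) \<Rightarrow> bool" where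
  "wgrad S u p q \<longleftrightarrow> u \<in> L2 S \<and> p \<in> L2 S \<and> q \<in> L2 S \<and>
     has_weak_deriv S (1, 0) u p \<and> has_weak_deriv S (0, 1) u q"

lemma wgradD: "wgrad S u p q \<Longrightarrow> u \<in> L2 S" "wgrad S u p q \<Longrightarrow> p \<in> L2 S" "wgrad S u p q \<Longrightarrow> q \<in> L2 S"
  by (simp_all add: wgrad_def)

lemma wgrad_imp_H1: "wgrad S u p q \<Longrightarrow> u \<in> H1 S"
  by (auto simp: H1_def wgrad_def Basis_real_prod)

lemma H1_imp_wgrad:
  assumes "u \<in> H1 S"
  shows "wgrad S u (weak_deriv S (1, 0) u) (weak_deriv S (0, 1) u)"
proof -
  have *: "weak_deriv S b u \<in> L2 S \<and> has_weak_deriv S b u (weak_deriv S b u)" if "b \<in> Basis" for b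
  proof -
    have "\<exists>p. p \<in> L2 S \<and> has_weak_deriv S b u p"
      using assms that by (auto simp: H1_def)
    then show ?thesis
      unfolding weak_deriv_def by (rule someI_ex)
  qed
  have "u \<in> L2 S"
    using assms by (simp add: H1_def)
  then show ?thesis
    using *[of "(1, 0)"] *[of "(0, 1)"] unfolding wgrad_def by (simp add: Basis_real_prod)
qed

locale rectangle =
  fixes ell :: real
  assumes ell_pos: "ell > 0"
begin

abbreviation \<Omega> :: "(real \<times> real) set" where "\<Omega> \<equiv> Omega ell"

lemma integral_py:
  assumes W: "smooth W"
  shows "(LINT z|lebesgue_on \<Omega>. py W z)
    = (LINT x|lebesgue_on {0..pi}. W (x, ell)) - (LINT x|lebesgue_on {0..pi}. W (x, 0))"
proof -
  have "integral {0..ell} (\<lambda>y. py W (x, y)) = W (x, ell) - W (x, 0)" for x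
    using ell_pos py_has_derivative[OF W, of x]
    by (intro integral_unique fundamental_theorem_of_calculus[where f = "\<lambda>y. W (x, y)"])
      (auto simp flip: has_real_derivative_iff_has_vector_derivative intro: has_field_derivative_at_within)
  then have "(LINT z|lebesgue_on \<Omega>. py W z) = integral {0..pi} (\<lambda>x. W (x, ell) - W (x, 0))"
    by (simp add: LINT_Omega_continuous(1) smooth_continuous smooth_py W)
  also have "\<dots> = (LINT x|lebesgue_on {0..pi}. W (x, ell) - W (x, 0))"
    by (intro LINT_interval_continuous[symmetric] continuous_on_diff smooth_continuous_slice W)
  also have "\<dots> = (LINT x|lebesgue_on {0..pi}. W (x, ell)) - (LINT x|lebesgue_on {0..pi}. W (x, 0))"
    by (intro Bochner_Integration.integral_diff L2_imp_integrable L2_slice W) auto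
  finally show ?thesis .
qed

lemma integral_px:
  assumes W: "smooth W" and eq: "\<And>y. y \<in> {0..ell} \<Longrightarrow> W (0, y) = 0" "\<And>y. y \<in> {0..ell} \<Longrightarrow> W (pi, y) = 0"
  shows "(LINT z|lebesgue_on \<Omega>. px W z) = 0"
proof -
  have "integral {0..pi} (\<lambda>x. px W (x, y)) = W (pi, y) - W (0, y)" for y
    using px_has_derivative[OF W, of y]
    by (intro integral_unique fundamental_theorem_of_calculus[where f = "\<lambda>x. W (x, y)"])
      (auto simp flip: has_real_derivative_iff_has_vector_derivative intro: has_field_derivative_at_within)
  then have "(LINT z|lebesgue_on \<Omega>. px W z) = integral {0..ell} (\<lambda>y. W (pi, y) - W (0, y))"
    by (simp add: LINT_Omega_continuous(2) smooth_continuous smooth_px W)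
  also have "\<dots> = integral {0..ell} (\<lambda>y. 0)"
    by (rule integral_cong) (simp add: eq)
  finally show ?thesis
    by simp
qed

lemma ibp_y:
  assumes U: "smooth U" and V: "smooth V"
  shows "ip \<Omega> (py U) V = - ip \<Omega> U (py V)
    + ip {0..pi} (\<lambda>x. U (x, ell)) (\<lambda>x. V (x, ell)) - ip {0..pi} (\<lambda>x. U (x, 0)) (\<lambda>x. V (x, 0))"
proof -
  have "(LINT z|lebesgue_on \<Omega>. U z * py V z + py U z * V z) = ip \<Omega> U (py V) + ip \<Omega> (py U) V"
    unfolding ip_def
    by (intro Bochner_Integration.integral_add L2_mult_integrable L2_Omega_smooth smooth_py U V)
  with integral_py[OF smooth_mult[OF U V]] show ?thesis
    by (simp add: py_mult[OF U V] ip_def)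
qed

text \<open>Lateral boundary terms are assumed away: the formula is applied to compactly supported
  test functions and to factors \<open>sin (k x)\<close>, which vanish at 0 and
  \<open>pi\<close>.\<close>

lemma ibp_x:
  assumes U: "smooth U" and V: "smooth V"
    and eq: "\<And>y. y \<in> {0..ell} \<Longrightarrow> U (0, y) * V (0, y) = 0" "\<And>y. y \<in> {0..ell} \<Longrightarrow> U (pi, y) * V (pi, y) = 0"
  shows "ip \<Omega> (px U) V = - ip \<Omega> U (px V)"
proof -
  have "(LINT z|lebesgue_on \<Omega>. U z * px V z + px U z * V z) = ip \<Omega> U (px V) + ip \<Omega> (px U) V"
    unfolding ip_def
    by (intro Bochner_Integration.integral_add L2_mult_integrable L2_Omega_smooth smooth_px U V)
  with integral_px[OF smooth_mult[OF U V] eq] show ?thesis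
    by (simp add: px_mult[OF U V])
qed

lemma wgrad_smooth:
  assumes U: "smooth U"
  shows "wgrad \<Omega> U (px U) (py U)"
  unfolding wgrad_def has_weak_deriv_iff px_def[symmetric] py_def[symmetric]
proof (intro conjI ballI)
  fix \<phi> assume phi: "\<phi> \<in> test_functions \<Omega>"
  note \<phi> = test_functionD[OF phi]
  have out: "(0, y) \<notin> \<Omega>" "(pi, y) \<notin> \<Omega>" "(x, 0) \<notin> \<Omega>" "(x, ell) \<notin> \<Omega>" for x y
    by (auto simp: Omega_def)
  show "ip \<Omega> U (px \<phi>) = - ip \<Omega> (px U) \<phi>"
    using ibp_x[OF U \<phi>(1)] \<phi>(2)[OF out(1)] \<phi>(2)[OF out(2)] by simp
  show "ip \<Omega> U (py \<phi>) = - ip \<Omega> (py U) \<phi>"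
    using ibp_y[OF U \<phi>(1)] \<phi>(2)[OF out(3)] \<phi>(2)[OF out(4)] by simp
qed (use U in \<open>auto intro!: L2_Omega_smooth smooth_px smooth_py\<close>)

lemma test_L2:
  assumes "\<phi> \<in> test_functions \<Omega>"
  shows "\<phi> \<in> L2 \<Omega>" "pd (1, 0) \<phi> \<in> L2 \<Omega>" "pd (0, 1) \<phi> \<in> L2 \<Omega>"
  using test_functionD(1)[OF assms]
  by (auto intro!: L2_Omega_smooth smooth_pd simp: Basis_real_prod)

text \<open>A cosine product times \<open>cutoff\<close> is a test function, and dominated
  convergence removes the cutoff; completeness of the cosine products thus replaces
  mollification.\<close>

lemma AE_zero_if_orthogonal_to_test_functions:
  assumes p: "p \<in> L2 \<Omega>" and orth: "\<And>\<phi>. \<phi> \<in> test_functions \<Omega> \<Longrightarrow> ip \<Omega> p \<phi> = 0"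
  shows "AE z in lebesgue_on \<Omega>. p z = 0"
proof (rule cos_complete_rectangle[OF ell_pos p])
  fix k j :: nat
  define h where "h = (\<lambda>z::real \<times> real. cos (k * fst z) * cos (j * (pi / ell) * snd z))"
  have h: "smooth h"
    unfolding h_def by (intro smooth_mult smooth_cos_fst smooth_cos_snd)
  have ph: "(\<lambda>z. p z * h z) \<in> borel_measurable (lebesgue_on \<Omega>)"
    using L2_measurable[OF p] L2_measurable[OF L2_Omega_smooth[OF h]] by measurable
  have "(\<lambda>n. LINT z|lebesgue_on \<Omega>. p z * (cutoff ell n z * h z)) \<longlonglongrightarrow> (LINT z|lebesgue_on \<Omega>. p z * h z)"
  proof (rule integral_dominated_convergence[where w = "\<lambda>z. \<bar>p z * h z\<bar>"])
    show "(\<lambda>z. p z * (cutoff ell n z * h z)) \<in> borel_measurable (lebesgue_on \<Omega>)" for n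
      using L2_measurable[OF p] L2_measurable[OF L2_Omega_smooth[OF smooth_mult[OF smooth_cutoff h]]]
      by measurable
    show "integrable (lebesgue_on \<Omega>) (\<lambda>z. \<bar>p z * h z\<bar>)"
      by (intro integrable_abs L2_mult_integrable p L2_Omega_smooth h)
    have "(\<lambda>n. p z * (cutoff ell n z * h z)) \<longlonglongrightarrow> p z * (1 * h z)" if "z \<in> \<Omega>" for z
      by (intro tendsto_intros cutoff_tendsto that)
    then show "AE z in lebesgue_on \<Omega>. (\<lambda>n. p z * (cutoff ell n z * h z)) \<longlonglongrightarrow> p z * h z"
      by (intro AE_I2) simp
    have "\<bar>cutoff ell n z\<bar> * \<bar>p z * h z\<bar> \<le> 1 * \<bar>p z * h z\<bar>" for n z
      by (intro mult_right_mono cutoff_bounds) simp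
    then show "AE z in lebesgue_on \<Omega>. norm (p z * (cutoff ell n z * h z)) \<le> \<bar>p z * h z\<bar>" for n
      by (intro AE_I2) (simp add: abs_mult ac_simps)
  qed (use ph in simp)
  then have "(LINT z|lebesgue_on \<Omega>. p z * h z) = 0"
    using orth[OF cutoff_mult_test_function[OF h]] by (simp add: ip_def LIMSEQ_const_iff)
  then show "ip \<Omega> p (\<lambda>(x, y). cos (k * x) * cos (j * (pi / ell * y))) = 0"
    by (simp add: ip_def h_def case_prod_unfold mult.assoc)
qed

lemma wgrad_add:
  "wgrad \<Omega> u p q \<Longrightarrow> wgrad \<Omega> u' p' q' \<Longrightarrow>
    wgrad \<Omega> (\<lambda>z. u z + u' z) (\<lambda>z. p z + p' z) (\<lambda>z. q z + q' z)"
  by (simp add: wgrad_def has_weak_deriv_iff L2_add ip_add_left test_L2)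

lemma wgrad_diff:
  "wgrad \<Omega> u p q \<Longrightarrow> wgrad \<Omega> u' p' q' \<Longrightarrow>
    wgrad \<Omega> (\<lambda>z. u z - u' z) (\<lambda>z. p z - p' z) (\<lambda>z. q z - q' z)"
  by (simp add: wgrad_def has_weak_deriv_iff L2_diff ip_diff_left test_L2)

text \<open>The weak gradient is a closed operator: both sides of its defining identity are
  continuous in \<open>L2\<close> for a fixed test function.\<close>

lemma wgrad_lim:
  assumes w: "\<And>n. wgrad \<Omega> (F n) (P n) (Q n)" and F: "L2lim \<Omega> F u" and P: "L2lim \<Omega> P p" and Q: "L2lim \<Omega> Q q"
  shows "wgrad \<Omega> u p q"
proof -
  have *: "ip \<Omega> u (pd b \<phi>) = - ip \<Omega> r \<phi>"
    if phi: "\<phi> \<in> test_functions \<Omega>" and R: "L2lim \<Omega> R r" and d: "pd b \<phi> \<in> L2 \<Omega>"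
      and w: "\<And>n. has_weak_deriv \<Omega> b (F n) (R n)" for b \<phi> R r
  proof -
    have "(\<lambda>n. ip \<Omega> (F n) (pd b \<phi>)) \<longlonglongrightarrow> ip \<Omega> u (pd b \<phi>)"
      by (intro L2lim_ip F L2lim_const d)
    moreover have "(\<lambda>n. - ip \<Omega> (R n) \<phi>) \<longlonglongrightarrow> - ip \<Omega> r \<phi>"
      by (intro tendsto_minus L2lim_ip R L2lim_const test_L2 phi)
    moreover have "ip \<Omega> (F n) (pd b \<phi>) = - ip \<Omega> (R n) \<phi>" for n
      using w phi by (simp add: has_weak_deriv_iff)
    ultimately show ?thesis
      using LIMSEQ_unique by simp
  qed
  show ?thesis
    unfolding wgrad_def has_weak_deriv_iff
    using *[OF _ P] *[OF _ Q] w test_L2 F P Q by (auto simp: wgrad_def dest: L2limD)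
qed

text \<open>If \<open>u\<close> is null, then \<open>p\<close> and \<open>q\<close> are orthogonal
  to every test function. This is what makes the choice inside \<open>weak_deriv\<close> harmless
  for integrals.\<close>

lemma wgrad_AE_zero:
  assumes w: "wgrad \<Omega> u p q" and u: "AE z in lebesgue_on \<Omega>. u z = 0"
  shows "AE z in lebesgue_on \<Omega>. p z = 0" "AE z in lebesgue_on \<Omega>. q z = 0"
proof -
  have *: "ip \<Omega> u v = 0" if "v \<in> L2 \<Omega>" for v
    using ip_cong_AE[OF u AE_I2[OF refl], of v] that w by (simp add: wgrad_def)
  show "AE z in lebesgue_on \<Omega>. p z = 0" "AE z in lebesgue_on \<Omega>. q z = 0"
    using w *[OF test_L2(2)] *[OF test_L2(3)]
    by (auto intro!: AE_zero_if_orthogonal_to_test_functions simp: wgrad_def has_weak_deriv_iff)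
qed

lemma wgrad_unique:
  assumes "wgrad \<Omega> u p q" "wgrad \<Omega> u' p' q'" "AE z in lebesgue_on \<Omega>. u z = u' z"
  shows "AE z in lebesgue_on \<Omega>. p z = p' z" "AE z in lebesgue_on \<Omega>. q z = q' z"
  using wgrad_AE_zero[OF wgrad_diff[OF assms(1,2)]] assms(3) by simp_all

lemma wgrad_weak_deriv:
  assumes w: "wgrad \<Omega> u p q"
  shows "AE z in lebesgue_on \<Omega>. weak_deriv \<Omega> (1, 0) u z = p z"
    "AE z in lebesgue_on \<Omega>. weak_deriv \<Omega> (0, 1) u z = q z"
  using wgrad_unique[OF H1_imp_wgrad[OF wgrad_imp_H1[OF w]] w] by simp_all

lemma wgrad_dirichlet_form:
  assumes u: "wgrad \<Omega> u p q" and v: "wgrad \<Omega> v p' q'"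
  shows "dirichlet_form \<Omega> u v = ip \<Omega> p p' + ip \<Omega> q q'"
proof -
  have "dirichlet_form \<Omega> u v = ip \<Omega> (weak_deriv \<Omega> (1, 0) u) (weak_deriv \<Omega> (1, 0) v)
      + ip \<Omega> (weak_deriv \<Omega> (0, 1) u) (weak_deriv \<Omega> (0, 1) v)"
    by (simp add: dirichlet_form_def Basis_real_prod ip_def)
  also have "\<dots> = ip \<Omega> p p' + ip \<Omega> q q'"
    using u v wgradD[OF H1_imp_wgrad[OF wgrad_imp_H1[OF u]]] wgradD[OF H1_imp_wgrad[OF wgrad_imp_H1[OF v]]]
    by (intro arg_cong2[where f = "(+)"] ip_cong_AE wgrad_weak_deriv) (auto dest: wgradD)
  finally show ?thesis .
qed

lemma wgrad_H1_norm:
  assumes u: "wgrad \<Omega> u p q"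
  shows "H1_norm \<Omega> u = sqrt (ip \<Omega> u u + ip \<Omega> p p + ip \<Omega> q q)"
proof -
  have "H1_norm \<Omega> u = sqrt (ip \<Omega> u u + dirichlet_form \<Omega> u u)"
    by (simp add: H1_norm_def dirichlet_form_def ip_def power2_eq_square)
  then show ?thesis
    by (simp add: wgrad_dirichlet_form[OF u u] add.assoc)
qed

lemma H1_norm_tendsto_0:
  assumes F: "\<And>n. wgrad \<Omega> (F n) (P n) (Q n)" and u: "wgrad \<Omega> u p q"
  shows "(\<lambda>n. H1_norm \<Omega> (\<lambda>z. F n z - u z)) \<longlonglongrightarrow> 0 \<longleftrightarrow>
    L2lim \<Omega> F u \<and> L2lim \<Omega> P p \<and> L2lim \<Omega> Q q"
proof -
  let ?a = "\<lambda>n. nrm \<Omega> (\<lambda>z. F n z - u z)" and ?b = "\<lambda>n. nrm \<Omega> (\<lambda>z. P n z - p z)"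
    and ?c = "\<lambda>n. nrm \<Omega> (\<lambda>z. Q n z - q z)"
  have eq: "H1_norm \<Omega> (\<lambda>z. F n z - u z) = sqrt ((?a n)\<^sup>2 + (?b n)\<^sup>2 + (?c n)\<^sup>2)" for n
    using wgrad_H1_norm[OF wgrad_diff[OF F[of n] u]] by (simp add: nrm_power2)
  show ?thesis
  proof
    assume lim: "(\<lambda>n. H1_norm \<Omega> (\<lambda>z. F n z - u z)) \<longlonglongrightarrow> 0"
    have "?a n \<le> H1_norm \<Omega> (\<lambda>z. F n z - u z)" "?b n \<le> H1_norm \<Omega> (\<lambda>z. F n z - u z)"
      "?c n \<le> H1_norm \<Omega> (\<lambda>z. F n z - u z)" for n
      unfolding eq by (auto intro!: real_le_rsqrt)
    then show "L2lim \<Omega> F u \<and> L2lim \<Omega> P p \<and> L2lim \<Omega> Q q"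
      by (intro conjI L2lim_comparison[OF _ _ _ lim] wgradD[OF F] wgradD[OF u])
  next
    assume "L2lim \<Omega> F u \<and> L2lim \<Omega> P p \<and> L2lim \<Omega> Q q"
    then have "?a \<longlonglongrightarrow> 0" "?b \<longlonglongrightarrow> 0" "?c \<longlonglongrightarrow> 0"
      by (auto dest: L2limD)
    then have "(\<lambda>n. sqrt ((?a n)\<^sup>2 + (?b n)\<^sup>2 + (?c n)\<^sup>2)) \<longlonglongrightarrow> sqrt (0\<^sup>2 + 0\<^sup>2 + 0\<^sup>2)"
      by (intro tendsto_intros)
    then show "(\<lambda>n. H1_norm \<Omega> (\<lambda>z. F n z - u z)) \<longlonglongrightarrow> 0"
      unfolding eq by simp
  qed
qed

lemma dirichlet_form_Cauchy_Schwarz: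
  assumes "u \<in> H1 \<Omega>" "v \<in> H1 \<Omega>"
  shows "(dirichlet_form \<Omega> u v)\<^sup>2 \<le> dirichlet_form \<Omega> u u * dirichlet_form \<Omega> v v"
proof -
  note u = H1_imp_wgrad[OF assms(1)] and v = H1_imp_wgrad[OF assms(2)]
  let ?p = "weak_deriv \<Omega> (1, 0) u" and ?q = "weak_deriv \<Omega> (0, 1) u"
  let ?p' = "weak_deriv \<Omega> (1, 0) v" and ?q' = "weak_deriv \<Omega> (0, 1) v"
  define a b c d where "a = nrm \<Omega> ?p" and "b = nrm \<Omega> ?q" and "c = nrm \<Omega> ?p'" and "d = nrm \<Omega> ?q'"
  have "\<bar>ip \<Omega> ?p ?p' + ip \<Omega> ?q ?q'\<bar> \<le> a * c + b * d"
    using ip_Cauchy_Schwarz[OF wgradD(2)[OF u] wgradD(2)[OF v]]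
      ip_Cauchy_Schwarz[OF wgradD(3)[OF u] wgradD(3)[OF v]]
    unfolding a_def b_def c_def d_def by linarith
  then have "(ip \<Omega> ?p ?p' + ip \<Omega> ?q ?q')\<^sup>2 \<le> (a * c + b * d)\<^sup>2"
    by (metis abs_ge_zero power2_abs power_mono)
  also have "\<dots> \<le> (a\<^sup>2 + b\<^sup>2) * (c\<^sup>2 + d\<^sup>2)"
  proof -
    have "(a\<^sup>2 + b\<^sup>2) * (c\<^sup>2 + d\<^sup>2) - (a * c + b * d)\<^sup>2 = (a * d - b * c)\<^sup>2"
      by (simp add: power2_eq_square algebra_simps)
    then show ?thesis
      by (metis diff_ge_0_iff_ge zero_le_power2)
  qed
  finally show ?thesis
    unfolding wgrad_dirichlet_form[OF u v] wgrad_dirichlet_form[OF u u] wgrad_dirichlet_form[OF v v]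
      a_def b_def c_def d_def nrm_power2 .
qed

end

section \<open>Separated functions and traces\<close>

lemma ip_sum_orthogonal:
  assumes "finite A" "\<And>k. e k \<in> L2 S" "\<And>k. d k \<in> L2 S"
    and orth: "\<And>j k. j \<noteq> k \<Longrightarrow> ip S (e j) (d k) = 0"
  shows "ip S (\<lambda>x. \<Sum>k\<in>A. e k x) (\<lambda>x. \<Sum>k\<in>A. d k x) = (\<Sum>k\<in>A. ip S (e k) (d k))"
proof -
  have "ip S (\<lambda>x. \<Sum>k\<in>A. e k x) (\<lambda>x. \<Sum>k\<in>A. d k x) = (\<Sum>j\<in>A. \<Sum>k\<in>A. ip S (e j) (d k))"
    using assms(2,3) by (simp add: ip_sum_left ip_sum_right L2_sum)
  also have "\<dots> = (\<Sum>j\<in>A. \<Sum>k\<in>A. if k = j then ip S (e j) (d j) else 0)"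
    using orth by (intro sum.cong refl) auto
  finally show ?thesis
    using \<open>finite A\<close> by simp
qed

text \<open>A summable majorant is assumed in place of orthogonality, since the lemma also serves
  the difference quotients of cosine sums, for which only an upper bound is established.\<close>

lemma L2_complete_summable:
  fixes F :: "nat \<Rightarrow> 'a::euclidean_space \<Rightarrow> real"
  assumes S: "S \<in> lmeasurable" and F: "\<And>n. F n \<in> L2 S" and a: "summable a"
    and le: "\<And>m n. m \<le> n \<Longrightarrow> (nrm S (\<lambda>x. F n x - F m x))\<^sup>2 \<le> (\<Sum>k=m..<n. a k)"
  shows "\<exists>s. L2lim S F s"
proof (rule L2_complete[OF S F])
  fix \<epsilon> :: real
  assume "\<epsilon> > 0"
  then obtain N where N: "\<And>m n. m \<ge> N \<Longrightarrow> \<bar>\<Sum>k=m..<n. a k\<bar> < \<epsilon>\<^sup>2"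
    using a[unfolded summable_Cauchy, rule_format, of "\<epsilon>\<^sup>2"] by auto
  have less: "nrm S (\<lambda>x. F n x - F m x) < \<epsilon>" if "N \<le> m" "m \<le> n" for m n
  proof -
    have "(nrm S (\<lambda>x. F n x - F m x))\<^sup>2 < \<epsilon>\<^sup>2"
      using le[OF that(2)] N[OF that(1), of n] by linarith
    then show ?thesis
      using \<open>\<epsilon> > 0\<close> by (intro power2_less_imp_less[of _ \<epsilon>]) auto
  qed
  have "nrm S (\<lambda>x. F m x - F n x) < \<epsilon>" if "N \<le> m" "N \<le> n" for m n
  proof (cases "m \<le> n")
    case True
    show ?thesis
      by (subst nrm_minus_commute) (rule less[OF that(1) True])
  next
    case False
    then show ?thesis
      using less[of n m] that by simp
  qed
  then show "\<exists>N. \<forall>m\<ge>N. \<forall>n\<ge>N. nrm S (\<lambda>x. F m x - F n x) < \<epsilon>"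
    by auto
qed

lemma sum_lessThan_diff:
  fixes m n :: nat
  shows "m \<le> n \<Longrightarrow> (\<Sum>k<n. F k) - (\<Sum>k<m. F k) = (\<Sum>k=m..<n. F k :: real)"
  using sum_diff_nat_ivl[of 0 m n F] by (simp add: atLeast0LessThan)

lemma L2_orthogonal_series:
  fixes e :: "nat \<Rightarrow> 'a::euclidean_space \<Rightarrow> real"
  assumes S: "S \<in> lmeasurable" and e: "\<And>k. e k \<in> L2 S"
    and orth: "\<And>j k. j \<noteq> k \<Longrightarrow> ip S (e j) (e k) = 0"
    and summ: "summable (\<lambda>k. ip S (e k) (e k))"
  shows "\<exists>s. L2lim S (\<lambda>n x. \<Sum>k<n. e k x) s"
proof (rule L2_complete_summable[OF S _ summ])
  show "(\<lambda>x. \<Sum>k<n. e k x) \<in> L2 S" for n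
    by (intro L2_sum e)
  show "(nrm S (\<lambda>x. (\<Sum>k<n. e k x) - (\<Sum>k<m. e k x)))\<^sup>2 \<le> (\<Sum>k=m..<n. ip S (e k) (e k))"
    if "m \<le> n" for m n
    using that ip_sum_orthogonal[OF _ e e orth, of "{m..<n}"]
    by (simp add: nrm_power2 sum_lessThan_diff)
qed

lemma L2lim_cong_AE:
  assumes F: "L2lim S F f" and fg: "AE x in lebesgue_on S. f x = g x" and g: "g \<in> L2 S"
  shows "L2lim S F g"
proof -
  have "nrm S (\<lambda>x. F n x - f x) = nrm S (\<lambda>x. F n x - g x)" for n
    using fg by (intro nrm_cong_AE) (auto intro: L2_diff L2limD[OF F] g)
  then show ?thesis
    using F g by (simp add: L2lim_def)
qed

text \<open>The common squared norm \<open>c\<close> is free because the unnormalised sines, with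
  \<open>c = pi / 2\<close>, are used besides \<open>phi\<close>. With \<open>T\<close> the sum of
  squared coefficients, Cauchy-Schwarz of \<open>f\<close> against the projection gives
  \<open>T\<^sup>2 \<le> c * ip S f f * T\<close>.\<close>

lemma Bessel_inequality:
  assumes f: "f \<in> L2 S" and e: "\<And>k. e k \<in> L2 S" and "finite A"
    and orth: "\<And>j k. ip S (e j) (e k) = (if j = k then c else 0)"
  shows "(\<Sum>k\<in>A. (ip S f (e k))\<^sup>2) \<le> c * ip S f f"
proof -
  let ?g = "\<lambda>x. \<Sum>k\<in>A. ip S f (e k) * e k x"
  have g: "?g \<in> L2 S"
    by (intro L2_sum L2_scale e)
  have c: "c \<ge> 0"
    using orth[of undefined undefined] ip_self_nonneg[of S "e undefined"] by simp
  define T where "T = (\<Sum>k\<in>A. (ip S f (e k))\<^sup>2)"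
  have fg: "ip S f ?g = T"
    by (simp add: ip_sum_right f e L2_scale ip_scale_right T_def power2_eq_square)
  have "ip S ?g ?g = (\<Sum>k\<in>A. ip S (\<lambda>x. ip S f (e k) * e k x) (\<lambda>x. ip S f (e k) * e k x))"
    using \<open>finite A\<close> by (intro ip_sum_orthogonal) (auto intro: L2_scale e simp: ip_scale_left ip_scale_right orth)
  also have "\<dots> = c * T"
    unfolding ip_scale_left ip_scale_right orth T_def sum_distrib_left
    by (simp add: power2_eq_square ac_simps)
  finally have gg: "ip S ?g ?g = c * T" .
  have "T\<^sup>2 \<le> (nrm S f * nrm S ?g)\<^sup>2"
    using power_mono[OF ip_Cauchy_Schwarz[OF f g] abs_ge_zero, of 2] unfolding fg by simp
  also have "\<dots> = (c * ip S f f) * T"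
    by (simp add: power_mult_distrib nrm_power2 gg)
  finally have *: "T * T \<le> (c * ip S f f) * T"
    by (simp add: power2_eq_square)
  have "T \<ge> 0"
    by (simp add: T_def sum_nonneg)
  then have "T \<le> c * ip S f f"
  proof (cases "T = 0")
    case False
    then show ?thesis
      using * \<open>T \<ge> 0\<close> by (simp add: mult_le_cancel_right)
  qed (simp add: c)
  then show ?thesis
    by (simp add: T_def)
qed

section \<open>Cosine series on \<open>{0..pi}\<close>\<close>

definition cn :: "nat \<Rightarrow> real" where
  "cn k = (if k = 0 then 1 / sqrt pi else sqrt (2 / pi))"

text \<open>The bottom values \<open>psi0 ell k (x, 0)\<close>, an orthonormal system in
  \<open>L2 {0..pi}\<close>; inner products with it are the Fourier coefficients of the
  data.\<close>

definition phi :: "nat \<Rightarrow> real \<Rightarrow> real" where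
  "phi k x = cn k * cos (real k * x)"

lemma integral_cos_nat: "integral {0..pi} (\<lambda>x. cos (real m * x)) = (if m = 0 then pi else 0)"
proof (cases "m = 0")
  case False
  have "((\<lambda>x. cos (real m * x)) has_integral (sin (real m * pi) / real m - sin (real m * 0) / real m)) {0..pi}"
    using False
    by (intro fundamental_theorem_of_calculus[where f = "\<lambda>x. sin (real m * x) / real m"])
      (auto intro!: derivative_eq_intros simp flip: has_real_derivative_iff_has_vector_derivative)
  then show ?thesis
    using False by (simp add: integral_unique)
qed simp

lemma integral_cos_mult_cos:
  "integral {0..pi} (\<lambda>x. cos (real j * x) * cos (real k * x))
    = (if j = k then if k = 0 then pi else pi / 2 else 0)"
proof -
  have "integral {0..pi} (\<lambda>x. cos (real j * x) * cos (real k * x))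
      = (integral {0..pi} (\<lambda>x. cos (real (nat \<bar>int j - int k\<bar>) * x)) + integral {0..pi} (\<lambda>x. cos (real (j + k) * x))) / 2"
    unfolding cos_nat_mult_cos
    by (subst integral_divide, subst Henstock_Kurzweil_Integration.integral_add)
      (auto intro!: integrable_continuous_interval continuous_intros)
  then show ?thesis
    unfolding integral_cos_nat by auto
qed

lemma integral_sin_mult_sin:
  "integral {0..pi} (\<lambda>x. sin (real j * x) * sin (real k * x))
    = (if j = k then if k = 0 then 0 else pi / 2 else 0)"
proof -
  have eq: "sin (real j * x) * sin (real k * x)
      = cos (real (nat \<bar>int j - int k\<bar>) * x) - cos (real j * x) * cos (real k * x)" for x
    using cos_nat_mult_cos[of j x k] by (simp add: distrib_right cos_add)
  have "integral {0..pi} (\<lambda>x. sin (real j * x) * sin (real k * x))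
      = integral {0..pi} (\<lambda>x. cos (real (nat \<bar>int j - int k\<bar>) * x))
        - integral {0..pi} (\<lambda>x. cos (real j * x) * cos (real k * x))"
    unfolding eq
    by (subst Henstock_Kurzweil_Integration.integral_diff)
      (auto intro!: integrable_continuous_interval continuous_intros)
  then show ?thesis
    unfolding integral_cos_nat integral_cos_mult_cos by auto
qed

lemma continuous_phi: "continuous_on S (phi k)"
  unfolding phi_def[abs_def] by (intro continuous_intros)

lemma phi_L2: "phi k \<in> L2 {0..pi}"
  by (intro L2_interval_continuous continuous_phi)

lemma ip_interval_continuous:
  fixes f g :: "real \<Rightarrow> real"
  shows "continuous_on UNIV f \<Longrightarrow> continuous_on UNIV g \<Longrightarrow> ip {a..b} f g = integral {a..b} (\<lambda>x. f x * g x)"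
  unfolding ip_def by (intro LINT_interval_continuous continuous_on_mult)

lemma cn_mult_integral: "cn j * cn k * (if j = k then if k = 0 then pi else pi / 2 else 0) = (if j = k then 1 else 0)"
  by (auto simp: cn_def)

lemma cn_nonzero: "cn k \<noteq> 0"
  by (simp add: cn_def)

lemma ip_phi: "ip {0..pi} (phi j) (phi k) = (if j = k then 1 else 0)"
proof -
  have "ip {0..pi} (phi j) (phi k) = integral {0..pi} (\<lambda>x. cn j * cn k * (cos (real j * x) * cos (real k * x)))"
    by (subst ip_interval_continuous[OF continuous_phi continuous_phi]) (simp add: phi_def ac_simps)
  also have "\<dots> = (if j = k then 1 else 0)"
    unfolding integral_mult_right integral_cos_mult_cos by (rule cn_mult_integral)
  finally show ?thesis .
qed

text \<open>Bessel's inequality makes the series converge to some \<open>s\<close>. The coefficients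
  of the partial sums are stationary from \<open>n > k\<close> on, so \<open>s - f\<close> is
  orthogonal to every cosine and completeness applies.\<close>

lemma Fourier_cos_converges:
  assumes f: "f \<in> L2 {0..pi}"
  shows "L2lim {0..pi} (\<lambda>n x. \<Sum>k<n. ip {0..pi} f (phi k) * phi k x) f"
proof -
  let ?c = "\<lambda>k. ip {0..pi} f (phi k)" and ?e = "\<lambda>k x. ip {0..pi} f (phi k) * phi k x"
  have e: "?e k \<in> L2 {0..pi}" for k
    by (intro L2_scale phi_L2)
  have ee: "ip {0..pi} (?e j) (?e k) = (if j = k then (?c k)\<^sup>2 else 0)" for j k
    by (simp add: ip_scale_left ip_scale_right ip_phi power2_eq_square)
  have "summable (\<lambda>k. (?c k)\<^sup>2)"
  proof (rule summableI_nonneg_bounded)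
    show "(\<Sum>k<n. (?c k)\<^sup>2) \<le> 1 * ip {0..pi} f f" for n
      by (rule Bessel_inequality) (auto simp: f phi_L2 ip_phi)
  qed simp
  then obtain s where s: "L2lim {0..pi} (\<lambda>n x. \<Sum>k<n. ?e k x) s"
    using L2_orthogonal_series[of "{0..pi}" ?e] e ee by auto
  have "AE x in lebesgue_on {0..pi}. s x - f x = 0"
  proof (rule cos_complete_interval)
    show "(\<lambda>x. s x - f x) \<in> L2 {0..pi}"
      by (intro L2_diff L2limD[OF s] f)
    fix k :: nat
    have "(\<lambda>n. ip {0..pi} (\<lambda>x. \<Sum>i<n. ?e i x) (phi k)) \<longlonglongrightarrow> ip {0..pi} s (phi k)"
      by (intro L2lim_ip s L2lim_const phi_L2)
    moreover have "\<forall>\<^sub>F n in sequentially. ip {0..pi} (\<lambda>x. \<Sum>i<n. ?e i x) (phi k) = ?c k"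
      using eventually_gt_at_top[of k]
    proof eventually_elim
      case (elim n)
      have "ip {0..pi} (\<lambda>x. \<Sum>i<n. ?e i x) (phi k) = (\<Sum>i<n. if i = k then ?c k else 0)"
        unfolding ip_sum_left[OF e phi_L2] by (intro sum.cong refl) (simp add: ip_scale_left ip_phi)
      then show ?case
        using elim by simp
    qed
    ultimately have "ip {0..pi} s (phi k) = ?c k"
      by (intro LIMSEQ_unique[OF _ tendsto_eventually])
    then have "ip {0..pi} (\<lambda>x. s x - f x) (phi k) = 0"
      by (simp add: ip_diff_left L2limD[OF s] f phi_L2)
    moreover have "phi k = (\<lambda>x. cn k * cos (real k * x))"
      by (rule ext) (simp add: phi_def)
    ultimately show "ip {0..pi} (\<lambda>x. s x - f x) (\<lambda>x. cos (real k * x)) = 0"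
      by (simp add: ip_scale_right cn_nonzero)
  qed
  then show ?thesis
    by (intro L2lim_cong_AE[OF s _ f]) simp
qed

text \<open>\<open>smooth_deriv \<eta> \<eta>'\<close> says that \<open>\<eta>\<close> is smooth on the line, phrased through its extension to
  the plane since \<open>smooth\<close> is needed there only.\<close>

definition smooth_deriv :: "(real \<Rightarrow> real) \<Rightarrow> (real \<Rightarrow> real) \<Rightarrow> bool" where
  "smooth_deriv \<eta> \<eta>' \<longleftrightarrow> smooth (\<lambda>z::real \<times> real. \<eta> (snd z)) \<and> (\<forall>y. (\<eta> has_real_derivative \<eta>' y) (at y))"

lemma smooth_derivD:
  assumes "smooth_deriv \<eta> \<eta>'"
  shows "smooth (\<lambda>z::real \<times> real. \<eta> (snd z))" "smooth (\<lambda>z::real \<times> real. \<eta>' (snd z))"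
    "(\<eta> has_real_derivative \<eta>' y) (at y)" "continuous_on S \<eta>" "continuous_on S \<eta>'"
proof -
  show s: "smooth (\<lambda>z::real \<times> real. \<eta> (snd z))" and d: "(\<eta> has_real_derivative \<eta>' y) (at y)" for y
    using assms by (auto simp: smooth_deriv_def)
  have "py (\<lambda>z. \<eta> (snd z)) z = \<eta>' (snd z)" for z
    using py_eqI[OF s, where x = "fst z" and y = "snd z"] d by simp
  then show s': "smooth (\<lambda>z::real \<times> real. \<eta>' (snd z))"
    using smooth_py[OF s] by presburger
  show "continuous_on S \<eta>" "continuous_on S \<eta>'"
    using smooth_continuous_slice(2)[OF s, of S undefined] smooth_continuous_slice(2)[OF s', of S undefined]
    by simp_all
qed

section \<open>Separated functions and their inner products\<close>

definition sep :: "nat \<Rightarrow> (real \<Rightarrow> real) \<Rightarrow> real \<times> real \<Rightarrow> real" where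
  "sep k \<eta> z = cn k * cos (real k * fst z) * \<eta> (snd z)"

text \<open>The \<open>x\<close>-derivative of \<open>sep k \<eta>\<close>. Its sine factor vanishes
  at \<open>x = 0\<close> and \<open>x = pi\<close>, which is the homogeneous Neumann condition on
  the lateral sides.\<close>

definition dsep :: "nat \<Rightarrow> (real \<Rightarrow> real) \<Rightarrow> real \<times> real \<Rightarrow> real" where
  "dsep k \<eta> z = - (real k * cn k * sin (real k * fst z) * \<eta> (snd z))"

lemma smooth_sep: "smooth (\<lambda>z::real \<times> real. \<eta> (snd z)) \<Longrightarrow> smooth (sep k \<eta>)"
  unfolding sep_def[abs_def] by (intro smooth_mult smooth_const smooth_cos_fst)

lemma smooth_dsep: "smooth (\<lambda>z::real \<times> real. \<eta> (snd z)) \<Longrightarrow> smooth (dsep k \<eta>)"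
  using smooth_cmult[of "\<lambda>z. real k * cn k * sin (real k * fst z) * \<eta> (snd z)" "-1"]
  unfolding dsep_def[abs_def] by (simp add: smooth_mult smooth_sin_fst)

lemma px_sep:
  assumes s: "smooth (\<lambda>z::real \<times> real. \<eta> (snd z))"
  shows "px (sep k \<eta>) = dsep k \<eta>"
proof (rule ext)
  fix z :: "real \<times> real"
  have "((\<lambda>x. sep k \<eta> (x, snd z)) has_real_derivative dsep k \<eta> z) (at (fst z))"
    unfolding sep_def dsep_def by (auto intro!: derivative_eq_intros)
  from px_eqI[OF smooth_sep[OF s] this] show "px (sep k \<eta>) z = dsep k \<eta> z"
    by simp
qed

lemma px_dsep:
  assumes s: "smooth (\<lambda>z::real \<times> real. \<eta> (snd z))"
  shows "px (dsep k \<eta>) = (\<lambda>z. - (real k)\<^sup>2 * sep k \<eta> z)"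
proof (rule ext)
  fix z :: "real \<times> real"
  have "((\<lambda>x. dsep k \<eta> (x, snd z)) has_real_derivative - (real k)\<^sup>2 * sep k \<eta> z) (at (fst z))"
    unfolding sep_def dsep_def by (auto intro!: derivative_eq_intros simp: power2_eq_square)
  from px_eqI[OF smooth_dsep[OF s] this] show "px (dsep k \<eta>) z = - (real k)\<^sup>2 * sep k \<eta> z"
    by simp
qed

lemma py_sep:
  assumes s: "smooth_deriv \<eta> \<eta>'"
  shows "py (sep k \<eta>) = sep k \<eta>'"
proof (rule ext)
  fix z :: "real \<times> real"
  have "((\<lambda>y. cn k * cos (real k * fst z) * \<eta> y) has_real_derivative cn k * cos (real k * fst z) * \<eta>' (snd z)) (at (snd z))"
    by (intro DERIV_cmult smooth_derivD(3)[OF s])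
  then have "((\<lambda>y. sep k \<eta> (fst z, y)) has_real_derivative sep k \<eta>' z) (at (snd z))"
    by (simp add: sep_def)
  from py_eqI[OF smooth_sep[OF smooth_derivD(1)[OF s]] this] show "py (sep k \<eta>) z = sep k \<eta>' z"
    by simp
qed

context rectangle
begin

definition I :: "(real \<Rightarrow> real) \<Rightarrow> (real \<Rightarrow> real) \<Rightarrow> real" where
  "I a b = integral {0..ell} (\<lambda>y. a y * b y)"

lemma wgrad_sep:
  assumes "smooth_deriv \<eta> \<eta>'"
  shows "wgrad \<Omega> (sep k \<eta>) (dsep k \<eta>) (sep k \<eta>')"
  using wgrad_smooth[OF smooth_sep[OF smooth_derivD(1)[OF assms]]]
  by (simp add: px_sep py_sep[OF assms] smooth_derivD(1)[OF assms])

lemma ip_product: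
  fixes a c b d :: "real \<Rightarrow> real"
  assumes "continuous_on UNIV a" "continuous_on UNIV b" "continuous_on UNIV c" "continuous_on UNIV d"
  shows "ip \<Omega> (\<lambda>z. a (fst z) * b (snd z)) (\<lambda>z. c (fst z) * d (snd z))
    = integral {0..pi} (\<lambda>x. a x * c x) * I b d"
proof -
  have "continuous_on UNIV (\<lambda>z::real \<times> real. (a (fst z) * b (snd z)) * (c (fst z) * d (snd z)))"
    by (intro continuous_on_mult assms[THEN continuous_on_compose2] continuous_on_fst continuous_on_snd
        continuous_on_id) auto
  from LINT_Omega_continuous(1)[OF this]
  have "ip \<Omega> (\<lambda>z. a (fst z) * b (snd z)) (\<lambda>z. c (fst z) * d (snd z))
      = integral {0..pi} (\<lambda>x. integral {0..ell} (\<lambda>y. (a x * c x) * (b y * d y)))"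
    by (simp add: ip_def ac_simps)
  then show ?thesis
    by (simp add: I_def)
qed

lemma ip_sep:
  assumes "continuous_on UNIV a" "continuous_on UNIV b"
  shows "ip \<Omega> (sep j a) (sep k b) = (if j = k then I a b else 0)"
proof -
  have "ip \<Omega> (sep j a) (sep k b) = cn j * cn k *
      ip \<Omega> (\<lambda>z. cos (real j * fst z) * a (snd z)) (\<lambda>z. cos (real k * fst z) * b (snd z))"
    unfolding sep_def[abs_def] by (simp add: ip_scale_left ip_scale_right mult.assoc)
  also have "\<dots> = cn j * cn k * (if j = k then if k = 0 then pi else pi / 2 else 0) * I a b"
    by (subst ip_product[where a = "\<lambda>x. cos (real j * x)" and c = "\<lambda>x. cos (real k * x)"])
      (auto simp: integral_cos_mult_cos intro!: continuous_intros assms)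
  finally show ?thesis
    by (simp only: cn_mult_integral) simp
qed

lemma ip_dsep:
  assumes "continuous_on UNIV a" "continuous_on UNIV b"
  shows "ip \<Omega> (dsep j a) (dsep k b) = (if j = k then (real k)\<^sup>2 * I a b else 0)"
proof -
  have d: "dsep k b = (\<lambda>z. (- real k * cn k) * (sin (real k * fst z) * b (snd z)))" for k b
    by (rule ext) (simp add: dsep_def)
  have "ip \<Omega> (dsep j a) (dsep k b) = real j * real k * (cn j * cn k) *
      ip \<Omega> (\<lambda>z. sin (real j * fst z) * a (snd z)) (\<lambda>z. sin (real k * fst z) * b (snd z))"
    unfolding d ip_scale_left ip_scale_right by simp
  also have "\<dots> = real j * real k * (cn j * cn k) * ((if j = k then if k = 0 then 0 else pi / 2 else 0) * I a b)"
    by (subst ip_product[where a = "\<lambda>x. sin (real j * x)" and c = "\<lambda>x. sin (real k * x)"])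
      (auto simp: integral_sin_mult_sin intro!: continuous_intros assms)
  \<comment> \<open>For \<open>j = k = 0\<close> the two case distinctions differ (0 against
    \<open>pi\<close>), but the factor \<open>real k\<close> is 0; this makes
    \<open>cn_mult_integral\<close> applicable.\<close>
  also have "\<dots> = real j * real k * (cn j * cn k * (if j = k then if k = 0 then pi else pi / 2 else 0)) * I a b"
    by auto
  finally show ?thesis
    by (simp only: cn_mult_integral) (simp add: power2_eq_square)
qed

section \<open>Traces and integration by parts for functions in \<open>H1\<close>\<close>

lemma has_trace_smooth:
  assumes "smooth U"
  shows "has_trace ell c U (\<lambda>x. U (x, c))"
proof -
  have "(\<lambda>n. H1_norm \<Omega> (\<lambda>z. U z - U z)) \<longlonglongrightarrow> 0"
    using H1_norm_tendsto_0[OF wgrad_smooth[OF assms] wgrad_smooth[OF assms]]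
    by (auto intro!: L2lim_const L2_Omega_smooth smooth_px smooth_py assms)
  then show ?thesis
    unfolding has_trace_def using assms by (auto intro!: L2_slice exI[of _ "\<lambda>n. U"])
qed

lemma has_trace_approx:
  assumes "has_trace ell c u w" and u: "wgrad \<Omega> u p q"
  shows "\<exists>U. (\<forall>n. smooth (U n)) \<and> L2lim \<Omega> U u \<and> L2lim \<Omega> (\<lambda>n. px (U n)) p \<and>
    L2lim \<Omega> (\<lambda>n. py (U n)) q \<and> L2lim {0..pi} (\<lambda>n x. U n (x, c)) w"
proof -
  from assms(1) obtain U where U: "\<And>n. smooth (U n)"
    and lim: "(\<lambda>n. H1_norm \<Omega> (\<lambda>z. U n z - u z)) \<longlonglongrightarrow> 0"
      "(\<lambda>n. LINT x|lebesgue_on {0..pi}. (U n (x, c) - w x)\<^sup>2) \<longlonglongrightarrow> 0" and w: "w \<in> L2 {0..pi}"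
    unfolding has_trace_def by blast
  have "L2lim {0..pi} (\<lambda>n x. U n (x, c)) w"
    by (intro L2limI_power2 L2_slice U w lim)
  with U H1_norm_tendsto_0[OF wgrad_smooth[OF U] u] lim(1) show ?thesis
    by auto
qed

text \<open>The trace hypothesis supplies smooth approximants of \<open>u\<close> together with its
  gradient; the smooth formula holds for each of them and passes to the limit.\<close>

lemma trace_ibp_x:
  assumes tr: "has_trace ell c u w" and u: "wgrad \<Omega> u p q" and V: "smooth V"
    and zero: "\<And>y. V (0, y) = 0" "\<And>y. V (pi, y) = 0"
  shows "ip \<Omega> p V = - ip \<Omega> u (px V)"
proof -
  obtain U where U: "\<And>n. smooth (U n)" "L2lim \<Omega> U u" "L2lim \<Omega> (\<lambda>n. px (U n)) p"
      and "L2lim \<Omega> (\<lambda>n. py (U n)) q" "L2lim {0..pi} (\<lambda>n x. U n (x, c)) w"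
    using has_trace_approx[OF tr u] by auto
  have "(\<lambda>n. ip \<Omega> (px (U n)) V) \<longlonglongrightarrow> ip \<Omega> p V"
    by (intro L2lim_ip U L2lim_const L2_Omega_smooth V)
  moreover have "(\<lambda>n. - ip \<Omega> (U n) (px V)) \<longlonglongrightarrow> - ip \<Omega> u (px V)"
    by (intro tendsto_minus L2lim_ip U L2lim_const L2_Omega_smooth smooth_px V)
  moreover have "ip \<Omega> (px (U n)) V = - ip \<Omega> (U n) (px V)" for n
    by (rule ibp_x[OF U(1) V]) (simp_all add: zero)
  ultimately show ?thesis
    by (intro LIMSEQ_unique) simp_all
qed

text \<open>Only the trace on \<open>y = 0\<close> is controlled, so \<open>V\<close> has to vanish
  on \<open>y = ell\<close> in order to remove the other boundary term from every
  approximant.\<close>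

lemma trace_ibp_y0:
  assumes tr: "has_trace ell 0 u w" and u: "wgrad \<Omega> u p q" and V: "smooth V"
    and zero: "\<And>x. V (x, ell) = 0"
  shows "ip \<Omega> q V = - ip \<Omega> u (py V) - ip {0..pi} w (\<lambda>x. V (x, 0))"
proof -
  obtain U where U: "\<And>n. smooth (U n)" "L2lim \<Omega> U u"
      and "L2lim \<Omega> (\<lambda>n. px (U n)) p" and U': "L2lim \<Omega> (\<lambda>n. py (U n)) q"
      "L2lim {0..pi} (\<lambda>n x. U n (x, 0)) w"
    using has_trace_approx[OF tr u] by auto
  have "(\<lambda>n. ip \<Omega> (py (U n)) V) \<longlonglongrightarrow> ip \<Omega> q V"
    by (intro L2lim_ip U U' L2lim_const L2_Omega_smooth V)
  moreover have "(\<lambda>n. - ip \<Omega> (U n) (py V) - ip {0..pi} (\<lambda>x. U n (x, 0)) (\<lambda>x. V (x, 0)))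
      \<longlonglongrightarrow> - ip \<Omega> u (py V) - ip {0..pi} w (\<lambda>x. V (x, 0))"
    by (intro tendsto_diff tendsto_minus L2lim_ip U U' L2lim_const L2_Omega_smooth L2_slice smooth_py V)
  moreover have "ip \<Omega> (py (U n)) V = - ip \<Omega> (U n) (py V) - ip {0..pi} (\<lambda>x. U n (x, 0)) (\<lambda>x. V (x, 0))" for n
    unfolding ibp_y[OF U(1) V] by (simp add: zero)
  ultimately show ?thesis
    by (intro LIMSEQ_unique) simp_all
qed

lemma trace_ibp_y1:
  assumes tr: "has_trace ell ell u w" and u: "wgrad \<Omega> u p q" and V: "smooth V"
    and zero: "\<And>x. V (x, 0) = 0"
  shows "ip \<Omega> q V = - ip \<Omega> u (py V) + ip {0..pi} w (\<lambda>x. V (x, ell))"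
proof -
  obtain U where U: "\<And>n. smooth (U n)" "L2lim \<Omega> U u"
      and "L2lim \<Omega> (\<lambda>n. px (U n)) p" and U': "L2lim \<Omega> (\<lambda>n. py (U n)) q"
      "L2lim {0..pi} (\<lambda>n x. U n (x, ell)) w"
    using has_trace_approx[OF tr u] by auto
  have "(\<lambda>n. ip \<Omega> (py (U n)) V) \<longlonglongrightarrow> ip \<Omega> q V"
    by (intro L2lim_ip U U' L2lim_const L2_Omega_smooth V)
  moreover have "(\<lambda>n. - ip \<Omega> (U n) (py V) + ip {0..pi} (\<lambda>x. U n (x, ell)) (\<lambda>x. V (x, ell)))
      \<longlonglongrightarrow> - ip \<Omega> u (py V) + ip {0..pi} w (\<lambda>x. V (x, ell))"
    by (intro tendsto_add tendsto_minus L2lim_ip U U' L2lim_const L2_Omega_smooth L2_slice smooth_py V)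
  moreover have "ip \<Omega> (py (U n)) V = - ip \<Omega> (U n) (py V) + ip {0..pi} (\<lambda>x. U n (x, ell)) (\<lambda>x. V (x, ell))" for n
    unfolding ibp_y[OF U(1) V] by (simp add: zero)
  ultimately show ?thesis
    by (intro LIMSEQ_unique) simp_all
qed

text \<open>The two traces may be realised by different approximating sequences; cutting \<open>V\<close> in two
  lets each be used on its own side.\<close>

lemma trace_ibp_y:
  assumes tr: "has_trace ell 0 u w0" "has_trace ell ell u w1" and u: "wgrad \<Omega> u p q" and V: "smooth V"
  shows "ip \<Omega> q V = - ip \<Omega> u (py V) - ip {0..pi} w0 (\<lambda>x. V (x, 0)) + ip {0..pi} w1 (\<lambda>x. V (x, ell))"
proof -
  define V0 V1 where "V0 z = V z * (- 1 / ell * snd z + 1)" and "V1 z = V z * (1 / ell * snd z + 0)" for z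
  have s: "smooth V0" "smooth V1"
    unfolding V0_def[abs_def] V1_def[abs_def] by (intro smooth_mult V smooth_snd)+
  have V01: "V = (\<lambda>z. V0 z + V1 z)"
    by (rule ext) (simp add: V0_def V1_def algebra_simps)
  have py_V: "py V = (\<lambda>z. py V0 z + py V1 z)"
    unfolding py_def by (subst V01) (intro pd_add smooth_differentiable s)
  have "ip \<Omega> q V = ip \<Omega> q V0 + ip \<Omega> q V1"
    by (subst V01) (intro ip_add_right L2_Omega_smooth s wgradD[OF u])
  moreover have "ip \<Omega> u (py V) = ip \<Omega> u (py V0) + ip \<Omega> u (py V1)"
    unfolding py_V by (intro ip_add_right L2_Omega_smooth smooth_py s wgradD[OF u])
  moreover have "ip \<Omega> q V0 = - ip \<Omega> u (py V0) - ip {0..pi} w0 (\<lambda>x. V0 (x, 0))"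
    using ell_pos by (intro trace_ibp_y0[OF tr(1) u s(1)]) (simp add: V0_def)
  moreover have "ip \<Omega> q V1 = - ip \<Omega> u (py V1) + ip {0..pi} w1 (\<lambda>x. V1 (x, ell))"
    by (intro trace_ibp_y1[OF tr(2) u s(2)]) (simp add: V1_def)
  ultimately show ?thesis
    using ell_pos by (simp add: V0_def V1_def)
qed

end

section \<open>The Gagliardo seminorm of cosine sums\<close>

definition quot :: "(real \<Rightarrow> real) \<Rightarrow> real \<times> real \<Rightarrow> real" where
  "quot w p = (w (fst p) - w (snd p)) / (fst p - snd p)"

text \<open>The squared difference of \<open>w\<close> at \<open>s + h\<close> and
  \<open>s - h\<close>, divided by \<open>h\<^sup>2\<close> although the points are
  \<open>2 * h\<close> apart: this accounts for a factor 4 against \<open>quot\<close>. The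
  indicators allow integration over the whole line in both variables.\<close>

definition mid :: "(real \<Rightarrow> real) \<Rightarrow> real \<Rightarrow> real \<Rightarrow> real" where
  "mid w s h = indicator {0..pi} (s - h) * indicator {0..pi} (s + h) * ((w (s + h) - w (s - h)) / h)\<^sup>2"

lemma mid_nonneg: "mid w s h \<ge> 0"
  by (simp add: mid_def)

lemma square_lmeasurable: "{a..b::real} \<times> {a..b} \<in> lmeasurable" "{a..b::real} \<times> {a..b} \<in> sets lebesgue"
proof -
  show "{a..b} \<times> {a..b} \<in> lmeasurable"
    by (intro lmeasurable_compact compact_Times) auto
  then show "{a..b} \<times> {a..b} \<in> sets lebesgue"
    by (rule fmeasurableD)
qed

text \<open>Completeness of Lebesgue measure. It gives measurability of the quotient of an
  \<open>H_half\<close> candidate, known only as an almost everywhere limit.\<close>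

lemma borel_measurable_AE_lebesgue:
  fixes f g :: "'a::euclidean_space \<Rightarrow> real"
  assumes f: "f \<in> borel_measurable (lebesgue_on S)" and eq: "AE x in lebesgue_on S. f x = g x"
    and S: "S \<in> sets lebesgue"
  shows "g \<in> borel_measurable (lebesgue_on S)"
proof -
  obtain N where N: "N \<in> null_sets (lebesgue_on S)" "{x \<in> space (lebesgue_on S). f x \<noteq> g x} \<subseteq> N"
    using eq unfolding eventually_ae_filter by blast
  have "f \<in> borel_measurable (lebesgue_on (S - N))"
    using borel_measurable_diff_null[OF N(1) S] f by blast
  moreover have "f x = g x" if "x \<in> space (lebesgue_on (S - N))" for x
    using that N(2) by auto
  ultimately have "g \<in> borel_measurable (lebesgue_on (S - N))"
    using measurable_cong[of "lebesgue_on (S - N)" f g borel] by blast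
  then show ?thesis
    using borel_measurable_diff_null[OF N(1) S] by blast
qed

text \<open>The Gagliardo seminorm in the midpoint and half-difference variables
  \<open>s = (x + y) / 2\<close>, \<open>h = (x - y) / 2\<close>.\<close>

lemma Gagliardo_midpoint:
  assumes [measurable]: "w \<in> borel_measurable borel"
  shows "(\<integral>\<^sup>+p. ennreal ((quot w p)\<^sup>2) \<partial>lebesgue_on ({0..pi} \<times> {0..pi}))
    = ennreal (1/2) * (\<integral>\<^sup>+h. \<integral>\<^sup>+s. ennreal (mid w s h) \<partial>lborel \<partial>lborel)"
proof -
  let ?I = "{0..pi}"
  define f where "f p = ennreal ((quot w p)\<^sup>2) * indicator (?I \<times> ?I) p" for p
  have meas [measurable]: "f \<in> borel_measurable (lborel \<Otimes>\<^sub>M lborel)"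
    unfolding f_def quot_def by measurable
  note S = square_lmeasurable(2)[of 0 pi]
  have "(\<integral>\<^sup>+p. ennreal ((quot w p)\<^sup>2) \<partial>lebesgue_on (?I \<times> ?I)) = (\<integral>\<^sup>+p. f p \<partial>lborel)"
    using S by (simp add: nn_integral_restrict_space f_def nn_integral_completion)
  also have "\<dots> = (\<integral>\<^sup>+y. \<integral>\<^sup>+x. f (x, y) \<partial>lborel \<partial>lborel)"
    unfolding lborel_pair.nn_integral_snd[OF meas] by (simp add: lborel_prod)
  also have "\<dots> = (\<integral>\<^sup>+y. 2 * (\<integral>\<^sup>+h. f (y + 2 * h, y) \<partial>lborel) \<partial>lborel)"
  proof (rule nn_integral_cong)
    fix y :: real
    show "(\<integral>\<^sup>+x. f (x, y) \<partial>lborel) = 2 * (\<integral>\<^sup>+h. f (y + 2 * h, y) \<partial>lborel)"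
      by (subst nn_integral_real_affine[where c = 2 and t = y]) (simp_all add: f_def quot_def)
  qed
  also have "\<dots> = 2 * (\<integral>\<^sup>+y. \<integral>\<^sup>+h. f (y + 2 * h, y) \<partial>lborel \<partial>lborel)"
    by (rule nn_integral_cmult) (simp add: f_def quot_def)
  \<comment> \<open>The order is exchanged so that, with \<open>h\<close> fixed, the shift
    \<open>y = s - h\<close> can be applied to the inner integral.\<close>
  also have "(\<integral>\<^sup>+y. \<integral>\<^sup>+h. f (y + 2 * h, y) \<partial>lborel \<partial>lborel) = (\<integral>\<^sup>+h. \<integral>\<^sup>+y. f (y + 2 * h, y) \<partial>lborel \<partial>lborel)"
    by (rule lborel_pair.Fubini') (simp add: f_def quot_def)
  also have "\<dots> = (\<integral>\<^sup>+h. \<integral>\<^sup>+s. ennreal (1/4) * ennreal (mid w s h) \<partial>lborel \<partial>lborel)"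
  proof (rule nn_integral_cong)
    fix h
    have "(\<integral>\<^sup>+y. f (y + 2 * h, y) \<partial>lborel) = (\<integral>\<^sup>+s. f (s + h, s - h) \<partial>lborel)"
      by (subst nn_integral_real_affine[where c = 1 and t = "- h"]) (auto simp: f_def quot_def algebra_simps)
    also have "\<dots> = (\<integral>\<^sup>+s. ennreal (1/4) * ennreal (mid w s h) \<partial>lborel)"
      by (rule nn_integral_cong)
        (auto simp: f_def quot_def mid_def indicator_def power_divide power_mult_distrib
          simp flip: ennreal_mult)
    finally show "(\<integral>\<^sup>+y. f (y + 2 * h, y) \<partial>lborel) = (\<integral>\<^sup>+s. ennreal (1/4) * ennreal (mid w s h) \<partial>lborel)" .
  qed
  also have "\<dots> = (\<integral>\<^sup>+h. ennreal (1/4) * (\<integral>\<^sup>+s. ennreal (mid w s h) \<partial>lborel) \<partial>lborel)"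
    by (intro nn_integral_cong nn_integral_cmult) (simp add: mid_def)
  also have "\<dots> = ennreal (1/4) * (\<integral>\<^sup>+h. \<integral>\<^sup>+s. ennreal (mid w s h) \<partial>lborel \<partial>lborel)"
    by (rule nn_integral_cmult) (simp add: mid_def)
  \<comment> \<open>The substitution \<open>x = y + 2 * h\<close> contributes 2 and the denominator
    \<open>(x - y)\<^sup>2 = 4 * h\<^sup>2\<close> contributes 1/4.\<close>
  also have "2 * (ennreal (1/4) * (\<integral>\<^sup>+h. \<integral>\<^sup>+s. ennreal (mid w s h) \<partial>lborel \<partial>lborel))
      = ennreal (1/2) * (\<integral>\<^sup>+h. \<integral>\<^sup>+s. ennreal (mid w s h) \<partial>lborel \<partial>lborel)"
  proof -
    have "2 * ennreal (1/4) = ennreal (1/2)"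
      using ennreal_mult[of 2 "1/4"] by simp
    then show ?thesis
      by (simp add: mult.assoc[symmetric])
  qed
  finally show ?thesis .
qed

text \<open>With \<open>t = a * h\<close> this is
  \<open>min 1 t\<^sup>2 \<le> 2 t\<^sup>2 / (1 + t\<^sup>2)\<close>. The majorant has the primitive
  \<open>2 * a * arctan (a * h)\<close> in \<open>h\<close>, so its integral grows only linearly in
  the frequency.\<close>

lemma sin_over_bound:
  fixes a h :: real
  shows "(sin (a * h) / h)\<^sup>2 \<le> 2 * a\<^sup>2 / (1 + (a * h)\<^sup>2)"
proof (cases "h = 0")
  case False
  define t where "t = a * h"
  have 1: "(sin t)\<^sup>2 \<le> t\<^sup>2"
    using abs_sin_x_le_abs_x[of t] by (rule abs_le_square_iff[THEN iffD1])
  have "(sin t)\<^sup>2 * t\<^sup>2 \<le> 1 * t\<^sup>2"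
    by (intro mult_right_mono) (auto simp: abs_square_le_1)
  with 1 have "(sin t)\<^sup>2 * (1 + t\<^sup>2) \<le> 2 * t\<^sup>2"
    by (simp add: distrib_left)
  then have "(sin t)\<^sup>2 \<le> 2 * t\<^sup>2 / (1 + t\<^sup>2)"
    by (simp add: pos_le_divide_eq add_pos_nonneg)
  then have "(sin t)\<^sup>2 / h\<^sup>2 \<le> (2 * t\<^sup>2 / (1 + t\<^sup>2)) / h\<^sup>2"
    by (intro divide_right_mono) simp_all
  also have "\<dots> = 2 * a\<^sup>2 / (1 + t\<^sup>2)"
    using False by (simp add: t_def power_mult_distrib)
  finally show ?thesis
    by (simp add: t_def power_divide)
qed simp

lemma nn_integral_sin_over_le:
  assumes "a \<ge> 0"
  shows "(\<integral>\<^sup>+h. ennreal ((sin (a * h) / h)\<^sup>2) * indicator {- (pi/2)..pi/2} h \<partial>lborel) \<le> ennreal (2 * pi * a)"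
proof -
  have "(\<integral>\<^sup>+h. ennreal ((sin (a * h) / h)\<^sup>2) * indicator {- (pi/2)..pi/2} h \<partial>lborel)
      \<le> (\<integral>\<^sup>+h. ennreal (2 * a\<^sup>2 / (1 + (a * h)\<^sup>2)) * indicator {- (pi/2)..pi/2} h \<partial>lborel)"
    by (intro nn_integral_mono mult_right_mono ennreal_leI sin_over_bound) simp
  also have "\<dots> = ennreal (2 * a * arctan (a * (pi/2)) - 2 * a * arctan (a * (- (pi/2))))"
  proof (rule nn_integral_FTC_Icc)
    fix h :: real
    have "((\<lambda>h. arctan (a * h)) has_real_derivative inverse (1 + (a * h)\<^sup>2) * a) (at h)"
      by (rule DERIV_chain2[OF DERIV_arctan]) (auto intro!: derivative_eq_intros)
    from DERIV_cmult[OF this, of "2 * a"]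
    have "((\<lambda>h. 2 * a * arctan (a * h)) has_real_derivative 2 * a\<^sup>2 / (1 + (a * h)\<^sup>2)) (at h)"
      by (simp only: power2_eq_square[of a] divide_inverse ac_simps)
    then show "((\<lambda>h. 2 * a * arctan (a * h)) has_real_derivative 2 * a\<^sup>2 / (1 + (a * h)\<^sup>2)) (at h)" .
    show "0 \<le> 2 * a\<^sup>2 / (1 + (a * h)\<^sup>2)"
      by simp
  qed auto
  also have "\<dots> \<le> ennreal (2 * pi * a)"
  proof (rule ennreal_leI)
    have "arctan t \<le> pi / 2" for t
      using arctan_ubound[of t] by simp
    then have "2 * (2 * a * arctan (a * (pi/2))) \<le> 2 * (2 * a * (pi / 2))"
      using assms by (intro mult_left_mono) auto
    then show "2 * a * arctan (a * (pi/2)) - 2 * a * arctan (a * (- (pi/2))) \<le> 2 * pi * a"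
      by (simp add: arctan_minus)
  qed
  finally show ?thesis .
qed

lemma sin_L2: "(\<lambda>x. sin (real k * x)) \<in> L2 {0..pi}"
  by (intro L2_interval_continuous continuous_intros)

lemma ip_sin: "ip {0..pi} (\<lambda>x. sin (real j * x)) (\<lambda>x. sin (real k * x))
    = (if j = k then if k = 0 then 0 else pi / 2 else 0)"
  by (subst ip_interval_continuous) (auto intro!: continuous_intros simp: integral_sin_mult_sin)

lemma nn_integral_lebesgue_on_interval:
  assumes "f \<in> borel_measurable borel"
  shows "(\<integral>\<^sup>+x. f x \<partial>lebesgue_on {a..b::real}) = (\<integral>\<^sup>+x. f x * indicator {a..b} x \<partial>lborel)"
  using assms by (simp add: nn_integral_restrict_space nn_integral_completion)

text \<open>For fixed \<open>h\<close> the symmetric difference of a cosine sum is a sine sum in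
  \<open>s\<close> with coefficients proportional to \<open>sin (k h)\<close>. Orthogonality of
  sines removes the cross terms, and each mode contributes at most \<open>4 * 2 pi k\<close>, halved
  by the midpoint formula.\<close>

lemma quot_sum_bound:
  fixes c :: "nat \<Rightarrow> real"
  assumes A: "finite A"
  defines "w \<equiv> \<lambda>x. \<Sum>k\<in>A. c k * phi k x"
  shows "quot w \<in> L2 ({0..pi} \<times> {0..pi})"
    and "(nrm ({0..pi} \<times> {0..pi}) (quot w))\<^sup>2 \<le> 4 * pi * (\<Sum>k\<in>A. real k * (c k)\<^sup>2)"
proof -
  have w_cont: "continuous_on UNIV w"
    unfolding w_def by (intro continuous_intros continuous_phi)
  then have [measurable]: "w \<in> borel_measurable borel"
    by (rule borel_measurable_continuous_onI)
  define T where "T = 4 * pi * (\<Sum>k\<in>A. real k * (c k)\<^sup>2)"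
  have T: "T \<ge> 0"
    unfolding T_def by (intro mult_nonneg_nonneg sum_nonneg) auto
  define d where "d k h = - 2 * c k * cn k * (sin (real k * h) / h)" for k h
  have diff: "(w (s + h) - w (s - h)) / h = (\<Sum>k\<in>A. d k h * sin (real k * s))" for s h
  proof -
    have "phi k (s + h) - phi k (s - h) = - 2 * cn k * sin (real k * h) * sin (real k * s)" for k
      by (simp add: phi_def distrib_left right_diff_distrib cos_add cos_diff algebra_simps)
    then have "w (s + h) - w (s - h) = (\<Sum>k\<in>A. c k * (- 2 * cn k * sin (real k * h) * sin (real k * s)))"
      unfolding w_def by (simp only: sum_subtractf[symmetric] right_diff_distrib[symmetric])
    then show ?thesis
      by (simp add: d_def sum_divide_distrib ac_simps)
  qed
  have inner: "(\<integral>\<^sup>+s. ennreal (mid w s h) \<partial>lborel)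
      \<le> (\<Sum>k\<in>A. ennreal (4 * (c k)\<^sup>2) * (ennreal ((sin (real k * h) / h)\<^sup>2) * indicator {- (pi/2)..pi/2} h))" for h
  proof -
    let ?g = "\<lambda>s. \<Sum>k\<in>A. d k h * sin (real k * s)"
    have [measurable]: "?g \<in> borel_measurable borel"
      by measurable
    have g_L2: "?g \<in> L2 {0..pi}"
      by (intro L2_sum L2_scale sin_L2)
    \<comment> \<open>If \<open>s - h\<close> and \<open>s + h\<close> both lie in
      \<open>{0..pi}\<close>, then so does \<open>s\<close>, and
      \<open>\<bar>h\<bar> \<le> pi / 2\<close>. Enlarging the domain to this product restores
      orthogonality of the sines in \<open>s\<close>.\<close>
    have "(\<integral>\<^sup>+s. ennreal (mid w s h) \<partial>lborel)
        \<le> (\<integral>\<^sup>+s. indicator {- (pi/2)..pi/2} h * (ennreal ((?g s)\<^sup>2) * indicator {0..pi} s) \<partial>lborel)"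
      unfolding mid_def diff by (intro nn_integral_mono) (auto simp: indicator_def)
    also have "\<dots> = indicator {- (pi/2)..pi/2} h * (\<integral>\<^sup>+s. ennreal ((?g s)\<^sup>2) * indicator {0..pi} s \<partial>lborel)"
      by (rule nn_integral_cmult) measurable
    also have "(\<integral>\<^sup>+s. ennreal ((?g s)\<^sup>2) * indicator {0..pi} s \<partial>lborel)
        = (\<integral>\<^sup>+s. ennreal ((?g s)\<^sup>2) \<partial>lebesgue_on {0..pi})"
      by (rule nn_integral_lebesgue_on_interval[symmetric]) measurable
    also have "\<dots> = ennreal (ip {0..pi} ?g ?g)"
      by (simp add: nrm_nn_integral[OF g_L2] nrm_power2)
    also have "ip {0..pi} ?g ?g = (\<Sum>k\<in>A. ip {0..pi} (\<lambda>s. d k h * sin (real k * s)) (\<lambda>s. d k h * sin (real k * s)))"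
      by (rule ip_sum_orthogonal[OF A]) (auto simp: L2_scale sin_L2 ip_scale_left ip_scale_right ip_sin)
    also have "\<dots> = (\<Sum>k\<in>A. 4 * (c k)\<^sup>2 * (sin (real k * h) / h)\<^sup>2)"
    proof (rule sum.cong[OF refl])
      fix k
      show "ip {0..pi} (\<lambda>s. d k h * sin (real k * s)) (\<lambda>s. d k h * sin (real k * s))
          = 4 * (c k)\<^sup>2 * (sin (real k * h) / h)\<^sup>2"
      proof (cases "k = 0")
        case False
        then have "(cn k)\<^sup>2 * (pi / 2) = 1"
          by (simp add: cn_def)
        moreover have "ip {0..pi} (\<lambda>s. d k h * sin (real k * s)) (\<lambda>s. d k h * sin (real k * s))
            = 4 * (c k)\<^sup>2 * (sin (real k * h) / h)\<^sup>2 * ((cn k)\<^sup>2 * (pi / 2))"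
          using False unfolding ip_scale_left ip_scale_right ip_sin d_def
          by (simp add: power2_eq_square)
        ultimately show ?thesis by simp
      qed (simp add: ip_scale_left ip_scale_right d_def)
    qed
    also have "ennreal \<dots> = (\<Sum>k\<in>A. ennreal (4 * (c k)\<^sup>2) * ennreal ((sin (real k * h) / h)\<^sup>2))"
      by (simp add: ennreal_mult flip: sum_ennreal)
    finally show ?thesis
      by (simp add: sum_distrib_left ac_simps)
  qed
  have "(\<integral>\<^sup>+h. \<integral>\<^sup>+s. ennreal (mid w s h) \<partial>lborel \<partial>lborel)
      \<le> (\<integral>\<^sup>+h. (\<Sum>k\<in>A. ennreal (4 * (c k)\<^sup>2) * (ennreal ((sin (real k * h) / h)\<^sup>2) * indicator {- (pi/2)..pi/2} h)) \<partial>lborel)"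
    by (intro nn_integral_mono inner)
  also have "\<dots> = (\<Sum>k\<in>A. ennreal (4 * (c k)\<^sup>2) * (\<integral>\<^sup>+h. ennreal ((sin (real k * h) / h)\<^sup>2) * indicator {- (pi/2)..pi/2} h \<partial>lborel))"
    by (subst nn_integral_sum) (auto simp: nn_integral_cmult)
  also have "\<dots> \<le> (\<Sum>k\<in>A. ennreal (4 * (c k)\<^sup>2) * ennreal (2 * pi * real k))"
    by (intro sum_mono mult_left_mono nn_integral_sin_over_le) auto
  also have "\<dots> = ennreal (2 * T)"
    by (simp add: T_def sum_distrib_left ac_simps flip: ennreal_mult sum_ennreal)
  finally have "(\<integral>\<^sup>+p. ennreal ((quot w p)\<^sup>2) \<partial>lebesgue_on ({0..pi} \<times> {0..pi})) \<le> ennreal (1/2) * ennreal (2 * T)"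
    unfolding Gagliardo_midpoint[OF \<open>w \<in> borel_measurable borel\<close>] by (rule mult_left_mono) simp
  also have "\<dots> = ennreal ((1/2) * (2 * T))"
    using T by (intro ennreal_mult[symmetric]) auto
  also have "\<dots> = ennreal ((sqrt T)\<^sup>2)"
    using T by simp
  finally have le: "(\<integral>\<^sup>+p. ennreal ((quot w p)\<^sup>2) \<partial>lebesgue_on ({0..pi} \<times> {0..pi})) \<le> ennreal ((sqrt T)\<^sup>2)" .
  have "quot w \<in> borel_measurable lborel"
    unfolding quot_def[abs_def] lborel_prod[symmetric] by measurable
  then have "quot w \<in> borel_measurable (lebesgue_on ({0..pi} \<times> {0..pi}))"
    by (intro measurable_restrict_space1 measurable_completion)
  note * = L2_bound_nn_integral[OF this _ le]
  show "quot w \<in> L2 ({0..pi} \<times> {0..pi})"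
    by (rule *(1)) (simp add: T)
  have "nrm ({0..pi} \<times> {0..pi}) (quot w) \<le> sqrt T"
    by (rule *(2)) (simp add: T)
  from power_mono[OF this nrm_nonneg, of 2] show "(nrm ({0..pi} \<times> {0..pi}) (quot w))\<^sup>2 \<le> 4 * pi * (\<Sum>k\<in>A. real k * (c k)\<^sup>2)"
    using T by (simp add: T_def)
qed

text \<open>A null set of abscissae times the line is null in the plane, and likewise with the
  coordinates exchanged.\<close>

lemma AE_lebesgue_on_square:
  assumes "AE x in lebesgue_on {a..b::real}. P x"
  shows "AE p in lebesgue_on ({a..b} \<times> {a..b}). P (fst p) \<and> P (snd p)"
proof -
  note S = square_lmeasurable(2)[of a b]
  have "AE x in lborel. x \<in> {a..b} \<longrightarrow> P x"
    using assms by (simp add: AE_restrict_space_iff AE_completion_iff)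
  then obtain N where N: "N \<in> null_sets lborel" and sub: "{x \<in> space lborel. \<not> (x \<in> {a..b} \<longrightarrow> P x)} \<subseteq> N"
    by (auto simp: eventually_ae_filter)
  have "N \<times> UNIV \<in> null_sets (lborel \<Otimes>\<^sub>M lborel)" "UNIV \<times> N \<in> null_sets (lborel \<Otimes>\<^sub>M lborel)"
    using N by auto
  then have "N \<times> UNIV \<union> UNIV \<times> N \<in> null_sets (lborel :: (real \<times> real) measure)"
    by (auto simp: lborel_prod intro: null_sets.Un)
  then have "AE p in lborel. p \<notin> N \<times> UNIV \<union> UNIV \<times> N"
    by (rule AE_not_in)
  then have "AE p in lborel. p \<in> {a..b} \<times> {a..b} \<longrightarrow> P (fst p) \<and> P (snd p)"
    by eventually_elim (use sub in auto)
  then have "AE p in lebesgue. p \<in> {a..b} \<times> {a..b} \<longrightarrow> P (fst p) \<and> P (snd p)"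
    by (rule AE_completion)
  then show ?thesis
    using S by (subst AE_restrict_space_iff) auto
qed

lemma quot_diff: "quot (\<lambda>x. v x - w x) p = quot v p - quot w p"
  by (simp add: quot_def diff_divide_distrib[symmetric])

lemma H_half_iff:
  assumes "quot f \<in> borel_measurable (lebesgue_on ({0..pi} \<times> {0..pi}))" "f \<in> L2 {0..pi}"
  shows "f \<in> H_half {0..pi} \<longleftrightarrow> quot f \<in> L2 ({0..pi} \<times> {0..pi})"
  using assms by (auto simp: H_half_def L2_def quot_def[abs_def] case_prod_unfold)

lemma H_half_norm_eq: "H_half_norm {0..pi} f
    = sqrt ((nrm {0..pi} f)\<^sup>2 + (nrm ({0..pi} \<times> {0..pi}) (quot f))\<^sup>2)"
  by (simp add: H_half_norm_def nrm_power2 ip_self quot_def case_prod_unfold)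

lemma phi_sum_H_half:
  assumes "finite A" shows "(\<lambda>x. \<Sum>k\<in>A. c k * phi k x) \<in> H_half {0..pi}"
  using quot_sum_bound(1)[OF assms, of c]
  by (subst H_half_iff) (auto intro!: L2_sum L2_scale phi_L2 L2_measurable)

text \<open>By \<open>quot_sum_bound\<close> the quotients of the partial sums converge in
  \<open>L2\<close> of the square to some \<open>Q\<close>. Pointwise limits along subsequences show
  that \<open>Q\<close> is the quotient of \<open>w\<close> itself.\<close>

lemma H_half_Fourier:
  assumes w: "w \<in> L2 {0..pi}" and summ: "summable (\<lambda>k. real k * (ip {0..pi} w (phi k))\<^sup>2)"
  shows "w \<in> H_half {0..pi}"
    "(\<lambda>x. w x - (\<Sum>k<n. ip {0..pi} w (phi k) * phi k x)) \<in> H_half {0..pi}"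
    "(\<lambda>n. H_half_norm {0..pi} (\<lambda>x. w x - (\<Sum>k<n. ip {0..pi} w (phi k) * phi k x))) \<longlonglongrightarrow> 0"
proof -
  let ?J = "{0..pi} \<times> {0..pi}"
  define c where "c k = ip {0..pi} w (phi k)" for k
  define S where "S n x = (\<Sum>k<n. c k * phi k x)" for n x
  have S_lim: "L2lim {0..pi} S w"
    using Fourier_cos_converges[OF w] by (simp add: S_def[abs_def] c_def)
  have QS: "quot (S n) \<in> L2 ?J" for n
    unfolding S_def[abs_def] by (rule quot_sum_bound(1)) simp
  have "\<exists>Q. L2lim ?J (\<lambda>n. quot (S n)) Q"
  proof (rule L2_complete_summable[OF square_lmeasurable(1) QS])
    show "summable (\<lambda>k. 4 * pi * (real k * (c k)\<^sup>2))"
      using summ by (intro summable_mult) (simp add: c_def)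
    fix m n :: nat
    assume "m \<le> n"
    then have "(\<lambda>p. quot (S n) p - quot (S m) p) = quot (\<lambda>x. \<Sum>k=m..<n. c k * phi k x)"
      by (simp add: quot_diff[symmetric] S_def[abs_def] sum_lessThan_diff)
    then show "(nrm ?J (\<lambda>p. quot (S n) p - quot (S m) p))\<^sup>2 \<le> (\<Sum>k=m..<n. 4 * pi * (real k * (c k)\<^sup>2))"
      using quot_sum_bound(2)[of "{m..<n}" c] by (simp add: sum_distrib_left)
  qed
  then obtain Q where Q: "L2lim ?J (\<lambda>n. quot (S n)) Q"
    by blast
  \<comment> \<open>Two nested subsequences: the first makes the partial sums converge almost
    everywhere on the interval, the second makes their quotients converge almost everywhere on the
    square.\<close>
  obtain r where r: "strict_mono r" and r_lim: "AE x in lebesgue_on {0..pi}. (\<lambda>n. S (r n) x) \<longlonglongrightarrow> w x"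
    using L2lim_AE_subseq[OF S_lim] by blast
  have "L2lim ?J (\<lambda>n. quot (S (r n))) Q"
    using Q LIMSEQ_subseq_LIMSEQ[OF L2limD(3)[OF Q] r] by (simp add: L2lim_def comp_def)
  then obtain r' where r': "strict_mono r'" and r'_lim: "AE p in lebesgue_on ?J. (\<lambda>n. quot (S (r (r' n))) p) \<longlonglongrightarrow> Q p"
    using L2lim_AE_subseq by blast
  have eq: "AE p in lebesgue_on ?J. Q p = quot w p"
    using AE_lebesgue_on_square[OF r_lim] r'_lim
  proof eventually_elim
    case (elim p)
    then have "(\<lambda>n. quot (S (r n)) p) \<longlonglongrightarrow> quot w p"
    proof (cases "fst p = snd p")
      case False
      then show ?thesis
        unfolding quot_def using elim by (intro tendsto_intros) auto
    qed (simp add: quot_def)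
    from LIMSEQ_subseq_LIMSEQ[OF this r'] elim(2) show ?case
      by (intro LIMSEQ_unique) (simp_all add: comp_def)
  qed
  have "Q \<in> borel_measurable (lebesgue_on ?J)"
    by (intro L2_measurable L2limD[OF Q])
  then have qw_meas: "quot w \<in> borel_measurable (lebesgue_on ?J)"
    using eq square_lmeasurable(2) by (rule borel_measurable_AE_lebesgue)
  have qw: "quot w \<in> L2 ?J"
  proof -
    have "integrable (lebesgue_on ?J) (\<lambda>p. (quot w p)\<^sup>2)"
    proof (rule integrable_cong_AE_imp[OF L2_square_integrable[OF L2limD(2)[OF Q]]])
      show "AE p in lebesgue_on ?J. (Q p)\<^sup>2 = (quot w p)\<^sup>2"
        using eq by eventually_elim simp
    qed (use qw_meas in measurable)
    then show ?thesis
      using qw_meas by (simp add: L2_def)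
  qed
  then show "w \<in> H_half {0..pi}"
    using H_half_iff[OF qw_meas w] by simp
  have qd: "(\<lambda>p. quot w p - quot (S n) p) = quot (\<lambda>x. w x - S n x)" for n
    by (rule ext) (simp add: quot_diff)
  have "quot (\<lambda>x. w x - S n x) \<in> L2 ?J"
    using L2_diff[OF qw QS[of n]] unfolding qd .
  then have "(\<lambda>x. w x - S n x) \<in> H_half {0..pi}"
    using H_half_iff[OF L2_measurable L2_diff[OF w L2limD(1)[OF S_lim]]] by blast
  then show "(\<lambda>x. w x - (\<Sum>k<n. ip {0..pi} w (phi k) * phi k x)) \<in> H_half {0..pi}"
    by (simp add: S_def c_def)
  have "L2lim ?J (\<lambda>n. quot (S n)) (quot w)"
    by (rule L2lim_cong_AE[OF Q eq qw])
  then have "(\<lambda>n. nrm ?J (\<lambda>p. quot w p - quot (S n) p)) \<longlonglongrightarrow> 0"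
    by (subst nrm_minus_commute) (rule L2limD)
  moreover have "(\<lambda>n. nrm {0..pi} (\<lambda>x. w x - S n x)) \<longlonglongrightarrow> 0"
    by (subst nrm_minus_commute) (rule L2limD[OF S_lim])
  ultimately have "(\<lambda>n. sqrt ((nrm {0..pi} (\<lambda>x. w x - S n x))\<^sup>2 + (nrm ?J (\<lambda>p. quot w p - quot (S n) p))\<^sup>2))
      \<longlonglongrightarrow> sqrt (0\<^sup>2 + 0\<^sup>2)"
    by (intro tendsto_intros)
  then have "(\<lambda>n. H_half_norm {0..pi} (\<lambda>x. w x - S n x)) \<longlonglongrightarrow> 0"
    unfolding H_half_norm_eq qd by simp
  then show "(\<lambda>n. H_half_norm {0..pi} (\<lambda>x. w x - (\<Sum>k<n. ip {0..pi} w (phi k) * phi k x))) \<longlonglongrightarrow> 0"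
    by (simp add: S_def c_def)
qed

section \<open>Fourier coefficients of H_half functions\<close>

text \<open>The derivative \<open>cos x - 1/2\<close> is nonnegative on \<open>[0, pi/3]\<close>,
  which contains \<open>[0, 1]\<close>.\<close>

lemma sin_ge_half:
  assumes "0 \<le> t" "t \<le> (1::real)" shows "t / 2 \<le> sin t"
proof -
  have "(\<lambda>t. sin t - t / 2) 0 \<le> (\<lambda>t. sin t - t / 2) t"
  proof (rule DERIV_nonneg_imp_nondecreasing[OF assms(1)])
    fix x :: real
    assume x: "0 \<le> x" "x \<le> t"
    have "cos (pi / 3) \<le> cos x"
      using x assms pi_gt3 by (intro cos_monotone_0_pi_le) auto
    moreover have "((\<lambda>t. sin t - t / 2) has_real_derivative cos x - 1 / 2) (at x)"
      by (auto intro!: derivative_eq_intros)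
    ultimately show "\<exists>y. ((\<lambda>t. sin t - t / 2) has_real_derivative y) (at x) \<and> 0 \<le> y"
      by (auto simp: cos_60)
  qed
  then show ?thesis by simp
qed

text \<open>On the interval \<open>(0, 1/k)\<close> the integrand is at least
  \<open>(k/2)\<^sup>2\<close>, and the length of the interval is \<open>1/k\<close>.\<close>

lemma nn_integral_sin_over_ge:
  assumes k: "k \<ge> (1::nat)"
  shows "ennreal (real k / 4) \<le> (\<integral>\<^sup>+h. ennreal ((sin (real k * h) / h)\<^sup>2) * indicator {0<..<pi/2} h \<partial>lborel)"
proof -
  have "ennreal (real k / 4) = ennreal ((real k)\<^sup>2 / 4) * ennreal (1 / real k)"
    using k by (simp add: power2_eq_square flip: ennreal_mult)
  also have "\<dots> = (\<integral>\<^sup>+h. ennreal ((real k)\<^sup>2 / 4) * indicator {0<..<1 / real k} h \<partial>lborel)"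
    by (simp add: nn_integral_cmult)
  also have "\<dots> \<le> (\<integral>\<^sup>+h. ennreal ((sin (real k * h) / h)\<^sup>2) * indicator {0<..<pi/2} h \<partial>lborel)"
  proof (rule nn_integral_mono)
    fix h :: real
    show "ennreal ((real k)\<^sup>2 / 4) * indicator {0<..<1 / real k} h
        \<le> ennreal ((sin (real k * h) / h)\<^sup>2) * indicator {0<..<pi/2} h"
    proof (cases "h \<in> {0<..<1 / real k}")
      case True
      then have h: "h > 0" "real k * h < 1"
        using k by (auto simp: field_simps)
      have "1 / real k \<le> 1"
        using k by simp
      then have "h < pi / 2"
        using True pi_gt3 by auto
      moreover have "(real k * h) / 2 / h \<le> sin (real k * h) / h"
        using h k by (intro divide_right_mono sin_ge_half) auto
      then have "real k / 2 \<le> sin (real k * h) / h"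
        using h by simp
      then have "(real k / 2)\<^sup>2 \<le> (sin (real k * h) / h)\<^sup>2"
        by (rule power_mono) simp
      ultimately show ?thesis
        using True by (auto simp: power_divide indicator_def intro!: ennreal_leI)
    qed simp
  qed
  finally show ?thesis .
qed

text \<open>\<open>reflected_diff g h\<close> is \<open>F (s + h) - F (s - h)\<close> for the even, \<open>2 pi\<close>-periodic extension \<open>F\<close> of \<open>g\<close>,
  provided that \<open>g\<close> vanishes off \<open>[0, pi]\<close>, \<open>s\<close> lies in \<open>[0, pi]\<close> and \<open>h\<close> in \<open>[0, pi/2]\<close>
  (up to finitely many points \<open>s\<close>).\<close>

definition reflected_diff :: "(real \<Rightarrow> real) \<Rightarrow> real \<Rightarrow> real \<Rightarrow> real" where
  "reflected_diff g h s = g (s + h) + g (2 * pi - h - s) - g (s - h) - g (h - s)"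

text \<open>Near \<open>s = 0\<close> reflection leaves the pair \<open>s + h\<close>,
  \<open>h - s\<close>, whose midpoint is \<open>h\<close> and half-difference \<open>s\<close>: the
  two variables change roles, and the denominator \<open>s < h\<close> only increases the quotient.
  Near \<open>pi\<close> the pair has midpoint \<open>pi - h\<close> and half-difference
  \<open>pi - s\<close>. The excluded \<open>s\<close> are those where reflected pieces overlap or a
  denominator vanishes.\<close>

lemma reflected_diff_le_mid:
  assumes g: "\<And>x. x \<notin> {0..pi} \<Longrightarrow> g x = 0" and h: "0 < h" "h < pi / 2" and s: "s \<in> {0..pi}"
    and ne: "s \<noteq> 0" "s \<noteq> h" "s \<noteq> pi - h" "s \<noteq> pi"
  shows "(reflected_diff g h s / h)\<^sup>2 \<le> mid g s h + mid g h s + mid g (pi - h) (pi - s)"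
proof -
  have shrink: "(a / h)\<^sup>2 \<le> (a / r)\<^sup>2" if "0 < r" "r < h" for a r
    using that by (auto simp: power_divide intro!: divide_left_mono power_mono)
  consider "s < h" | "h < s" "s < pi - h" | "pi - h < s"
    using ne by linarith
  then show ?thesis
  proof cases
    case 1
    then have "reflected_diff g h s = g (s + h) - g (h - s)"
      using g[of "2 * pi - h - s"] g[of "s - h"] h by (simp add: reflected_diff_def)
    moreover have "mid g h s = ((g (s + h) - g (h - s)) / s)\<^sup>2"
      using 1 h s by (simp add: mid_def indicator_def add.commute)
    moreover have "0 < s"
      using s ne by auto
    ultimately show ?thesis
      using shrink[of s "g (s + h) - g (h - s)"] 1 mid_nonneg[of g s h] mid_nonneg[of g "pi - h" "pi - s"]
      by simp
  next
    case 2
    then have "reflected_diff g h s = g (s + h) - g (s - h)"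
      using g[of "2 * pi - h - s"] g[of "h - s"] h by (simp add: reflected_diff_def)
    moreover have "mid g s h = ((g (s + h) - g (s - h)) / h)\<^sup>2"
      using 2 h s by (simp add: mid_def indicator_def)
    ultimately show ?thesis
      using mid_nonneg[of g h s] mid_nonneg[of g "pi - h" "pi - s"] by simp
  next
    case 3
    then have "reflected_diff g h s = g (2 * pi - h - s) - g (s - h)"
      using g[of "s + h"] g[of "h - s"] h by (simp add: reflected_diff_def)
    moreover have "mid g (pi - h) (pi - s) = ((g (2 * pi - h - s) - g (s - h)) / (pi - s))\<^sup>2"
      using 3 h s by (simp add: mid_def indicator_def algebra_simps)
    moreover have "0 < pi - s" "pi - s < h"
      using s ne 3 by auto
    ultimately show ?thesis
      using shrink[of "pi - s" "g (2 * pi - h - s) - g (s - h)"] mid_nonneg[of g s h] mid_nonneg[of g h s]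
      by simp
  qed
qed

lemma sin_nat_2pi_minus: "sin (real k * (2 * pi - t)) = - sin (real k * t)"
proof -
  have "real k * (2 * pi - t) = real k * (2 * pi) - real k * t"
    by (simp add: right_diff_distrib)
  moreover have "sin (real k * (2 * pi)) = 0" "cos (real k * (2 * pi)) = 1"
    using sin_npi[of "2 * k"] cos_npi[of "2 * k"] by (simp_all add: ac_simps)
  ultimately show ?thesis
    by (simp add: sin_diff)
qed

text \<open>Each of the four terms is substituted so that \<open>g\<close> carries the integration
  variable \<open>r\<close>. The windowed sines then combine to
  \<open>sin (k (r - h)) - sin (k (r + h))\<close>, a product of \<open>sin (k h)\<close> and
  \<open>cos (k r)\<close>.\<close>

lemma reflected_diff_sine_coefficient:
  assumes [measurable]: "g \<in> borel_measurable borel" and int: "integrable lborel g"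
    and g: "\<And>x. x \<notin> {0..pi} \<Longrightarrow> g x = 0" and h: "0 < h" "h < pi / 2"
  shows "(LINT s|lborel. indicator {0..pi} s * (reflected_diff g h s * sin (real k * s)))
    = - 2 * sin (real k * h) * (LINT t|lborel. g t * cos (real k * t))"
proof -
  let ?K = "\<lambda>s. indicator {0..pi} s * sin (real k * s)"
  define F where "F c t r = g r * ?K (t + c * r)" for c t r
  have F_meas [measurable]: "F c t \<in> borel_measurable borel" for c t
    unfolding F_def[abs_def] by measurable
  have F_int: "integrable lborel (F c t)" for c t
    unfolding F_def[abs_def] using int
    by (rule integrable_mult_bounded[where B = 1]) (auto simp: indicator_def)
  have *: "(LINT s|lborel. g (t + c * s) * ?K s) = (LINT r|lborel. F c (- (c * t)) r)"
    "integrable lborel (\<lambda>s. g (t + c * s) * ?K s)" if "c = 1 \<or> c = -1" for t c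
  proof -
    have "c * c = 1" and c: "c \<noteq> 0" "\<bar>c\<bar> = 1"
      using that by auto
    then have eq: "F c (- (c * t)) (t + c * s) = g (t + c * s) * ?K s" for s
      by (simp add: F_def distrib_left flip: mult.assoc)
    show "(LINT s|lborel. g (t + c * s) * ?K s) = (LINT r|lborel. F c (- (c * t)) r)"
      using lborel_integral_real_affine[OF c(1), of "F c (- (c * t))" t] c(2) by (simp add: eq)
    show "integrable lborel (\<lambda>s. g (t + c * s) * ?K s)"
      using lborel_integrable_real_affine[OF F_int c(1), of c "- (c * t)" t] by (simp add: eq)
  qed
  have "(LINT s|lborel. indicator {0..pi} s * (reflected_diff g h s * sin (real k * s)))
      = (LINT s|lborel. g (h + 1 * s) * ?K s + g ((2 * pi - h) + (-1) * s) * ?K s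
          - g (- h + 1 * s) * ?K s - g (h + (-1) * s) * ?K s)"
    by (intro Bochner_Integration.integral_cong refl) (simp add: reflected_diff_def algebra_simps)
  also have "\<dots> = (LINT s|lborel. g (h + 1 * s) * ?K s) + (LINT s|lborel. g ((2 * pi - h) + (-1) * s) * ?K s)
          - (LINT s|lborel. g (- h + 1 * s) * ?K s) - (LINT s|lborel. g (h + (-1) * s) * ?K s)"
    using *(2)[of 1 h] *(2)[of "-1" "2 * pi - h"] *(2)[of 1 "- h"] *(2)[of "-1" h] by simp
  also have "\<dots> = (LINT r|lborel. F 1 (- h) r) + (LINT r|lborel. F (-1) (2 * pi - h) r)
          - (LINT r|lborel. F 1 h r) - (LINT r|lborel. F (-1) h r)"
    using *(1)[of 1 h] *(1)[of "-1" "2 * pi - h"] *(1)[of 1 "- h"] *(1)[of "-1" h] by simp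
  also have "\<dots> = (LINT r|lborel. F 1 (- h) r + F (-1) (2 * pi - h) r - F 1 h r - F (-1) h r)"
    using F_int by simp
  also have "\<dots> = (LINT r|lborel. (- 2 * sin (real k * h)) * (g r * cos (real k * r)))"
  proof (rule integral_cong_AE)
    show "AE r in lborel. F 1 (- h) r + F (-1) (2 * pi - h) r - F 1 h r - F (-1) h r
        = (- 2 * sin (real k * h)) * (g r * cos (real k * r))"
      using AE_lborel_singleton[of h] AE_lborel_singleton[of "pi - h"]
    proof eventually_elim
      case (elim r)
      show ?case
      proof (cases "r \<in> {0..pi}")
        case True
        \<comment> \<open>Away from the two excluded points exactly one of the windows at
          \<open>r - h\<close> and \<open>h - r\<close> is active, and exactly one of those at
          \<open>r + h\<close> and \<open>2 * pi - h - r\<close>. Oddness and periodicity give the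
          reflected sine the sign that completes the formula.\<close>
        have 1: "?K (- h + r) = (if h < r then sin (real k * (r - h)) else 0)"
          using True elim h by (auto simp: indicator_def)
        have 2: "?K (2 * pi - h - r) = (if pi - h < r then - sin (real k * (r + h)) else 0)"
          using True elim h sin_nat_2pi_minus[of k "h + r"] by (auto simp: indicator_def algebra_simps)
        have 3: "?K (h + r) = (if pi - h < r then 0 else sin (real k * (r + h)))"
          using True elim h by (auto simp: indicator_def algebra_simps)
        have 4: "?K (h - r) = (if h < r then 0 else - sin (real k * (r - h)))"
          using True elim h sin_minus[of "real k * (r - h)"] by (auto simp: indicator_def algebra_simps)
        have "F 1 (- h) r + F (-1) (2 * pi - h) r - F 1 h r - F (-1) h r
            = g r * (?K (- h + r) + ?K (2 * pi - h - r) - ?K (h + r) - ?K (h - r))"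
          by (simp add: F_def algebra_simps)
        also have "?K (- h + r) + ?K (2 * pi - h - r) - ?K (h + r) - ?K (h - r)
            = sin (real k * (r - h)) - sin (real k * (r + h))"
          unfolding 1 2 3 4 by simp
        also have "\<dots> = - 2 * sin (real k * h) * cos (real k * r)"
          by (simp add: distrib_left right_diff_distrib sin_add sin_diff)
        finally show ?thesis by simp
      qed (simp add: F_def g)
    qed
  qed measurable
  also have "\<dots> = - 2 * sin (real k * h) * (LINT r|lborel. g r * cos (real k * r))"
    by (rule Bochner_Integration.integral_mult_right_zero)
  finally show ?thesis .
qed

lemma LINT_interval_lborel:
  fixes f :: "real \<Rightarrow> real"
  assumes "f \<in> borel_measurable borel"
  shows "(LINT x|lebesgue_on {a..b}. f x) = (LINT x|lborel. indicator {a..b} x * f x)"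
  using assms by (simp add: integral_restrict_space integral_completion)

text \<open>Nothing is claimed when the right side is infinite; otherwise the quotient is
  square-integrable and Bessel's inequality for the sines applies. Starting at \<open>Suc j\<close>
  leaves out frequency 0, where the sine is the zero function.\<close>

lemma reflected_diff_Bessel:
  assumes g_meas [measurable]: "g \<in> borel_measurable borel" and int: "integrable lborel g"
    and g: "\<And>x. x \<notin> {0..pi} \<Longrightarrow> g x = 0" and h: "0 < h" "h < pi / 2"
  shows "ennreal (\<Sum>j<n. 4 * (ip {0..pi} g (phi (Suc j)))\<^sup>2 * (sin (real (Suc j) * h) / h)\<^sup>2)
    \<le> (\<integral>\<^sup>+s. ennreal ((reflected_diff g h s / h)\<^sup>2) * indicator {0..pi} s \<partial>lborel)"
proof (cases "(\<integral>\<^sup>+s. ennreal ((reflected_diff g h s / h)\<^sup>2) * indicator {0..pi} s \<partial>lborel) = \<infinity>")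
  case False
  let ?u = "\<lambda>s. reflected_diff g h s / h"
  let ?e = "\<lambda>j x. sin (real (Suc j) * x)"
  have u_meas [measurable]: "?u \<in> borel_measurable borel"
    unfolding reflected_diff_def by measurable
  have nn: "(\<integral>\<^sup>+s. ennreal ((?u s)\<^sup>2) \<partial>lebesgue_on {0..pi}) = (\<integral>\<^sup>+s. ennreal ((?u s)\<^sup>2) * indicator {0..pi} s \<partial>lborel)"
    by (rule nn_integral_lebesgue_on_interval) measurable
  have u_meas': "?u \<in> borel_measurable (lebesgue_on {0..pi})"
    using u_meas by (intro measurable_restrict_space1 measurable_completion) simp
  have u: "?u \<in> L2 {0..pi}"
    unfolding L2_def using u_meas' False nn
    by (auto intro!: integrableI_bounded simp: top.not_eq_extremum)
  have coeff: "(ip {0..pi} ?u (?e j))\<^sup>2 = (pi / 2) * (4 * (ip {0..pi} g (phi (Suc j)))\<^sup>2 * (sin (real (Suc j) * h) / h)\<^sup>2)" for j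
  proof -
    let ?a = "LINT t|lborel. g t * cos (real (Suc j) * t)"
    have "ip {0..pi} ?u (?e j) = (1 / h) * ip {0..pi} (reflected_diff g h) (?e j)"
      using ip_scale_left[of _ "1 / h" "reflected_diff g h"] by simp
    also have "ip {0..pi} (reflected_diff g h) (?e j) = (LINT s|lborel. indicator {0..pi} s * (reflected_diff g h s * sin (real (Suc j) * s)))"
      unfolding ip_def by (rule LINT_interval_lborel) (simp add: reflected_diff_def)
    also have "\<dots> = - 2 * sin (real (Suc j) * h) * ?a"
      by (rule reflected_diff_sine_coefficient[OF g_meas int g h])
    finally have 1: "ip {0..pi} ?u (?e j) = - 2 * (sin (real (Suc j) * h) / h) * ?a"
      by simp
    have "ip {0..pi} g (phi (Suc j)) = (LINT s|lborel. indicator {0..pi} s * (g s * phi (Suc j) s))"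
      unfolding ip_def by (rule LINT_interval_lborel) (simp add: phi_def)
    also have "\<dots> = (LINT s|lborel. cn (Suc j) * (g s * cos (real (Suc j) * s)))"
    proof (intro Bochner_Integration.integral_cong refl)
      show "indicator {0..pi} s * (g s * phi (Suc j) s) = cn (Suc j) * (g s * cos (real (Suc j) * s))" for s
        by (cases "s \<in> {0..pi}") (simp_all add: phi_def g del: of_nat_Suc)
    qed
    finally have 2: "ip {0..pi} g (phi (Suc j)) = cn (Suc j) * ?a"
      by simp
    have "(cn (Suc j))\<^sup>2 * pi = 2"
      by (simp add: cn_def)
    then show ?thesis
      unfolding 1 2 power_mult_distrib by (simp add: ac_simps)
  qed
  have "(\<Sum>j<n. (ip {0..pi} ?u (?e j))\<^sup>2) \<le> pi / 2 * ip {0..pi} ?u ?u"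
    by (rule Bessel_inequality[OF u]) (auto simp: sin_L2 ip_sin simp del: of_nat_Suc)
  then have "pi / 2 * (\<Sum>j<n. 4 * (ip {0..pi} g (phi (Suc j)))\<^sup>2 * (sin (real (Suc j) * h) / h)\<^sup>2) \<le> pi / 2 * ip {0..pi} ?u ?u"
    unfolding coeff sum_distrib_left .
  then have "(\<Sum>j<n. 4 * (ip {0..pi} g (phi (Suc j)))\<^sup>2 * (sin (real (Suc j) * h) / h)\<^sup>2) \<le> ip {0..pi} ?u ?u"
    by (rule mult_left_le_imp_le) simp
  then have "ennreal (\<Sum>j<n. 4 * (ip {0..pi} g (phi (Suc j)))\<^sup>2 * (sin (real (Suc j) * h) / h)\<^sup>2) \<le> ennreal (ip {0..pi} ?u ?u)"
    by (rule ennreal_leI)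
  also have "\<dots> = (\<integral>\<^sup>+s. ennreal ((?u s)\<^sup>2) * indicator {0..pi} s \<partial>lborel)"
    using nrm_nn_integral[OF u] nn by (simp add: nrm_power2)
  finally show ?thesis .
qed simp

text \<open>All three terms of the pointwise bound have the same integral over the plane: exchanging
  the variables and reflecting both at \<open>pi\<close> preserve it.\<close>

lemma mid_integral_bound:
  assumes [measurable]: "g \<in> borel_measurable borel" and g: "\<And>x. x \<notin> {0..pi} \<Longrightarrow> g x = 0"
  shows "(\<integral>\<^sup>+h. (\<integral>\<^sup>+s. ennreal ((reflected_diff g h s / h)\<^sup>2) * indicator {0..pi} s \<partial>lborel) * indicator {0<..<pi/2} h \<partial>lborel)
    \<le> 3 * (\<integral>\<^sup>+h. \<integral>\<^sup>+s. ennreal (mid g s h) \<partial>lborel \<partial>lborel)"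
proof -
  let ?M = "\<integral>\<^sup>+h. \<integral>\<^sup>+s. ennreal (mid g s h) \<partial>lborel \<partial>lborel"
  have [measurable]: "(\<lambda>p. ennreal (mid g (fst p) (snd p))) \<in> borel_measurable (borel \<Otimes>\<^sub>M borel)"
    unfolding mid_def by measurable
  have swap: "(\<integral>\<^sup>+h. \<integral>\<^sup>+s. ennreal (mid g h s) \<partial>lborel \<partial>lborel) = ?M"
    by (rule lborel_pair.Fubini') (simp add: mid_def)
  have refl: "(\<integral>\<^sup>+h. \<integral>\<^sup>+s. ennreal (mid g (pi - h) (pi - s)) \<partial>lborel \<partial>lborel) = ?M"
  proof -
    have "(\<integral>\<^sup>+s. ennreal (mid g x (pi - s)) \<partial>lborel) = (\<integral>\<^sup>+s. ennreal (mid g x s) \<partial>lborel)" for x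
      using nn_integral_real_affine[of "\<lambda>s. ennreal (mid g x s)" "-1" pi] by (simp add: mid_def)
    then have "(\<integral>\<^sup>+h. \<integral>\<^sup>+s. ennreal (mid g (pi - h) (pi - s)) \<partial>lborel \<partial>lborel)
        = (\<integral>\<^sup>+h. \<integral>\<^sup>+s. ennreal (mid g (pi - h) s) \<partial>lborel \<partial>lborel)"
      by simp
    also have "\<dots> = (\<integral>\<^sup>+h. \<integral>\<^sup>+s. ennreal (mid g h s) \<partial>lborel \<partial>lborel)"
      using nn_integral_real_affine[of "\<lambda>h. \<integral>\<^sup>+s. ennreal (mid g h s) \<partial>lborel" "-1" pi] by (simp add: mid_def)
    finally show ?thesis
      using swap by simp
  qed
  have "(\<integral>\<^sup>+h. (\<integral>\<^sup>+s. ennreal ((reflected_diff g h s / h)\<^sup>2) * indicator {0..pi} s \<partial>lborel) * indicator {0<..<pi/2} h \<partial>lborel)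
      \<le> (\<integral>\<^sup>+h. \<integral>\<^sup>+s. ennreal (mid g s h) + ennreal (mid g h s) + ennreal (mid g (pi - h) (pi - s)) \<partial>lborel \<partial>lborel)"
  proof (rule nn_integral_mono)
    fix h :: real
    show "(\<integral>\<^sup>+s. ennreal ((reflected_diff g h s / h)\<^sup>2) * indicator {0..pi} s \<partial>lborel) * indicator {0<..<pi/2} h
        \<le> (\<integral>\<^sup>+s. ennreal (mid g s h) + ennreal (mid g h s) + ennreal (mid g (pi - h) (pi - s)) \<partial>lborel)"
    proof (cases "h \<in> {0<..<pi/2}")
      case True
      have "(\<integral>\<^sup>+s. ennreal ((reflected_diff g h s / h)\<^sup>2) * indicator {0..pi} s \<partial>lborel)
          \<le> (\<integral>\<^sup>+s. ennreal (mid g s h) + ennreal (mid g h s) + ennreal (mid g (pi - h) (pi - s)) \<partial>lborel)"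
      proof (rule nn_integral_mono_AE)
        show "AE s in lborel. ennreal ((reflected_diff g h s / h)\<^sup>2) * indicator {0..pi} s
            \<le> ennreal (mid g s h) + ennreal (mid g h s) + ennreal (mid g (pi - h) (pi - s))"
          using AE_lborel_singleton[of "0::real"] AE_lborel_singleton[of h] AE_lborel_singleton[of "pi - h"] AE_lborel_singleton[of pi]
        proof eventually_elim
          case (elim s)
          show ?case
          proof (cases "s \<in> {0..pi}")
            case s: True
            have "ennreal ((reflected_diff g h s / h)\<^sup>2) \<le> ennreal (mid g s h + mid g h s + mid g (pi - h) (pi - s))"
              using True s elim by (intro ennreal_leI reflected_diff_le_mid g) auto
            then show ?thesis
              using s by (simp add: ennreal_plus mid_nonneg)
          qed simp
        qed
      qed
      then show ?thesis
        using True by simp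
    qed simp
  qed
  also have "\<dots> = ?M + (\<integral>\<^sup>+h. \<integral>\<^sup>+s. ennreal (mid g h s) \<partial>lborel \<partial>lborel)
      + (\<integral>\<^sup>+h. \<integral>\<^sup>+s. ennreal (mid g (pi - h) (pi - s)) \<partial>lborel \<partial>lborel)"
    by (simp add: nn_integral_add mid_def)
  also have "\<dots> = 3 * ?M"
  proof -
    have "(3::ennreal) = 1 + 1 + 1"
      by simp
    then show ?thesis
      unfolding swap refl by (simp only: distrib_right mult_1)
  qed
  finally show ?thesis .
qed

text \<open>A Borel representative that vanishes off the interval makes Fubini and affine
  substitutions on the whole line available.\<close>

lemma L2_interval_borel_version:
  assumes f: "f \<in> L2 {a..b::real}"
  obtains g where "g \<in> borel_measurable borel" "\<And>x. x \<notin> {a..b} \<Longrightarrow> g x = 0"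
    "AE x in lebesgue_on {a..b}. f x = g x" "g \<in> L2 {a..b}" "integrable lborel g"
proof -
  have "(\<lambda>x. if x \<in> {a..b} then f x else 0) \<in> borel_measurable lebesgue"
    by (rule borel_measurable_if_I[OF L2_measurable[OF f]]) simp
  from completion_ex_borel_measurable_real[OF this]
  obtain g' where g': "g' \<in> borel_measurable lborel" "AE x in lborel. (if x \<in> {a..b} then f x else 0) = g' x"
    by blast
  define g where "g x = indicator {a..b} x * g' x" for x
  have g_meas: "g \<in> borel_measurable borel"
    using g'(1) unfolding g_def[abs_def] by measurable
  have "AE x in lebesgue. x \<in> {a..b} \<longrightarrow> f x = g x"
    using AE_completion[OF g'(2)] by eventually_elim (auto simp: g_def)
  then have eq: "AE x in lebesgue_on {a..b}. f x = g x"
    by (subst AE_restrict_space_iff) auto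
  have g_meas': "g \<in> borel_measurable (lebesgue_on {a..b})"
    using g_meas by (intro measurable_restrict_space1 measurable_completion) simp
  have "integrable (lebesgue_on {a..b}) (\<lambda>x. (g x)\<^sup>2)"
  proof (rule integrable_cong_AE_imp[OF L2_square_integrable[OF f]])
    show "AE x in lebesgue_on {a..b}. (f x)\<^sup>2 = (g x)\<^sup>2"
      using eq by eventually_elim simp
  qed (use g_meas' in measurable)
  then have g_L2: "g \<in> L2 {a..b}"
    using g_meas' by (simp add: L2_def)
  have "integrable (lebesgue_on {a..b}) g"
    by (rule L2_imp_integrable[OF _ g_L2]) simp
  then have "integrable lebesgue (\<lambda>x. indicator {a..b} x *\<^sub>R g x)"
    by (simp add: integrable_restrict_space)
  moreover have "(\<lambda>x. indicator {a..b} x *\<^sub>R g x) = g"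
    by (rule ext) (simp add: g_def indicator_def)
  ultimately have "integrable lborel g"
    using g_meas by (simp add: integrable_completion)
  then show thesis
    using that[of g] g_meas eq g_L2 by (simp add: g_def)
qed

text \<open>Bessel's inequality at fixed \<open>h\<close>, integrated over \<open>(0, pi/2)\<close>:
  on the left \<open>\<integral> (sin (k h) / h)\<^sup>2 dh \<ge> k / 4\<close> produces the weight
  \<open>k\<close>, and the right is at most three times the midpoint integral, which finiteness of
  the Gagliardo seminorm controls.\<close>

lemma H_half_summable:
  assumes f: "f \<in> H_half {0..pi}"
  shows "summable (\<lambda>k. real k * (ip {0..pi} f (phi k))\<^sup>2)"
proof -
  let ?J = "{0..pi} \<times> {0..pi}"
  have fL2: "f \<in> L2 {0..pi}" and fint: "integrable (lebesgue_on ?J) (\<lambda>p. (quot f p)\<^sup>2)"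
    using f by (auto simp: H_half_def quot_def case_prod_unfold)
  obtain g where g_meas [measurable]: "g \<in> borel_measurable borel" and g: "\<And>x. x \<notin> {0..pi} \<Longrightarrow> g x = 0"
    and eq: "AE x in lebesgue_on {0..pi}. f x = g x" and gL2: "g \<in> L2 {0..pi}" and gint: "integrable lborel g"
    using L2_interval_borel_version[OF fL2] by blast
  have coeff: "ip {0..pi} f (phi k) = ip {0..pi} g (phi k)" for k
    by (rule ip_cong_AE[OF eq]) (auto simp: fL2 gL2 phi_L2)
  define b where "b k = ip {0..pi} g (phi k)" for k
  define M where "M = (\<integral>\<^sup>+h. \<integral>\<^sup>+s. ennreal (mid g s h) \<partial>lborel \<partial>lborel)"
  have "ennreal (1/2) * M = (\<integral>\<^sup>+p. ennreal ((quot g p)\<^sup>2) \<partial>lebesgue_on ?J)"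
    unfolding M_def by (rule Gagliardo_midpoint[symmetric]) simp
  also have "\<dots> = (\<integral>\<^sup>+p. ennreal ((quot f p)\<^sup>2) \<partial>lebesgue_on ?J)"
    by (rule nn_integral_cong_AE, use AE_lebesgue_on_square[OF eq] in eventually_elim) (simp add: quot_def)
  also have "\<dots> < \<infinity>"
    using fint by (simp add: integrable_iff_bounded)
  finally have M: "M < \<infinity>"
    by (auto simp: ennreal_mult_less_top)
  have bound: "ennreal (\<Sum>j<n. real (Suc j) * (b (Suc j))\<^sup>2) \<le> 3 * M" for n
  proof -
    let ?s = "\<lambda>j h. ennreal ((sin (real (Suc j) * h) / h)\<^sup>2) * indicator {0<..<pi/2} h"
    \<comment> \<open>The 4 matches the coefficient in \<open>reflected_diff_Bessel\<close>, the 1/4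
      the lower bound of the sine integral.\<close>
    have "ennreal (\<Sum>j<n. real (Suc j) * (b (Suc j))\<^sup>2) = (\<Sum>j<n. ennreal (4 * (b (Suc j))\<^sup>2) * ennreal (real (Suc j) / 4))"
      by (simp add: ac_simps flip: ennreal_mult sum_ennreal del: of_nat_Suc)
    also have "\<dots> \<le> (\<Sum>j<n. ennreal (4 * (b (Suc j))\<^sup>2) * (\<integral>\<^sup>+h. ?s j h \<partial>lborel))"
      by (intro sum_mono mult_left_mono nn_integral_sin_over_ge) auto
    also have "\<dots> = (\<integral>\<^sup>+h. (\<Sum>j<n. ennreal (4 * (b (Suc j))\<^sup>2) * ?s j h) \<partial>lborel)"
      by (subst nn_integral_sum) (auto simp: nn_integral_cmult)
    also have "\<dots> \<le> (\<integral>\<^sup>+h. (\<integral>\<^sup>+s. ennreal ((reflected_diff g h s / h)\<^sup>2) * indicator {0..pi} s \<partial>lborel) * indicator {0<..<pi/2} h \<partial>lborel)"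
    proof (rule nn_integral_mono)
      fix h :: real
      show "(\<Sum>j<n. ennreal (4 * (b (Suc j))\<^sup>2) * ?s j h)
          \<le> (\<integral>\<^sup>+s. ennreal ((reflected_diff g h s / h)\<^sup>2) * indicator {0..pi} s \<partial>lborel) * indicator {0<..<pi/2} h"
      proof (cases "h \<in> {0<..<pi/2}")
        case True
        then have "(\<Sum>j<n. ennreal (4 * (b (Suc j))\<^sup>2) * ?s j h)
            = ennreal (\<Sum>j<n. 4 * (b (Suc j))\<^sup>2 * (sin (real (Suc j) * h) / h)\<^sup>2)"
          by (simp add: ennreal_mult flip: sum_ennreal del: of_nat_Suc)
        also have "\<dots> \<le> (\<integral>\<^sup>+s. ennreal ((reflected_diff g h s / h)\<^sup>2) * indicator {0..pi} s \<partial>lborel)"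
          unfolding b_def using True by (intro reflected_diff_Bessel g_meas gint g) auto
        finally show ?thesis
          using True by simp
      qed simp
    qed
    also have "\<dots> \<le> 3 * M"
      unfolding M_def by (rule mid_integral_bound[OF g_meas g])
    finally show ?thesis .
  qed
  have "3 * M < \<infinity>"
    using M by (simp add: ennreal_mult_less_top)
  then have fin: "3 * M = ennreal (enn2real (3 * M))"
    by simp
  have "summable (\<lambda>j. real (Suc j) * (b (Suc j))\<^sup>2)"
  proof (rule summableI_nonneg_bounded)
    show "(\<Sum>j<n. real (Suc j) * (b (Suc j))\<^sup>2) \<le> enn2real (3 * M)" for n
      using bound[of n] by (subst (asm) fin) (simp add: ennreal_le_iff)
  qed simp
  then show ?thesis
    unfolding coeff b_def using summable_Suc_iff[of "\<lambda>k. real k * (ip {0..pi} g (phi k))\<^sup>2"] by simp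
qed

section \<open>Harmonic separated functions\<close>

lemma smooth_deriv_cosh: "smooth_deriv (\<lambda>y. cosh (a * y + c)) (\<lambda>y. a * sinh (a * y + c))"
  unfolding smooth_deriv_def using smooth_cosh_snd[of a c]
  by (auto intro!: derivative_eq_intros)

lemma smooth_deriv_sinh: "smooth_deriv (\<lambda>y. sinh (a * y + c)) (\<lambda>y. a * cosh (a * y + c))"
  unfolding smooth_deriv_def using smooth_sinh_snd[of a c]
  by (auto intro!: derivative_eq_intros)

lemma smooth_deriv_cos: "smooth_deriv (\<lambda>y. cos (a * y)) (\<lambda>y. - a * sin (a * y))"
  unfolding smooth_deriv_def using smooth_cos_snd[of a]
  by (auto intro!: derivative_eq_intros)

lemma smooth_deriv_sin: "smooth_deriv (\<lambda>y. sin (a * y)) (\<lambda>y. a * cos (a * y))"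
proof -
  have "smooth (\<lambda>z::real \<times> real. cos (a * snd z + (- (pi / 2))))"
    by (rule smooth_linear_cos[OF bounded_linear_scaled_snd])
  then show ?thesis
    unfolding smooth_deriv_def by (auto intro!: derivative_eq_intros simp: cos_diff)
qed

lemma smooth_deriv_linear: "smooth_deriv (\<lambda>y. a * y + c) (\<lambda>y. a)"
  unfolding smooth_deriv_def using smooth_snd[of a c]
  by (auto intro!: derivative_eq_intros)

lemma smooth_deriv_const: "smooth_deriv (\<lambda>y. c) (\<lambda>y. 0)"
  by (simp add: smooth_deriv_def)

lemma smooth_deriv_add:
  "smooth_deriv a a' \<Longrightarrow> smooth_deriv b b' \<Longrightarrow> smooth_deriv (\<lambda>y. a y + b y) (\<lambda>y. a' y + b' y)"
  by (auto simp: smooth_deriv_def smooth_add intro: DERIV_add)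

lemma smooth_deriv_diff:
  "smooth_deriv a a' \<Longrightarrow> smooth_deriv b b' \<Longrightarrow> smooth_deriv (\<lambda>y. a y - b y) (\<lambda>y. a' y - b' y)"
  by (auto simp: smooth_deriv_def smooth_diff intro: DERIV_diff)

lemma smooth_deriv_cmult: "smooth_deriv a a' \<Longrightarrow> smooth_deriv (\<lambda>y. c * a y) (\<lambda>y. c * a' y)"
  by (auto simp: smooth_deriv_def smooth_cmult intro: DERIV_cmult)

lemma sep_scale: "sep k (\<lambda>y. c * a y) = (\<lambda>z. c * sep k a z)"
  by (rule ext) (simp add: sep_def)

lemma dsep_scale: "dsep k (\<lambda>y. c * a y) = (\<lambda>z. c * dsep k a z)"
  by (rule ext) (simp add: dsep_def)

lemma sep_add: "sep k (\<lambda>y. a y + b y) = (\<lambda>z. sep k a z + sep k b z)"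
  by (rule ext) (simp add: sep_def distrib_left)

lemma dsep_add: "dsep k (\<lambda>y. a y + b y) = (\<lambda>z. dsep k a z + dsep k b z)"
  by (rule ext) (simp add: dsep_def distrib_left)

lemma sep_slice: "sep k a (x, y) = phi k x * a y"
  by (simp add: sep_def phi_def)

lemma phi_H_half: "phi k \<in> H_half {0..pi}"
  using phi_sum_H_half[of "{k}" "\<lambda>k. 1"] by simp

lemma phi_scaled_H_half: "(\<lambda>x. c * phi k x) \<in> H_half {0..pi}"
  using phi_sum_H_half[of "{k}" "\<lambda>k. c"] by simp

section \<open>Functionals in \<open>H_minus_half\<close> on cosine series\<close>

lemma H_minus_half_scale:
  "G \<in> H_minus_half {0..pi} \<Longrightarrow> v \<in> H_half {0..pi} \<Longrightarrow> G (\<lambda>x. c * v x) = c * G v"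
  by (simp add: H_minus_half_def)

lemma H_minus_half_add:
  "G \<in> H_minus_half {0..pi} \<Longrightarrow> v \<in> H_half {0..pi} \<Longrightarrow> w \<in> H_half {0..pi} \<Longrightarrow>
    G (\<lambda>x. v x + w x) = G v + G w"
  by (simp add: H_minus_half_def)

lemma H_minus_half_sum:
  assumes G: "G \<in> H_minus_half {0..pi}"
  shows "G (\<lambda>x. \<Sum>k<n. c k * phi k x) = (\<Sum>k<n. c k * G (phi k))"
proof (induction n)
  case 0
  show ?case
    using H_minus_half_scale[OF G phi_H_half, of 0 0] by simp
next
  case (Suc n)
  show ?case
    using H_minus_half_add[OF G phi_sum_H_half[of "{..<n}" c] phi_scaled_H_half[of "c n" n]]
    by (simp add: Suc H_minus_half_scale[OF G phi_H_half])
qed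

text \<open>The functional is bounded for the \<open>H_half\<close> norm, so convergence in that
  norm is what permits termwise evaluation; linearity is available only inside
  \<open>H_half\<close>.\<close>

lemma H_minus_half_Fourier:
  assumes G: "G \<in> H_minus_half {0..pi}" and w: "w \<in> L2 {0..pi}"
    and summ: "summable (\<lambda>k. real k * (ip {0..pi} w (phi k))\<^sup>2)"
  shows "(\<lambda>n. \<Sum>k<n. ip {0..pi} w (phi k) * G (phi k)) \<longlonglongrightarrow> G w"
proof -
  let ?c = "\<lambda>k. ip {0..pi} w (phi k)"
  note HF = H_half_Fourier[OF w summ]
  obtain C where "\<forall>v\<in>H_half {0..pi}. \<bar>G v\<bar> \<le> C * H_half_norm {0..pi} v"
    using G unfolding H_minus_half_def by blast
  then have C: "\<bar>G v\<bar> \<le> C * H_half_norm {0..pi} v" if "v \<in> H_half {0..pi}" for v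
    using that by blast
  have eq: "G (\<lambda>x. w x - (\<Sum>k<n. ?c k * phi k x)) = G w - (\<Sum>k<n. ?c k * G (phi k))" for n
  proof -
    have "G (\<lambda>x. w x + (\<Sum>k<n. (- ?c k) * phi k x)) = G w + (\<Sum>k<n. (- ?c k) * G (phi k))"
      using H_minus_half_add[OF G HF(1) phi_sum_H_half[of "{..<n}" "\<lambda>k. - ?c k"]]
      by (simp only: H_minus_half_sum[OF G] finite_lessThan)
    then show ?thesis
      by (simp add: sum_negf)
  qed
  have "(\<lambda>n. C * H_half_norm {0..pi} (\<lambda>x. w x - (\<Sum>k<n. ?c k * phi k x))) \<longlonglongrightarrow> 0"
    by (rule tendsto_mult_right_zero[OF HF(3)])
  then have "(\<lambda>n. G w - (\<Sum>k<n. ?c k * G (phi k))) \<longlonglongrightarrow> 0"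
  proof (rule Lim_null_comparison[rotated])
    show "\<forall>\<^sub>F n in sequentially. norm (G w - (\<Sum>k<n. ?c k * G (phi k)))
        \<le> C * H_half_norm {0..pi} (\<lambda>x. w x - (\<Sum>k<n. ?c k * phi k x))"
      using C[OF HF(2)] unfolding eq by simp
  qed
  from tendsto_diff[OF tendsto_const[of "G w"] this] show ?thesis
    by simp
qed

lemma L2lim_Suc: "L2lim S F f \<Longrightarrow> L2lim S (\<lambda>n. F (Suc n)) f"
  unfolding L2lim_def by (auto intro: LIMSEQ_Suc)

context rectangle
begin

lemma wgrad_zero: "wgrad \<Omega> (\<lambda>z. 0) (\<lambda>z. 0) (\<lambda>z. 0)"
  by (simp add: wgrad_def has_weak_deriv_iff)

lemma wgrad_sum:
  "(\<And>k. k \<in> A \<Longrightarrow> wgrad \<Omega> (F k) (P k) (Q k)) \<Longrightarrow>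
    wgrad \<Omega> (\<lambda>z. \<Sum>k\<in>A. F k z) (\<lambda>z. \<Sum>k\<in>A. P k z) (\<lambda>z. \<Sum>k\<in>A. Q k z)"
  by (induction A rule: infinite_finite_induct) (auto intro: wgrad_add wgrad_zero)

lemma I_nonneg: "continuous_on UNIV a \<Longrightarrow> I a a \<ge> 0"
  unfolding I_def
  by (intro Henstock_Kurzweil_Integration.integral_nonneg integrable_continuous_interval continuous_on_mult)
    (auto intro: continuous_on_subset)

text \<open>The second condition is \<open>\<eta>'' = k\<^sup>2 \<eta>\<close>, which says that
  \<open>sep k \<eta>\<close> is a harmonic function.\<close>

definition harmonic :: "nat \<Rightarrow> (real \<Rightarrow> real) \<Rightarrow> (real \<Rightarrow> real) \<Rightarrow> bool" where
  "harmonic k \<eta> \<eta>' \<longleftrightarrow> smooth_deriv \<eta> \<eta>' \<and> smooth_deriv \<eta>' (\<lambda>y. (real k)\<^sup>2 * \<eta> y)"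

text \<open>The product \<open>\<eta> \<eta>'\<close> is a primitive of the energy density, so the
  energy of a mode is a boundary expression.\<close>

lemma harmonic_energy:
  assumes h: "harmonic k \<eta> \<eta>'"
  shows "(real k)\<^sup>2 * I \<eta> \<eta> + I \<eta>' \<eta>' = \<eta> ell * \<eta>' ell - \<eta> 0 * \<eta>' 0"
proof -
  have s: "smooth_deriv \<eta> \<eta>'" "smooth_deriv \<eta>' (\<lambda>y. (real k)\<^sup>2 * \<eta> y)"
    using h by (auto simp: harmonic_def)
  have "((\<lambda>y. (real k)\<^sup>2 * (\<eta> y * \<eta> y) + \<eta>' y * \<eta>' y) has_integral \<eta> ell * \<eta>' ell - \<eta> 0 * \<eta>' 0) {0..ell}"
  proof (rule fundamental_theorem_of_calculus)
    fix y
    have "((\<lambda>y. \<eta> y * \<eta>' y) has_real_derivative \<eta>' y * \<eta>' y + (real k)\<^sup>2 * \<eta> y * \<eta> y) (at y)"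
      by (intro DERIV_mult smooth_derivD(3)[OF s(1)] smooth_derivD(3)[OF s(2)])
    then show "((\<lambda>y. \<eta> y * \<eta>' y) has_vector_derivative (real k)\<^sup>2 * (\<eta> y * \<eta> y) + \<eta>' y * \<eta>' y) (at y within {0..ell})"
      by (simp add: has_real_derivative_iff_has_vector_derivative ac_simps has_vector_derivative_at_within)
  qed (use ell_pos in simp)
  moreover have "integral {0..ell} (\<lambda>y. (real k)\<^sup>2 * (\<eta> y * \<eta> y) + \<eta>' y * \<eta>' y) = (real k)\<^sup>2 * I \<eta> \<eta> + I \<eta>' \<eta>'"
    unfolding I_def
    by (subst Henstock_Kurzweil_Integration.integral_add)
      (auto intro!: integrable_continuous_interval continuous_on_mult smooth_derivD[OF s(1)] continuous_on_const)
  ultimately show ?thesis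
    by (simp add: integral_unique)
qed

text \<open>The squared \<open>H1\<close> norm of \<open>sep k \<eta>\<close>: the 1 comes from the
  function, \<open>k\<^sup>2\<close> from its \<open>x\<close>-derivative.\<close>

definition h1energy :: "nat \<Rightarrow> (real \<Rightarrow> real) \<Rightarrow> (real \<Rightarrow> real) \<Rightarrow> real" where
  "h1energy k \<eta> \<eta>' = (1 + (real k)\<^sup>2) * I \<eta> \<eta> + I \<eta>' \<eta>'"

lemma h1energy_nonneg: "smooth_deriv \<eta> \<eta>' \<Longrightarrow> h1energy k \<eta> \<eta>' \<ge> 0"
  unfolding h1energy_def
  by (intro add_nonneg_nonneg mult_nonneg_nonneg I_nonneg smooth_derivD) auto

lemma h1energy_bounds:
  assumes h: "harmonic k \<eta> \<eta>'" and k: "k \<ge> 1"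
  shows "\<eta> ell * \<eta>' ell - \<eta> 0 * \<eta>' 0 \<le> h1energy k \<eta> \<eta>'"
    "h1energy k \<eta> \<eta>' \<le> 2 * (\<eta> ell * \<eta>' ell - \<eta> 0 * \<eta>' 0)"
proof -
  have s: "smooth_deriv \<eta> \<eta>'"
    using h by (auto simp: harmonic_def)
  have nn: "I \<eta> \<eta> \<ge> 0" "I \<eta>' \<eta>' \<ge> 0"
    by (intro I_nonneg smooth_derivD[OF s])+
  have "1 * I \<eta> \<eta> \<le> (real k)\<^sup>2 * I \<eta> \<eta>"
    using k nn by (intro mult_right_mono) auto
  with nn show "\<eta> ell * \<eta>' ell - \<eta> 0 * \<eta>' 0 \<le> h1energy k \<eta> \<eta>'"
    "h1energy k \<eta> \<eta>' \<le> 2 * (\<eta> ell * \<eta>' ell - \<eta> 0 * \<eta>' 0)"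
    unfolding harmonic_energy[OF h, symmetric] h1energy_def distrib_right distrib_left by linarith+
qed

text \<open>Injectivity of \<open>\<kappa>\<close> makes the functions and both components of their
  gradients orthogonal, so three series converge separately, and \<open>wgrad_lim\<close> recognises
  the last two as the gradient of the first. The free \<open>\<kappa>\<close> covers series over all
  frequencies and series starting at frequency 1.\<close>

lemma sep_series:
  fixes \<kappa> :: "nat \<Rightarrow> nat"
  assumes inj: "inj \<kappa>" and s: "\<And>j. smooth_deriv (\<eta> j) (\<eta>' j)"
    and summ: "summable (\<lambda>j. h1energy (\<kappa> j) (\<eta> j) (\<eta>' j))"
  shows "\<exists>u p q. wgrad \<Omega> u p q \<and> L2lim \<Omega> (\<lambda>n z. \<Sum>j<n. sep (\<kappa> j) (\<eta> j) z) u \<and>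
    L2lim \<Omega> (\<lambda>n z. \<Sum>j<n. dsep (\<kappa> j) (\<eta> j) z) p \<and> L2lim \<Omega> (\<lambda>n z. \<Sum>j<n. sep (\<kappa> j) (\<eta>' j) z) q \<and>
    (H1_norm \<Omega> u)\<^sup>2 = (\<Sum>j. h1energy (\<kappa> j) (\<eta> j) (\<eta>' j))"
proof -
  note sd = smooth_derivD[OF s]
  have ne: "\<kappa> i \<noteq> \<kappa> j" if "i \<noteq> j" for i j
    using inj that by (auto dest: injD)
  have L2: "sep (\<kappa> j) (\<eta> j) \<in> L2 \<Omega>" "dsep (\<kappa> j) (\<eta> j) \<in> L2 \<Omega>" "sep (\<kappa> j) (\<eta>' j) \<in> L2 \<Omega>" for j
    by (intro L2_Omega_smooth smooth_sep smooth_dsep sd)+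
  have orth: "ip \<Omega> (sep (\<kappa> i) (\<eta> i)) (sep (\<kappa> j) (\<eta> j)) = 0"
      "ip \<Omega> (dsep (\<kappa> i) (\<eta> i)) (dsep (\<kappa> j) (\<eta> j)) = 0"
      "ip \<Omega> (sep (\<kappa> i) (\<eta>' i)) (sep (\<kappa> j) (\<eta>' j)) = 0" if "i \<noteq> j" for i j
    using ne[OF that] by (simp_all add: ip_sep ip_dsep sd)
  have self: "ip \<Omega> (sep (\<kappa> j) (\<eta> j)) (sep (\<kappa> j) (\<eta> j)) = I (\<eta> j) (\<eta> j)"
      "ip \<Omega> (dsep (\<kappa> j) (\<eta> j)) (dsep (\<kappa> j) (\<eta> j)) = (real (\<kappa> j))\<^sup>2 * I (\<eta> j) (\<eta> j)"
      "ip \<Omega> (sep (\<kappa> j) (\<eta>' j)) (sep (\<kappa> j) (\<eta>' j)) = I (\<eta>' j) (\<eta>' j)" for j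
    by (simp_all add: ip_sep ip_dsep sd)
  have nn: "I (\<eta> j) (\<eta> j) \<ge> 0" "(real (\<kappa> j))\<^sup>2 * I (\<eta> j) (\<eta> j) \<ge> 0" "I (\<eta>' j) (\<eta>' j) \<ge> 0" for j
    by (simp_all add: I_nonneg sd)
  have sum: "h1energy (\<kappa> j) (\<eta> j) (\<eta>' j) = I (\<eta> j) (\<eta> j) + (real (\<kappa> j))\<^sup>2 * I (\<eta> j) (\<eta> j) + I (\<eta>' j) (\<eta>' j)" for j
    by (simp add: h1energy_def distrib_right)
  have S1: "summable (\<lambda>j. I (\<eta> j) (\<eta> j))" and S2: "summable (\<lambda>j. (real (\<kappa> j))\<^sup>2 * I (\<eta> j) (\<eta> j))"
    and S3: "summable (\<lambda>j. I (\<eta>' j) (\<eta>' j))"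
    using nn unfolding sum by (auto intro!: summable_comparison_test'[OF summ[unfolded sum], of 0])
  obtain u where u: "L2lim \<Omega> (\<lambda>n z. \<Sum>j<n. sep (\<kappa> j) (\<eta> j) z) u"
    using L2_orthogonal_series[of \<Omega> "\<lambda>j. sep (\<kappa> j) (\<eta> j)"] L2 orth self S1 by auto
  obtain p where p: "L2lim \<Omega> (\<lambda>n z. \<Sum>j<n. dsep (\<kappa> j) (\<eta> j) z) p"
    using L2_orthogonal_series[of \<Omega> "\<lambda>j. dsep (\<kappa> j) (\<eta> j)"] L2 orth self S2 by auto
  obtain q where q: "L2lim \<Omega> (\<lambda>n z. \<Sum>j<n. sep (\<kappa> j) (\<eta>' j) z) q"
    using L2_orthogonal_series[of \<Omega> "\<lambda>j. sep (\<kappa> j) (\<eta>' j)"] L2 orth self S3 by auto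
  have w: "wgrad \<Omega> u p q"
    by (rule wgrad_lim[OF _ u p q]) (intro wgrad_sum wgrad_sep s)
  let ?F = "\<lambda>n z. \<Sum>j<n. sep (\<kappa> j) (\<eta> j) z" and ?P = "\<lambda>n z. \<Sum>j<n. dsep (\<kappa> j) (\<eta> j) z"
    and ?Q = "\<lambda>n z. \<Sum>j<n. sep (\<kappa> j) (\<eta>' j) z"
  have "(\<lambda>n. ip \<Omega> (?F n) (?F n) + ip \<Omega> (?P n) (?P n) + ip \<Omega> (?Q n) (?Q n)) \<longlonglongrightarrow> ip \<Omega> u u + ip \<Omega> p p + ip \<Omega> q q"
    by (intro tendsto_add L2lim_ip u p q)
  moreover have "ip \<Omega> (?F n) (?F n) + ip \<Omega> (?P n) (?P n) + ip \<Omega> (?Q n) (?Q n) = (\<Sum>j<n. h1energy (\<kappa> j) (\<eta> j) (\<eta>' j))" for n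
    by (simp add: ip_sum_orthogonal L2 orth self sum sum.distrib)
  ultimately have "(\<lambda>j. h1energy (\<kappa> j) (\<eta> j) (\<eta>' j)) sums (ip \<Omega> u u + ip \<Omega> p p + ip \<Omega> q q)"
    by (simp add: sums_def)
  then have "(\<Sum>j. h1energy (\<kappa> j) (\<eta> j) (\<eta>' j)) = ip \<Omega> u u + ip \<Omega> p p + ip \<Omega> q q"
    by (rule sums_unique[symmetric])
  also have "\<dots> = (H1_norm \<Omega> u)\<^sup>2"
    unfolding wgrad_H1_norm[OF w] by (simp add: add_nonneg_nonneg)
  finally have "(H1_norm \<Omega> u)\<^sup>2 = (\<Sum>j. h1energy (\<kappa> j) (\<eta> j) (\<eta>' j))"
    by (rule sym)
  with w u p q show ?thesis
    by (intro exI conjI)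
qed

lemma H1_sums_sep:
  assumes s: "\<And>j. smooth_deriv (\<eta> j) (\<eta>' j)" and u: "wgrad \<Omega> u p q"
    and lim: "L2lim \<Omega> (\<lambda>n z. \<Sum>j<n. sep (\<kappa> j) (\<eta> j) z) u"
      "L2lim \<Omega> (\<lambda>n z. \<Sum>j<n. dsep (\<kappa> j) (\<eta> j) z) p" "L2lim \<Omega> (\<lambda>n z. \<Sum>j<n. sep (\<kappa> j) (\<eta>' j) z) q"
  shows "H1_sums \<Omega> (\<lambda>j. sep (\<kappa> j) (\<eta> j)) u"
  unfolding H1_sums_def
proof (intro conjI allI)
  show "sep (\<kappa> j) (\<eta> j) \<in> H1 \<Omega>" for j
    by (rule wgrad_imp_H1[OF wgrad_sep[OF s]])
  show "u \<in> H1 \<Omega>"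
    by (rule wgrad_imp_H1[OF u])
  have "wgrad \<Omega> (\<lambda>z. \<Sum>j<n. sep (\<kappa> j) (\<eta> j) z) (\<lambda>z. \<Sum>j<n. dsep (\<kappa> j) (\<eta> j) z) (\<lambda>z. \<Sum>j<n. sep (\<kappa> j) (\<eta>' j) z)" for n
    by (intro wgrad_sum wgrad_sep s)
  from H1_norm_tendsto_0[OF this u] lim
  show "(\<lambda>n. H1_norm \<Omega> (\<lambda>z. (\<Sum>k<n. sep (\<kappa> k) (\<eta> k) z) - u z)) \<longlonglongrightarrow> 0"
    by simp
qed

text \<open>Integration by parts in \<open>x\<close> has no boundary term because the sine in
  \<open>dsep\<close> vanishes on the lateral sides, and a second \<open>x\<close>-derivative
  returns \<open>sep\<close> with factor \<open>- k\<^sup>2\<close>.\<close>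

lemma trace_dsep:
  assumes tr: "has_trace ell c u w" and u: "wgrad \<Omega> u p q" and s: "smooth (\<lambda>z::real \<times> real. \<eta> (snd z))"
  shows "ip \<Omega> p (dsep k \<eta>) = (real k)\<^sup>2 * ip \<Omega> u (sep k \<eta>)"
proof -
  have "ip \<Omega> p (dsep k \<eta>) = - ip \<Omega> u (px (dsep k \<eta>))"
    by (rule trace_ibp_x[OF tr u smooth_dsep[OF s]]) (simp_all add: dsep_def)
  then show ?thesis
    by (simp add: px_dsep[OF s] ip_scale_right ip_minus_right)
qed

lemma trace_sep0:
  assumes tr: "has_trace ell 0 u w" and u: "wgrad \<Omega> u p q" and s: "smooth_deriv \<zeta> \<zeta>'" and "\<zeta> ell = 0"
  shows "ip \<Omega> q (sep k \<zeta>) = - ip \<Omega> u (sep k \<zeta>') - \<zeta> 0 * ip {0..pi} w (phi k)"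
proof -
  have "ip \<Omega> q (sep k \<zeta>) = - ip \<Omega> u (py (sep k \<zeta>)) - ip {0..pi} w (\<lambda>x. sep k \<zeta> (x, 0))"
    using \<open>\<zeta> ell = 0\<close>
    by (intro trace_ibp_y0[OF tr u smooth_sep[OF smooth_derivD(1)[OF s]]]) (simp add: sep_slice)
  then show ?thesis
    using ip_scale_right[of _ w "\<zeta> 0" "phi k"] by (simp add: py_sep[OF s] sep_slice mult.commute)
qed

text \<open>Green's formula: harmonicity cancels the volume terms, the zero trace removes the top
  side, and the exterior normal at \<open>y = 0\<close> points downwards, whence the sign of
  \<open>\<eta>' 0\<close>.\<close>

lemma dirichlet_harmonic:
  assumes tr: "has_trace ell 0 v w" "has_trace ell ell v (\<lambda>x. 0)" and v: "wgrad \<Omega> v p q"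
    and h: "harmonic k \<eta> \<eta>'"
  shows "ip \<Omega> p (dsep k \<eta>) + ip \<Omega> q (sep k \<eta>') = - \<eta>' 0 * ip {0..pi} w (phi k)"
proof -
  have s: "smooth_deriv \<eta> \<eta>'" "smooth_deriv \<eta>' (\<lambda>y. (real k)\<^sup>2 * \<eta> y)"
    using h by (auto simp: harmonic_def)
  have "ip \<Omega> q (sep k \<eta>') = - ip \<Omega> v (py (sep k \<eta>')) - ip {0..pi} w (\<lambda>x. sep k \<eta>' (x, 0))
      + ip {0..pi} (\<lambda>x. 0) (\<lambda>x. sep k \<eta>' (x, ell))"
    by (rule trace_ibp_y[OF tr v smooth_sep[OF smooth_derivD(1)[OF s(2)]]])
  moreover have "ip {0..pi} w (\<lambda>x. sep k \<eta>' (x, 0)) = \<eta>' 0 * ip {0..pi} w (phi k)"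
    using ip_scale_right[of _ w "\<eta>' 0" "phi k"] by (simp add: sep_slice mult.commute)
  ultimately show ?thesis
    using trace_dsep[OF tr(1) v smooth_derivD(1)[OF s(1)]]
    by (simp add: py_sep[OF s(2)] sep_scale ip_scale_right)
qed

lemma dirichlet_sep_sum:
  assumes u: "wgrad \<Omega> u p q" and s: "\<And>k. smooth_deriv (\<eta> k) (\<eta>' k)"
  shows "dirichlet_form \<Omega> (\<lambda>z. \<Sum>k\<in>A. sep k (\<eta> k) z) u
    = (\<Sum>k\<in>A. ip \<Omega> p (dsep k (\<eta> k)) + ip \<Omega> q (sep k (\<eta>' k)))"
proof -
  have "dirichlet_form \<Omega> (\<lambda>z. \<Sum>k\<in>A. sep k (\<eta> k) z) u
      = ip \<Omega> (\<lambda>z. \<Sum>k\<in>A. dsep k (\<eta> k) z) p + ip \<Omega> (\<lambda>z. \<Sum>k\<in>A. sep k (\<eta>' k) z) q"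
    by (intro wgrad_dirichlet_form u wgrad_sum wgrad_sep s)
  then show ?thesis
    by (simp add: ip_commute[of _ _ p] ip_commute[of _ _ q] ip_sum_right wgradD[OF u] sum.distrib
        L2_Omega_smooth smooth_sep smooth_dsep smooth_derivD[OF s])
qed

lemma dirichlet_sep_sum_self:
  assumes A: "finite A" and h: "\<And>k. harmonic k (\<eta> k) (\<eta>' k)"
  shows "dirichlet_form \<Omega> (\<lambda>z. \<Sum>k\<in>A. sep k (\<eta> k) z) (\<lambda>z. \<Sum>k\<in>A. sep k (\<eta> k) z)
    = (\<Sum>k\<in>A. \<eta> k ell * \<eta>' k ell - \<eta> k 0 * \<eta>' k 0)"
proof -
  have s: "smooth_deriv (\<eta> k) (\<eta>' k)" for k
    using h by (auto simp: harmonic_def)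
  have w: "wgrad \<Omega> (\<lambda>z. \<Sum>k\<in>A. sep k (\<eta> k) z) (\<lambda>z. \<Sum>k\<in>A. dsep k (\<eta> k) z) (\<lambda>z. \<Sum>k\<in>A. sep k (\<eta>' k) z)"
    by (intro wgrad_sum wgrad_sep s)
  note sm = L2_Omega_smooth smooth_sep smooth_dsep smooth_derivD[OF s]
  have "ip \<Omega> (\<lambda>z. \<Sum>k\<in>A. dsep k (\<eta> k) z) (\<lambda>z. \<Sum>k\<in>A. dsep k (\<eta> k) z) = (\<Sum>k\<in>A. (real k)\<^sup>2 * I (\<eta> k) (\<eta> k))"
    by (subst ip_sum_orthogonal[OF A]) (auto simp: sm ip_dsep)
  moreover have "ip \<Omega> (\<lambda>z. \<Sum>k\<in>A. sep k (\<eta>' k) z) (\<lambda>z. \<Sum>k\<in>A. sep k (\<eta>' k) z) = (\<Sum>k\<in>A. I (\<eta>' k) (\<eta>' k))"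
    by (subst ip_sum_orthogonal[OF A]) (auto simp: sm ip_sep)
  ultimately show ?thesis
    unfolding wgrad_dirichlet_form[OF w w] by (simp add: harmonic_energy[OF h] flip: sum.distrib)
qed

text \<open>The first family contains the profiles of \<open>psi0\<close> and \<open>psi1\<close>;
  the second, with \<open>b = 0\<close>, vanishes on \<open>y = ell\<close> and serves the trace
  estimate.\<close>

lemma harmonic_cosh_sinh:
  assumes "k \<ge> 1"
  shows "harmonic k (\<lambda>y. a * cosh (real k * (ell - y)) + b * sinh (real k * y))
    (\<lambda>y. - (real k * a * sinh (real k * (ell - y))) + real k * b * cosh (real k * y))"
    "harmonic k (\<lambda>y. a * sinh (real k * (ell - y)) + b * sinh (real k * y))
    (\<lambda>y. - (real k * a * cosh (real k * (ell - y))) + real k * b * cosh (real k * y))"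
proof -
  let ?k = "real k"
  have r: "?k * (ell - y) = (- ?k) * y + ?k * ell" for y
    by (simp add: algebra_simps)
  have c: "smooth_deriv (\<lambda>y. a * cosh (?k * (ell - y))) (\<lambda>y. - (?k * a * sinh (?k * (ell - y))))" for a
    using smooth_deriv_cmult[OF smooth_deriv_cosh[of "- ?k" "?k * ell"], of a] unfolding r by (simp add: ac_simps)
  have s: "smooth_deriv (\<lambda>y. a * sinh (?k * (ell - y))) (\<lambda>y. - (?k * a * cosh (?k * (ell - y))))" for a
    using smooth_deriv_cmult[OF smooth_deriv_sinh[of "- ?k" "?k * ell"], of a] unfolding r by (simp add: ac_simps)
  have s': "smooth_deriv (\<lambda>y. b * sinh (?k * y)) (\<lambda>y. ?k * b * cosh (?k * y))" for b
    using smooth_deriv_cmult[OF smooth_deriv_sinh[of ?k 0], of b] by (simp add: ac_simps)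
  have c': "smooth_deriv (\<lambda>y. b * cosh (?k * y)) (\<lambda>y. ?k * b * sinh (?k * y))" for b
    using smooth_deriv_cmult[OF smooth_deriv_cosh[of ?k 0], of b] by (simp add: ac_simps)
  show "harmonic k (\<lambda>y. a * cosh (?k * (ell - y)) + b * sinh (?k * y))
    (\<lambda>y. - (?k * a * sinh (?k * (ell - y))) + ?k * b * cosh (?k * y))"
    using smooth_deriv_add[OF c[of a] s'[of b]] smooth_deriv_add[OF s[of "- (?k * a)"] c'[of "?k * b"]]
    by (simp add: harmonic_def power2_eq_square algebra_simps)
  show "harmonic k (\<lambda>y. a * sinh (?k * (ell - y)) + b * sinh (?k * y))
    (\<lambda>y. - (?k * a * cosh (?k * (ell - y))) + ?k * b * cosh (?k * y))"
    using smooth_deriv_add[OF s[of a] s'[of b]] smooth_deriv_add[OF c[of "- (?k * a)"] c'[of "?k * b"]]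
    by (simp add: harmonic_def power2_eq_square algebra_simps)
qed

lemma harmonic_linear: "harmonic 0 (\<lambda>y. a - b * y) (\<lambda>y. - b)"
  using smooth_deriv_linear[of "- b" a] by (simp add: harmonic_def smooth_deriv_const)

text \<open>Testing against the harmonic function that matches the trace on \<open>y = 0\<close> and vanishes on
  \<open>y = ell\<close> gives the trace theorem in terms of Fourier coefficients.\<close>

lemma trace_Fourier_summable:
  assumes v: "v \<in> H1 \<Omega>" and tr: "has_trace ell 0 v w" "has_trace ell ell v (\<lambda>x. 0)"
  shows "summable (\<lambda>k. real k * (ip {0..pi} w (phi k))\<^sup>2)"
proof -
  define c where "c k = ip {0..pi} w (phi k)" for k
  \<comment> \<open>The amplitude makes the profile equal to \<open>c k\<close> at
    \<open>y = 0\<close>. Mode 0 is dropped; its weight is 0 in the sum to be bounded.\<close>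
  define a where "a k = (if k = 0 then 0 else c k / sinh (real k * ell))" for k :: nat
  define \<eta> \<eta>' where "\<eta> k y = a k * sinh (real k * (ell - y)) + 0 * sinh (real k * y)"
    and "\<eta>' k y = - (real k * a k * cosh (real k * (ell - y))) + real k * 0 * cosh (real k * y)" for k y
  have h: "harmonic k (\<eta> k) (\<eta>' k)" for k
  proof (cases "k = 0")
    case True
    then show ?thesis
      using harmonic_linear[of 0 0] by (simp add: \<eta>_def[abs_def] \<eta>'_def[abs_def])
  next
    case False
    then show ?thesis
      unfolding \<eta>_def[abs_def] \<eta>'_def[abs_def] by (intro harmonic_cosh_sinh(2)) simp
  qed
  have s: "smooth_deriv (\<eta> k) (\<eta>' k)" for k
    using h by (auto simp: harmonic_def)
  note wv = H1_imp_wgrad[OF v]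
  have eta: "- \<eta>' k 0 * c k = real k * (c k)\<^sup>2 * coth (real k * ell)"
      "\<eta> k ell * \<eta>' k ell - \<eta> k 0 * \<eta>' k 0 = real k * (c k)\<^sup>2 * coth (real k * ell)" for k
  proof -
    have "sinh (real k * ell) \<noteq> 0" if "k \<noteq> 0"
      using that ell_pos by simp
    then show "- \<eta>' k 0 * c k = real k * (c k)\<^sup>2 * coth (real k * ell)"
      "\<eta> k ell * \<eta>' k ell - \<eta> k 0 * \<eta>' k 0 = real k * (c k)\<^sup>2 * coth (real k * ell)"
      by (cases "k = 0"; simp add: \<eta>_def \<eta>'_def a_def coth_def power2_eq_square)+
  qed
  have coth_ge: "1 \<le> coth (real (Suc k) * ell)" for k
  proof -
    have "sinh (real (Suc k) * ell) > 0"
      using ell_pos by simp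
    then show ?thesis
      using sinh_le_cosh_real[of "real (Suc k) * ell"] unfolding coth_def by simp
  qed
  have bound: "(\<Sum>k<n. real k * (c k)\<^sup>2) \<le> dirichlet_form \<Omega> v v" for n
  proof -
    let ?V = "\<lambda>z. \<Sum>k<n. sep k (\<eta> k) z"
    \<comment> \<open>The form of \<open>?V\<close> with \<open>v\<close> and that of
      \<open>?V\<close> with itself both equal \<open>T\<close>, so Cauchy-Schwarz reads
      \<open>T\<^sup>2 \<le> T * dirichlet_form \<Omega> v v\<close>. Since \<open>coth\<close> is
      at least 1, \<open>T\<close> dominates the sum to be bounded.\<close>
    define T where "T = (\<Sum>k<n. real k * (c k)\<^sup>2 * coth (real k * ell))"
    have VH: "?V \<in> H1 \<Omega>"
      by (rule wgrad_imp_H1[OF wgrad_sum[OF wgrad_sep[OF s]]])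
    have 1: "dirichlet_form \<Omega> ?V v = T"
      unfolding dirichlet_sep_sum[OF wv s] dirichlet_harmonic[OF tr wv h] T_def c_def[symmetric] eta ..
    have 2: "dirichlet_form \<Omega> ?V ?V = T"
      unfolding T_def by (subst dirichlet_sep_sum_self[OF _ h]) (simp_all only: eta finite_lessThan)
    have le: "real k * (c k)\<^sup>2 \<le> real k * (c k)\<^sup>2 * coth (real k * ell)" for k
    proof (cases k)
      case (Suc j)
      then show ?thesis
        using mult_left_mono[OF coth_ge[of j], of "real k * (c k)\<^sup>2"] by simp
    qed simp
    then have "0 \<le> T"
      unfolding T_def by (intro sum_nonneg order_trans[OF _ le]) simp
    have "T * T \<le> T * dirichlet_form \<Omega> v v"
      using dirichlet_form_Cauchy_Schwarz[OF VH v] unfolding 1 2 by (simp add: power2_eq_square)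
    moreover have "0 \<le> dirichlet_form \<Omega> v v"
      by (simp add: wgrad_dirichlet_form[OF wv wv])
    ultimately have "T \<le> dirichlet_form \<Omega> v v"
      using \<open>0 \<le> T\<close> by (cases "T = 0") (auto simp: mult_le_cancel_left)
    moreover have "(\<Sum>k<n. real k * (c k)\<^sup>2) \<le> T"
      unfolding T_def by (intro sum_mono le)
    ultimately show ?thesis
      by linarith
  qed
  show ?thesis
    unfolding c_def[symmetric] by (rule summableI_nonneg_bounded[OF _ bound]) simp
qed

end

section \<open>The Cauchy problem\<close>

lemma psi0_bottom: "psi0 ell k (x, 0) = phi k x"
  by (simp add: psi0_def phi_def cn_def)

lemma f_coeff_eq: "f_coeff ell f0 k = ip {0..pi} f0 (phi k)"
  by (simp add: f_coeff_def ip_def psi0_bottom)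

lemma g_coeff_eq: "g_coeff ell g0 k = g0 (phi k)"
  by (simp add: g_coeff_def psi0_bottom)

lemma suminf_bounds:
  fixes a b :: "nat \<Rightarrow> real"
  assumes b: "summable b" and le: "\<And>k. c * b k \<le> a k" "\<And>k. a k \<le> d * b k" and a: "summable a"
  shows "c * suminf b \<le> suminf a" "suminf a \<le> d * suminf b"
  using suminf_le[OF le(1) summable_mult[OF b] a] suminf_le[OF le(2) a summable_mult[OF b]]
  by (simp_all add: suminf_mult[OF b])

context rectangle
begin

lemma H1_norm_cong_AE:
  assumes "u \<in> H1 \<Omega>" "v \<in> H1 \<Omega>" "AE z in lebesgue_on \<Omega>. u z = v z"
  shows "H1_norm \<Omega> u = H1_norm \<Omega> v"
proof -
  note wu = H1_imp_wgrad[OF assms(1)] and wv = H1_imp_wgrad[OF assms(2)]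
  note eq = wgrad_unique[OF wu wv assms(3)]
  show ?thesis
    unfolding wgrad_H1_norm[OF wu] wgrad_H1_norm[OF wv]
    using ip_cong_AE[OF assms(3) assms(3)] ip_cong_AE[OF eq(1) eq(1)] ip_cong_AE[OF eq(2) eq(2)]
      wgradD[OF wu] wgradD[OF wv] by simp
qed

lemma coth_le: "k \<ge> 1 \<Longrightarrow> coth (real k * ell) \<le> coth ell"
proof -
  assume "k \<ge> 1"
  then have "ell \<le> real k * ell"
    using ell_pos by simp
  then have "tanh ell \<le> tanh (real k * ell)" "0 < tanh ell"
    using ell_pos by simp_all
  then have "1 / tanh (real k * ell) \<le> 1 / tanh ell"
    by (intro divide_left_mono mult_pos_pos) auto
  then show ?thesis
    by (simp add: coth_def tanh_def)
qed

lemma tanh_bounds: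
  assumes "k \<ge> 1"
  shows "tanh ell \<le> tanh (real k * ell)" "tanh (real k * ell) \<le> 1" "0 < tanh ell"
proof -
  have "ell \<le> real k * ell"
    using ell_pos assms by simp
  then show "tanh ell \<le> tanh (real k * ell)" "0 < tanh ell"
    using ell_pos by simp_all
  show "tanh (real k * ell) \<le> 1"
    using tanh_real_lt_1[of "real k * ell"] by simp
qed

end

section \<open>Mode profiles determined by the Cauchy data and existence of a solution\<close>

locale cauchy_data = rectangle +
  fixes f0 :: "real \<Rightarrow> real" and g0 :: "(real \<Rightarrow> real) \<Rightarrow> real"
  assumes f0: "f0 \<in> H_half {0..pi}" and g0: "g0 \<in> H_minus_half {0..pi}"
begin

abbreviation f :: "nat \<Rightarrow> real" where "f \<equiv> f_coeff ell f0"
abbreviation g :: "nat \<Rightarrow> real" where "g \<equiv> g_coeff ell g0"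
abbreviation d :: "nat \<Rightarrow> real" where "d \<equiv> defect ell f0 g0"
abbreviation C :: "nat \<Rightarrow> real" where "C k \<equiv> cosh (real k * ell)"
abbreviation S :: "nat \<Rightarrow> real" where "S k \<equiv> sinh (real k * ell)"

lemma S_pos: "k \<ge> 1 \<Longrightarrow> S k > 0"
  using ell_pos by simp

lemma f0_L2: "f0 \<in> L2 {0..pi}"
  using f0 by (simp add: H_half_def)

lemma f_summable: "summable (\<lambda>k. real k * (f k)\<^sup>2)"
  unfolding f_coeff_eq by (rule H_half_summable[OF f0])

lemma g_eq_defect: "k \<ge> 1 \<Longrightarrow> g k = (f k - d k) * S k * real k / C k"
  using S_pos[of k] ell_pos by (simp add: defect_def coth_def)

text \<open>For \<open>k \<ge> 1\<close> this solves the flux condition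
  \<open>- k f tanh (k ell) + k \<beta> / sinh (k ell) = - g\<close> of the \<open>k\<close>-th
  mode.\<close>

definition \<beta> :: "nat \<Rightarrow> real" where "\<beta> k = (S k)\<^sup>2 / C k * d k"

text \<open>The solution of \<open>\<eta>'' = k\<^sup>2 \<eta>\<close> with initial values
  \<open>f k\<close> and \<open>- g k\<close> at \<open>y = 0\<close>, written in the basis that the
  solution formula uses; for \<open>k = 0\<close> it is linear.\<close>

definition prof :: "nat \<Rightarrow> real \<Rightarrow> real" where
  "prof k y = (if k = 0 then f 0 - g 0 * y
    else f k / C k * cosh (real k * (ell - y)) + \<beta> k / S k * sinh (real k * y))"

definition prof' :: "nat \<Rightarrow> real \<Rightarrow> real" where
  "prof' k y = (if k = 0 then - g 0
    else - (real k * (f k / C k) * sinh (real k * (ell - y))) + real k * (\<beta> k / S k) * cosh (real k * y))"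

lemma prof_harmonic: "harmonic k (prof k) (prof' k)"
proof (cases "k = 0")
  case True
  then show ?thesis
    using harmonic_linear[of "f 0" "g 0"] by (simp add: prof_def[abs_def] prof'_def[abs_def])
next
  case False
  then show ?thesis
    using harmonic_cosh_sinh(1)[of k "f k / C k" "\<beta> k / S k"]
    by (simp add: prof_def[abs_def] prof'_def[abs_def])
qed

lemma prof_smooth: "smooth_deriv (prof k) (prof' k)"
  using prof_harmonic by (simp add: harmonic_def)

lemma prof_0: "prof k 0 = f k"
  by (simp add: prof_def)

lemma prof'_0: "prof' k 0 = - g k"
proof (cases "k = 0")
  case False
  then have "S k \<noteq> 0"
    using ell_pos by simp
  then show ?thesis
    using False g_eq_defect[of k] by (simp add: prof'_def \<beta>_def field_simps power2_eq_square)
qed (simp add: prof'_def)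

text \<open>Expressing \<open>g k\<close> through \<open>f k\<close> and \<open>d k\<close> makes
  the mixed terms \<open>f k * d k\<close> from the two ends cancel, which leaves a sum of
  squares.\<close>

lemma prof_energy:
  assumes k: "k \<ge> 1"
  shows "prof k ell * prof' k ell - prof k 0 * prof' k 0
    = tanh (real k * ell) * (real k * (f k)\<^sup>2 + compat_term ell f0 g0 k)"
proof -
  have S: "S k \<noteq> 0" and C: "C k \<noteq> 0"
    using k ell_pos by simp_all
  have 1: "prof k ell = (f k + (S k)\<^sup>2 * d k) / C k" "prof' k ell = real k * S k * d k"
    using k S C by (simp_all add: prof_def prof'_def \<beta>_def field_simps power2_eq_square)
  show ?thesis
    unfolding prof_0 prof'_0 1 g_eq_defect[OF k] compat_term_def tanh_def
    using C by (simp add: field_simps power2_eq_square)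
qed

lemma prof_h1energy:
  assumes k: "k \<ge> 1"
  shows "tanh ell * (real k * (f k)\<^sup>2 + compat_term ell f0 g0 k) \<le> h1energy k (prof k) (prof' k)"
    "h1energy k (prof k) (prof' k) \<le> 2 * (real k * (f k)\<^sup>2 + compat_term ell f0 g0 k)"
proof -
  let ?X = "real k * (f k)\<^sup>2 + compat_term ell f0 g0 k"
  have X: "0 \<le> ?X"
    by (simp add: compat_term_def)
  have "tanh ell * ?X \<le> tanh (real k * ell) * ?X" "tanh (real k * ell) * ?X \<le> 1 * ?X"
    using X tanh_bounds[OF k] by (intro mult_right_mono; simp)+
  then show "tanh ell * ?X \<le> h1energy k (prof k) (prof' k)" "h1energy k (prof k) (prof' k) \<le> 2 * ?X"
    using h1energy_bounds[OF prof_harmonic k] unfolding prof_energy[OF k] by simp_all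
qed

lemma X_summable:
  assumes "compatible ell f0 g0"
  shows "summable (\<lambda>j. real (Suc j) * (f (Suc j))\<^sup>2 + compat_term ell f0 g0 (Suc j))"
  using assms f_summable unfolding compatible_def
  by (intro summable_add) (simp_all only: summable_Suc_iff[of "\<lambda>k. real k * (f k)\<^sup>2"])

lemma prof_summable:
  assumes "compatible ell f0 g0"
  shows "summable (\<lambda>k. h1energy k (prof k) (prof' k))"
proof -
  have "summable (\<lambda>j. h1energy (Suc j) (prof (Suc j)) (prof' (Suc j)))"
  proof (rule summable_comparison_test'[OF summable_mult[OF X_summable[OF assms], of 2]])
    show "norm (h1energy (Suc j) (prof (Suc j)) (prof' (Suc j)))
        \<le> 2 * (real (Suc j) * (f (Suc j))\<^sup>2 + compat_term ell f0 g0 (Suc j))" for j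
      using prof_h1energy(2)[of "Suc j"] h1energy_nonneg[OF prof_smooth, of "Suc j" "Suc j"] by simp
  qed
  then show ?thesis
    using summable_Suc_iff[of "\<lambda>k. h1energy k (prof k) (prof' k)"] by simp
qed

text \<open>The partial sums of the mode series serve as the smooth approximants required by
  \<open>has_trace\<close>, since on \<open>y = 0\<close> they are the Fourier sums of
  \<open>f0\<close>. In the weak equation they produce the Fourier sums of \<open>g0 w\<close>,
  which converge because the coefficients of a trace are summable with weight
  \<open>k\<close>.\<close>

lemma solution_existence:
  assumes comp: "compatible ell f0 g0"
  shows "\<exists>u. cauchy_solution ell f0 g0 u \<and> L2lim \<Omega> (\<lambda>n z. \<Sum>k<n. sep k (prof k) z) u \<and>
    (H1_norm \<Omega> u)\<^sup>2 = (\<Sum>k. h1energy k (prof k) (prof' k))"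
proof -
  let ?T = "\<lambda>n z. \<Sum>k<n. sep k (prof k) z"
  from sep_series[where \<kappa> = "\<lambda>k. k", OF inj_on_id[of UNIV, unfolded id_def] prof_smooth prof_summable[OF comp]]
  obtain u p q where u: "wgrad \<Omega> u p q" and T: "L2lim \<Omega> ?T u"
    and P: "L2lim \<Omega> (\<lambda>n z. \<Sum>k<n. dsep k (prof k) z) p" and Q: "L2lim \<Omega> (\<lambda>n z. \<Sum>k<n. sep k (prof' k) z) q"
    and norm: "(H1_norm \<Omega> u)\<^sup>2 = (\<Sum>k. h1energy k (prof k) (prof' k))"
    by auto
  have Tw: "wgrad \<Omega> (?T n) (\<lambda>z. \<Sum>k<n. dsep k (prof k) z) (\<lambda>z. \<Sum>k<n. sep k (prof' k) z)" for n
    by (intro wgrad_sum wgrad_sep prof_smooth)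
  have "has_trace ell 0 u f0"
    unfolding has_trace_def
  proof (intro conjI exI[of _ ?T] allI)
    show "smooth (?T n)" for n
      by (intro smooth_sum smooth_sep smooth_derivD[OF prof_smooth])
    show "(\<lambda>n. H1_norm \<Omega> (\<lambda>z. ?T n z - u z)) \<longlonglongrightarrow> 0"
      using H1_norm_tendsto_0[OF Tw u] T P Q by simp
    have "L2lim {0..pi} (\<lambda>n x. ?T n (x, 0)) f0"
      using Fourier_cos_converges[OF f0_L2] by (simp add: sep_slice prof_0 f_coeff_eq mult.commute)
    then show "(\<lambda>n. LINT x|lebesgue_on {0..pi}. (?T n (x, 0) - f0 x)\<^sup>2) \<longlonglongrightarrow> 0"
      by (rule L2lim_power2)
  qed (rule f0_L2)
  moreover have "dirichlet_form \<Omega> u v = g0 w"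
    if v: "v \<in> H1 \<Omega>" and tr: "has_trace ell 0 v w" "has_trace ell ell v (\<lambda>x. 0)" for v w
  proof -
    note wv = H1_imp_wgrad[OF v]
    have w: "w \<in> L2 {0..pi}"
      using tr(1) by (simp add: has_trace_def)
    have "(\<lambda>n. dirichlet_form \<Omega> (?T n) v) \<longlonglongrightarrow> dirichlet_form \<Omega> u v"
      unfolding wgrad_dirichlet_form[OF Tw wv] wgrad_dirichlet_form[OF u wv]
      by (intro tendsto_add L2lim_ip P Q L2lim_const wgradD[OF wv])
    moreover have "dirichlet_form \<Omega> (?T n) v = (\<Sum>k<n. ip {0..pi} w (phi k) * g0 (phi k))" for n
      unfolding dirichlet_sep_sum[OF wv prof_smooth] dirichlet_harmonic[OF tr wv prof_harmonic] prof'_0 g_coeff_eq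
      by (simp add: mult.commute)
    moreover have "(\<lambda>n. \<Sum>k<n. ip {0..pi} w (phi k) * g0 (phi k)) \<longlonglongrightarrow> g0 w"
      by (rule H_minus_half_Fourier[OF g0 w trace_Fourier_summable[OF v tr]])
    ultimately show ?thesis
      by (intro LIMSEQ_unique) simp_all
  qed
  ultimately have "cauchy_solution ell f0 g0 u"
    unfolding cauchy_solution_def using wgrad_imp_H1[OF u] by blast
  with T norm show ?thesis
    by blast
qed

section \<open>Consequences of the weak equation for an arbitrary solution\<close>

lemma solutionD:
  assumes "cauchy_solution ell f0 g0 u"
  shows "u \<in> H1 \<Omega>" "has_trace ell 0 u f0"
  using assms by (auto simp: cauchy_solution_def)

lemma solution_test:
  assumes u: "cauchy_solution ell f0 g0 u" and w: "wgrad \<Omega> u p q"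
    and s: "smooth_deriv \<eta> \<eta>'" and zero: "\<eta> ell = 0"
  shows "ip \<Omega> p (dsep k \<eta>) + ip \<Omega> q (sep k \<eta>') = \<eta> 0 * g k"
proof -
  have sm: "smooth (sep k \<eta>)"
    by (rule smooth_sep[OF smooth_derivD(1)[OF s]])
  have "(\<lambda>x. sep k \<eta> (x, 0)) = (\<lambda>x. \<eta> 0 * phi k x)" "(\<lambda>x. sep k \<eta> (x, ell)) = (\<lambda>x. 0)"
    by (simp_all add: sep_slice zero mult.commute)
  then have tr: "has_trace ell 0 (sep k \<eta>) (\<lambda>x. \<eta> 0 * phi k x)" "has_trace ell ell (sep k \<eta>) (\<lambda>x. 0)"
    using has_trace_smooth[OF sm, of 0] has_trace_smooth[OF sm, of ell] by simp_all
  have "dirichlet_form \<Omega> u (sep k \<eta>) = g0 (\<lambda>x. \<eta> 0 * phi k x)"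
    using u tr wgrad_imp_H1[OF wgrad_sep[OF s]] unfolding cauchy_solution_def by blast
  then show ?thesis
    unfolding wgrad_dirichlet_form[OF w wgrad_sep[OF s]] H_minus_half_scale[OF g0 phi_H_half] g_coeff_eq .
qed

text \<open>Green's second identity. The double zero at \<open>ell\<close> eliminates the unknown
  value and flux on the top side, so the moment is determined by the Cauchy data.\<close>

lemma solution_moment:
  assumes u: "cauchy_solution ell f0 g0 u"
    and s: "smooth_deriv \<eta> \<eta>'" "smooth_deriv \<eta>' \<eta>''" and zero: "\<eta> ell = 0" "\<eta>' ell = 0"
  shows "ip \<Omega> u (sep k (\<lambda>y. \<eta>'' y - (real k)\<^sup>2 * \<eta> y)) = - \<eta>' 0 * f k - \<eta> 0 * g k"
proof -
  note w = H1_imp_wgrad[OF solutionD(1)[OF u]]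
  have "sep k (\<lambda>y. \<eta>'' y - (real k)\<^sup>2 * \<eta> y) = (\<lambda>z. sep k \<eta>'' z - (real k)\<^sup>2 * sep k \<eta> z)"
    by (rule ext) (simp add: sep_def right_diff_distrib)
  then have "ip \<Omega> u (sep k (\<lambda>y. \<eta>'' y - (real k)\<^sup>2 * \<eta> y)) = ip \<Omega> u (sep k \<eta>'') - (real k)\<^sup>2 * ip \<Omega> u (sep k \<eta>)"
    by (simp add: ip_diff_right ip_scale_right L2_scale L2_Omega_smooth smooth_sep smooth_derivD[OF s(1)]
        smooth_derivD[OF s(2)] wgradD[OF w])
  with solution_test[OF u w s(1) zero(1), of k] trace_dsep[OF solutionD(2)[OF u] w smooth_derivD(1)[OF s(1)], of k]
    trace_sep0[OF solutionD(2)[OF u] w s(2) zero(2), of k]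
  show ?thesis
    by (simp add: f_coeff_eq)
qed

text \<open>For each pair of frequencies the adjoint equation
  \<open>\<eta>'' - k\<^sup>2 \<eta> = c cos (\<mu> y)\<close> is solved explicitly with a double
  zero at \<open>ell\<close>; \<open>solution_moment\<close> then gives both solutions the same
  cosine moments.\<close>

lemma solution_unique:
  assumes u: "cauchy_solution ell f0 g0 u" and v: "cauchy_solution ell f0 g0 v"
  shows "AE z in lebesgue_on \<Omega>. u z = v z"
proof -
  have L2: "u \<in> L2 \<Omega>" "v \<in> L2 \<Omega>"
    using solutionD(1)[OF u] solutionD(1)[OF v] by (auto simp: H1_def)
  have "AE z in lebesgue_on \<Omega>. u z - v z = 0"
  proof (rule cos_complete_rectangle[OF ell_pos])
    fix k j :: nat
    define \<mu> where "\<mu> = real j * (pi / ell)"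
    have "\<exists>\<eta> \<eta>' \<eta>'' c. smooth_deriv \<eta> \<eta>' \<and> smooth_deriv \<eta>' \<eta>'' \<and> \<eta> ell = 0 \<and> \<eta>' ell = 0 \<and> c \<noteq> 0 \<and>
        (\<lambda>y. \<eta>'' y - (real k)\<^sup>2 * \<eta> y) = (\<lambda>y. c * cos (\<mu> * y))"
    proof (cases "k = 0 \<and> j = 0")
      case True
      \<comment> \<open>For two zero frequencies the general profile below would give
        \<open>c = 0\<close>; the parabola with vertex at \<open>ell\<close> takes its
        place.\<close>
      have "smooth (\<lambda>z::real \<times> real. (1/2) * ((1 * snd z + (- ell)) * (1 * snd z + (- ell))))"
        by (intro smooth_cmult smooth_mult smooth_snd)
      then have "smooth_deriv (\<lambda>y. (1/2) * ((y - ell) * (y - ell))) (\<lambda>y. y - ell)"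
        unfolding smooth_deriv_def by (auto intro!: derivative_eq_intros)
      moreover have "smooth_deriv (\<lambda>y. y - ell) (\<lambda>y. 1)"
        using smooth_deriv_linear[of 1 "- ell"] by simp
      ultimately show ?thesis
        using True by (intro exI[of _ "\<lambda>y. (1/2) * ((y - ell) * (y - ell))"] exI[of _ "\<lambda>y. y - ell"]
            exI[of _ "\<lambda>y. 1"] exI[of _ 1]) (simp add: \<mu>_def)
    next
      case False
      let ?k = "real k"
      \<comment> \<open>Subtracting \<open>A\<close> times \<open>cosh (k (ell - y))\<close>, which
        the operator annihilates, cancels the value at \<open>ell\<close>. The slope vanishes there
        as well because \<open>\<mu> * ell\<close> is a multiple of \<open>pi\<close>.\<close>
      define A where "A = cos (\<mu> * ell)"
      define \<eta> \<eta>' \<eta>'' where "\<eta> y = cos (\<mu> * y) - A * cosh ((- ?k) * y + ?k * ell)"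
        and "\<eta>' y = - \<mu> * sin (\<mu> * y) - A * ((- ?k) * sinh ((- ?k) * y + ?k * ell))"
        and "\<eta>'' y = - \<mu> * (\<mu> * cos (\<mu> * y)) - A * ((- ?k) * ((- ?k) * cosh ((- ?k) * y + ?k * ell)))" for y
      have "smooth_deriv \<eta> \<eta>'" "smooth_deriv \<eta>' \<eta>''"
        unfolding \<eta>_def[abs_def] \<eta>'_def[abs_def] \<eta>''_def[abs_def]
        by (intro smooth_deriv_diff smooth_deriv_cmult smooth_deriv_cos smooth_deriv_sin smooth_deriv_cosh smooth_deriv_sinh)+
      moreover have "\<mu> * ell = real j * pi"
        using ell_pos by (simp add: \<mu>_def)
      then have "\<eta> ell = 0" "\<eta>' ell = 0"
        by (simp_all add: \<eta>_def \<eta>'_def A_def)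
      moreover have "\<eta>'' y - ?k\<^sup>2 * \<eta> y = (- (\<mu>\<^sup>2 + ?k\<^sup>2)) * cos (\<mu> * y)" for y
        by (simp add: \<eta>_def \<eta>''_def power2_eq_square algebra_simps)
      moreover have "\<mu> \<noteq> 0 \<or> ?k \<noteq> 0"
        using False ell_pos by (auto simp: \<mu>_def)
      then have "0 < \<mu>\<^sup>2 + ?k\<^sup>2"
        by (simp only: sum_power2_gt_zero_iff)
      then have "- (\<mu>\<^sup>2 + ?k\<^sup>2) \<noteq> 0"
        by linarith
      ultimately show ?thesis
        by (intro exI[of _ \<eta>] exI[of _ \<eta>'] exI[of _ \<eta>''] exI[of _ "- (\<mu>\<^sup>2 + ?k\<^sup>2)"]) simp
    qed
    then obtain \<eta> \<eta>' \<eta>'' c where s: "smooth_deriv \<eta> \<eta>'" "smooth_deriv \<eta>' \<eta>''"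
      and zero: "\<eta> ell = 0" "\<eta>' ell = 0" and c: "c \<noteq> 0"
      and ode: "(\<lambda>y. \<eta>'' y - (real k)\<^sup>2 * \<eta> y) = (\<lambda>y. c * cos (\<mu> * y))"
      by blast
    have "ip \<Omega> u (sep k (\<lambda>y. c * cos (\<mu> * y))) = ip \<Omega> v (sep k (\<lambda>y. c * cos (\<mu> * y)))"
      unfolding ode[symmetric] solution_moment[OF u s zero] solution_moment[OF v s zero] ..
    then have "ip \<Omega> u (sep k (\<lambda>y. cos (\<mu> * y))) = ip \<Omega> v (sep k (\<lambda>y. cos (\<mu> * y)))"
      using c by (simp add: sep_scale ip_scale_right)
    moreover have "sep k (\<lambda>y. cos (\<mu> * y)) = (\<lambda>z. cn k * (case z of (x, y) \<Rightarrow> cos (real k * x) * cos (real j * (pi / ell * y))))"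
      by (rule ext) (auto simp: sep_def \<mu>_def mult.assoc)
    ultimately have "ip \<Omega> u (\<lambda>(x, y). cos (real k * x) * cos (real j * (pi / ell * y)))
        = ip \<Omega> v (\<lambda>(x, y). cos (real k * x) * cos (real j * (pi / ell * y)))"
      by (simp add: ip_scale_right cn_nonzero)
    moreover have "continuous_on UNIV (\<lambda>z::real \<times> real. case z of (x, y) \<Rightarrow> cos (real k * x) * cos (real j * (pi / ell * y)))"
      using ell_pos unfolding case_prod_unfold by (intro continuous_intros) auto
    ultimately show "ip \<Omega> (\<lambda>z. u z - v z) (\<lambda>(x, y). cos (real k * x) * cos (real j * (pi / ell * y))) = 0"
      by (simp add: ip_diff_left L2 L2_Omega_continuous)
  qed (intro L2_diff L2)
  then show ?thesis
    by simp
qed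

text \<open>The growing mode \<open>sinh (k y)\<close> does not vanish on \<open>y = ell\<close>. Its gradient is split into the
  gradient of the decaying mode \<open>\<eta>\<close>, a legitimate test function, and a remainder whose vertical
  component vanishes on \<open>y = ell\<close> and so can be integrated by parts with the Dirichlet datum.\<close>

lemma solution_growing_mode:
  assumes u: "cauchy_solution ell f0 g0 u" and w: "wgrad \<Omega> u p q" and k: "k \<ge> 1"
  shows "ip \<Omega> p (dsep k (\<lambda>y. sinh (real k * y))) + ip \<Omega> q (sep k (\<lambda>y. real k * cosh (real k * y)))
    = real k * (S k)\<^sup>2 * d k"
proof -
  let ?k = "real k"
  \<comment> \<open>The factor \<open>- C k\<close> makes the vertical derivatives of
    \<open>\<eta>\<close> and of the growing mode agree at \<open>ell\<close>, so that their
    difference \<open>\<zeta>\<close> vanishes there.\<close>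
  define \<eta> \<eta>' where "\<eta> y = - C k * sinh ((- ?k) * y + ?k * ell)"
    and "\<eta>' y = - C k * ((- ?k) * cosh ((- ?k) * y + ?k * ell))" for y
  define \<zeta> \<theta> where "\<zeta> y = ?k * cosh (?k * y + 0) - \<eta>' y" and "\<theta> y = sinh (?k * y + 0) - \<eta> y" for y
  have s: "smooth_deriv \<eta> \<eta>'"
    unfolding \<eta>_def[abs_def] \<eta>'_def[abs_def] by (intro smooth_deriv_cmult smooth_deriv_sinh)
  have t: "smooth_deriv \<theta> (\<lambda>y. ?k * cosh (?k * y + 0) - \<eta>' y)"
    unfolding \<theta>_def[abs_def] by (intro smooth_deriv_diff smooth_deriv_sinh s)
  have "smooth_deriv \<zeta> (\<lambda>y. ?k * (?k * sinh (?k * y + 0)) - (- C k) * ((- ?k) * ((- ?k) * sinh ((- ?k) * y + ?k * ell))))"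
    unfolding \<zeta>_def[abs_def] \<eta>'_def[abs_def] by (intro smooth_deriv_diff smooth_deriv_cmult smooth_deriv_cosh)
  moreover have "?k * (?k * sinh (?k * y + 0)) - (- C k) * ((- ?k) * ((- ?k) * sinh ((- ?k) * y + ?k * ell))) = ?k\<^sup>2 * \<theta> y" for y
    by (simp add: \<theta>_def \<eta>_def power2_eq_square algebra_simps)
  ultimately have z: "smooth_deriv \<zeta> (\<lambda>y. ?k\<^sup>2 * \<theta> y)"
    by simp
  have "\<eta> ell = 0" "\<zeta> ell = 0"
    by (simp_all add: \<eta>_def \<zeta>_def \<eta>'_def)
  note L2 = L2_Omega_smooth smooth_sep smooth_dsep smooth_derivD[OF s] smooth_derivD[OF t] smooth_derivD[OF z] wgradD[OF w]
  have 1: "ip \<Omega> p (dsep k \<eta>) + ip \<Omega> q (sep k \<eta>') = \<eta> 0 * g k"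
    by (rule solution_test[OF u w s \<open>\<eta> ell = 0\<close>])
  have 2: "ip \<Omega> q (sep k \<zeta>) = - (?k\<^sup>2 * ip \<Omega> u (sep k \<theta>)) - \<zeta> 0 * f k"
    using trace_sep0[OF solutionD(2)[OF u] w z \<open>\<zeta> ell = 0\<close>, of k]
    by (simp add: sep_scale ip_scale_right f_coeff_eq)
  have 3: "ip \<Omega> p (dsep k \<theta>) = ?k\<^sup>2 * ip \<Omega> u (sep k \<theta>)"
    by (rule trace_dsep[OF solutionD(2)[OF u] w smooth_derivD(1)[OF t]])
  have "dsep k (\<lambda>y. sinh (?k * y)) = (\<lambda>z. dsep k \<eta> z + dsep k \<theta> z)"
    unfolding dsep_add[symmetric] by (simp add: \<theta>_def)
  moreover have "sep k (\<lambda>y. ?k * cosh (?k * y)) = (\<lambda>z. sep k \<eta>' z + sep k \<zeta> z)"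
    unfolding sep_add[symmetric] by (simp add: \<zeta>_def)
  ultimately have "ip \<Omega> p (dsep k (\<lambda>y. sinh (?k * y))) + ip \<Omega> q (sep k (\<lambda>y. ?k * cosh (?k * y))) = \<eta> 0 * g k - \<zeta> 0 * f k"
    using 1 2 3 by (simp add: ip_add_right L2)
  also have "\<zeta> 0 = - ?k * (S k)\<^sup>2"
    using hyperbolic_pythagoras[of "?k * ell"]
    by (simp add: \<zeta>_def \<eta>'_def power2_eq_square algebra_simps)
  also have "\<eta> 0 * g k - - ?k * (S k)\<^sup>2 * f k = ?k * (S k)\<^sup>2 * d k"
    using k S_pos[OF k] by (simp add: \<eta>_def defect_def coth_def field_simps power2_eq_square)
  finally show ?thesis .
qed

text \<open>For a finite sum \<open>?V\<close> of growing modes the product with \<open>u\<close> is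
  the partial sum \<open>T\<close> of the compatibility terms, while the energy of \<open>?V\<close>
  is at most \<open>coth ell * T\<close>. Cauchy-Schwarz then bounds \<open>T\<close> by
  \<open>coth ell\<close> times the energy of \<open>u\<close>, uniformly in the number of
  terms.\<close>

lemma solution_imp_compatible:
  assumes u: "cauchy_solution ell f0 g0 u"
  shows "compatible ell f0 g0"
proof -
  note w = H1_imp_wgrad[OF solutionD(1)[OF u]]
  \<comment> \<open>The weight \<open>d k\<close> turns the factor \<open>d k\<close> found in
    \<open>solution_growing_mode\<close> into its square, that is, into a compatibility
    term.\<close>
  let ?\<eta> = "\<lambda>k y. d k * sinh (real k * y)" and ?\<eta>' = "\<lambda>k y. d k * (real k * cosh (real k * y))"
  have h: "harmonic k (?\<eta> k) (?\<eta>' k)" for k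
  proof (cases "k = 0")
    case True
    then show ?thesis
      using harmonic_linear[of 0 0] by simp
  next
    case False
    then show ?thesis
      using harmonic_cosh_sinh(1)[of k 0 "d k"] by (simp add: ac_simps)
  qed
  have s: "smooth_deriv (?\<eta> k) (?\<eta>' k)" for k
    using h by (auto simp: harmonic_def)
  have "(\<Sum>j<n. compat_term ell f0 g0 (Suc j)) \<le> coth ell * dirichlet_form \<Omega> u u" for n
  proof -
    let ?A = "{1..n}"
    let ?V = "\<lambda>z. \<Sum>k\<in>?A. sep k (?\<eta> k) z"
    define T where "T = (\<Sum>k\<in>?A. compat_term ell f0 g0 k)"
    have V: "?V \<in> H1 \<Omega>"
      by (rule wgrad_imp_H1[OF wgrad_sum[OF wgrad_sep[OF s]]])
    have 1: "dirichlet_form \<Omega> ?V u = T"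
      unfolding dirichlet_sep_sum[OF w s] T_def
    proof (rule sum.cong[OF refl])
      fix k assume "k \<in> ?A"
      then have k: "k \<ge> 1" by simp
      show "ip \<Omega> (weak_deriv \<Omega> (1, 0) u) (dsep k (?\<eta> k)) + ip \<Omega> (weak_deriv \<Omega> (0, 1) u) (sep k (?\<eta>' k))
          = compat_term ell f0 g0 k"
        using solution_growing_mode[OF u w k]
        unfolding dsep_scale sep_scale[of k "d k"] ip_scale_right compat_term_def
        by (simp add: power2_eq_square flip: distrib_left)
    qed
    have "dirichlet_form \<Omega> ?V ?V = (\<Sum>k\<in>?A. compat_term ell f0 g0 k * coth (real k * ell))"
    proof (subst dirichlet_sep_sum_self[OF _ h], simp, rule sum.cong[OF refl])
      fix k assume "k \<in> ?A"
      then have "S k \<noteq> 0"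
        using ell_pos by simp
      then show "?\<eta> k ell * ?\<eta>' k ell - ?\<eta> k 0 * ?\<eta>' k 0 = compat_term ell f0 g0 k * coth (real k * ell)"
        by (simp add: compat_term_def coth_def power2_eq_square)
    qed
    also have "\<dots> \<le> (\<Sum>k\<in>?A. compat_term ell f0 g0 k * coth ell)"
      by (intro sum_mono mult_left_mono coth_le) (auto simp: compat_term_def)
    also have "\<dots> = coth ell * T"
      by (simp add: T_def sum_distrib_right[symmetric])
    finally have 2: "dirichlet_form \<Omega> ?V ?V \<le> coth ell * T" .
    have D: "0 \<le> dirichlet_form \<Omega> u u"
      by (simp add: wgrad_dirichlet_form[OF w w])
    have "T * T \<le> dirichlet_form \<Omega> ?V ?V * dirichlet_form \<Omega> u u"
      using dirichlet_form_Cauchy_Schwarz[OF V solutionD(1)[OF u]] unfolding 1 by (simp add: power2_eq_square)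
    also have "\<dots> \<le> (coth ell * T) * dirichlet_form \<Omega> u u"
      by (rule mult_right_mono[OF 2 D])
    finally have *: "T * T \<le> T * (coth ell * dirichlet_form \<Omega> u u)"
      by (simp add: ac_simps)
    have "0 \<le> T"
      unfolding T_def by (intro sum_nonneg) (simp add: compat_term_def)
    moreover have "0 \<le> coth ell"
      using ell_pos by (simp add: coth_def)
    ultimately have "T \<le> coth ell * dirichlet_form \<Omega> u u"
      using * D by (cases "T = 0") (auto simp: mult_le_cancel_left)
    moreover have "T = (\<Sum>j<n. compat_term ell f0 g0 (Suc j))"
      unfolding T_def by (simp add: sum.atLeast1_atMost_eq)
    ultimately show ?thesis
      by simp
  qed
  then show ?thesis
    unfolding compatible_def by (rule summableI_nonneg_bounded[rotated]) (simp add: compat_term_def)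
qed

text \<open>The two parts of each mode converge separately: the \<open>psi0\<close> part by
  summability of \<open>k f\<^sub>k\<^sup>2\<close>, the \<open>psi1\<close> part by compatibility.
  Uniqueness carries the formula from the constructed solution to any \<open>u\<close>.\<close>

lemma solution_series:
  assumes comp: "compatible ell f0 g0" and u: "cauchy_solution ell f0 g0 u"
  shows "\<exists>a b. H1_sums \<Omega> (\<lambda>k z. f k * psi0 ell k z) a \<and>
    H1_sums \<Omega> (\<lambda>j z. (S (Suc j))\<^sup>2 / C (Suc j) * d (Suc j) * psi1 ell (Suc j) z) b \<and>
    (AE z in lebesgue_on \<Omega>. u z = a z - ell * g 0 * psi1 ell 0 z + b z)"
proof -
  define A A' where "A k y = f k / C k * cosh (real k * (ell - y))"
    and "A' k y = - (real k * (f k / C k) * sinh (real k * (ell - y)))" for k y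
  define B B' where "B k y = \<beta> k / S k * sinh (real k * y)"
    and "B' k y = real k * (\<beta> k / S k) * cosh (real k * y)" for k y
  have A_harm: "harmonic k (A k) (A' k)" for k
  proof (cases "k = 0")
    case True
    then show ?thesis
      using harmonic_linear[of "f 0" 0] by (simp add: A_def[abs_def] A'_def[abs_def])
  next
    case False
    then show ?thesis
      using harmonic_cosh_sinh(1)[of k "f k / C k" 0] by (simp add: A_def[abs_def] A'_def[abs_def])
  qed
  have B_harm: "harmonic (Suc j) (B (Suc j)) (B' (Suc j))" for j
    using harmonic_cosh_sinh(1)[of "Suc j" 0 "\<beta> (Suc j) / S (Suc j)"]
    by (simp add: B_def[abs_def] B'_def[abs_def] del: of_nat_Suc)
  have As: "smooth_deriv (A k) (A' k)" and Bs: "smooth_deriv (B (Suc j)) (B' (Suc j))" for k j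
    using A_harm[of k] B_harm[of j] by (simp_all add: harmonic_def)
  have A_sum: "summable (\<lambda>k. h1energy k (A k) (A' k))"
  proof (rule summable_comparison_test'[OF summable_mult[OF f_summable, of 2], of 1])
    fix k :: nat
    assume k: "k \<ge> 1"
    have "A k ell * A' k ell - A k 0 * A' k 0 = tanh (real k * ell) * (real k * (f k)\<^sup>2)"
      by (simp add: A_def A'_def tanh_def power2_eq_square)
    also have "\<dots> \<le> 1 * (real k * (f k)\<^sup>2)"
      by (intro mult_right_mono tanh_bounds[OF k]) simp
    finally show "norm (h1energy k (A k) (A' k)) \<le> 2 * (real k * (f k)\<^sup>2)"
      using h1energy_bounds(2)[OF A_harm k] h1energy_nonneg[OF As, of k k] by simp
  qed
  have B_sum: "summable (\<lambda>j. h1energy (Suc j) (B (Suc j)) (B' (Suc j)))"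
  proof (rule summable_comparison_test'[OF summable_mult[OF comp[unfolded compatible_def], of 2], of 0])
    fix j :: nat
    let ?k = "Suc j"
    have k: "?k \<ge> 1" and S: "S ?k \<noteq> 0"
      using ell_pos by simp_all
    have "B ?k ell * B' ?k ell - B ?k 0 * B' ?k 0 = tanh (real ?k * ell) * compat_term ell f0 g0 ?k"
      using S by (simp add: B_def B'_def \<beta>_def compat_term_def tanh_def field_simps power2_eq_square del: of_nat_Suc)
    also have "\<dots> \<le> 1 * compat_term ell f0 g0 ?k"
      by (intro mult_right_mono tanh_bounds[OF k]) (simp add: compat_term_def)
    finally show "norm (h1energy ?k (B ?k) (B' ?k)) \<le> 2 * compat_term ell f0 g0 ?k"
      using h1energy_bounds(2)[OF B_harm k] h1energy_nonneg[OF Bs, of ?k j] by simp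
  qed
  obtain a pa qa where a: "wgrad \<Omega> a pa qa" "L2lim \<Omega> (\<lambda>n z. \<Sum>k<n. sep k (A k) z) a"
      "L2lim \<Omega> (\<lambda>n z. \<Sum>k<n. dsep k (A k) z) pa" "L2lim \<Omega> (\<lambda>n z. \<Sum>k<n. sep k (A' k) z) qa"
    using sep_series[where \<kappa> = "\<lambda>k. k", OF inj_on_id[of UNIV, unfolded id_def] As A_sum] by blast
  obtain b pb qb where b: "wgrad \<Omega> b pb qb" "L2lim \<Omega> (\<lambda>n z. \<Sum>j<n. sep (Suc j) (B (Suc j)) z) b"
      "L2lim \<Omega> (\<lambda>n z. \<Sum>j<n. dsep (Suc j) (B (Suc j)) z) pb" "L2lim \<Omega> (\<lambda>n z. \<Sum>j<n. sep (Suc j) (B' (Suc j)) z) qb"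
    using sep_series[OF inj_Suc Bs B_sum] by blast
  have Af: "sep k (A k) = (\<lambda>z. f k * psi0 ell k z)" for k
    by (rule ext) (auto simp: sep_def A_def psi0_def cn_def split: prod.splits)
  have Bf: "sep (Suc j) (B (Suc j)) = (\<lambda>z. (S (Suc j))\<^sup>2 / C (Suc j) * d (Suc j) * psi1 ell (Suc j) z)" for j
    by (rule ext) (auto simp: sep_def B_def \<beta>_def psi1_def cn_def ac_simps split: prod.splits)
  have "H1_sums \<Omega> (\<lambda>k z. f k * psi0 ell k z) a"
    using H1_sums_sep[where \<kappa> = "\<lambda>k. k", OF As a] by (simp only: Af)
  moreover have "H1_sums \<Omega> (\<lambda>j z. (S (Suc j))\<^sup>2 / C (Suc j) * d (Suc j) * psi1 ell (Suc j) z) b"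
    using H1_sums_sep[where \<kappa> = Suc, OF Bs b] by (simp only: Bf)
  moreover have "AE z in lebesgue_on \<Omega>. u z = a z - ell * g 0 * psi1 ell 0 z + b z"
  proof -
    let ?m = "sep 0 (\<lambda>y. g 0 * y)"
    obtain s where s: "cauchy_solution ell f0 g0 s" "L2lim \<Omega> (\<lambda>n z. \<Sum>k<n. sep k (prof k) z) s"
      using solution_existence[OF comp] by blast
    have m: "?m z = ell * g 0 * psi1 ell 0 z" for z
      using ell_pos by (auto simp: sep_def cn_def psi1_def split: prod.splits)
    have m_L2: "?m \<in> L2 \<Omega>"
      using smooth_deriv_linear[of "g 0" 0] by (intro L2_Omega_smooth smooth_sep) (auto dest: smooth_derivD(1))
    \<comment> \<open>The linear term of mode 0 is split off, so the second sum starts at frequency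
      1 and has one summand fewer.\<close>
    have split: "(\<Sum>k<Suc n. sep k (prof k) z) = (\<Sum>k<Suc n. sep k (A k) z) - ?m z + (\<Sum>j<n. sep (Suc j) (B (Suc j)) z)" for n z
    proof -
      have "sep 0 (prof 0) z = sep 0 (A 0) z - ?m z"
        by (simp add: sep_def prof_def A_def algebra_simps)
      moreover have "sep (Suc j) (prof (Suc j)) z = sep (Suc j) (A (Suc j)) z + sep (Suc j) (B (Suc j)) z" for j
        by (simp add: sep_def prof_def A_def B_def algebra_simps)
      ultimately show ?thesis
        unfolding sum.lessThan_Suc_shift by (simp add: sum.distrib)
    qed
    have "L2lim \<Omega> (\<lambda>n z. \<Sum>k<Suc n. sep k (prof k) z) (\<lambda>z. a z - ?m z + b z)"
      unfolding split by (intro L2lim_add L2lim_diff L2lim_Suc[OF a(2)] L2lim_const m_L2 b(2))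
    from L2lim_unique[OF L2lim_Suc[OF s(2)] this] solution_unique[OF u s(1)]
    show ?thesis
      by eventually_elim (simp add: m)
  qed
  ultimately show ?thesis
    by blast
qed

section \<open>Mode 0 and the norm equivalence\<close>

lemma h1energy_0: "h1energy 0 (prof 0) (prof' 0) = (f 0)\<^sup>2 * ell - f 0 * g 0 * ell\<^sup>2 + (g 0)\<^sup>2 * ell ^ 3 / 3 + (g 0)\<^sup>2 * ell"
proof -
  let ?F = "\<lambda>y. (f 0)\<^sup>2 * y - f 0 * g 0 * y\<^sup>2 + (g 0)\<^sup>2 * y ^ 3 / 3"
  have "((\<lambda>y. (f 0 - g 0 * y) * (f 0 - g 0 * y)) has_integral ?F ell - ?F 0) {0..ell}"
    using ell_pos
    by (intro fundamental_theorem_of_calculus[where f = ?F])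
      (auto intro!: derivative_eq_intros simp: power2_eq_square algebra_simps simp flip: has_real_derivative_iff_has_vector_derivative)
  then have "I (prof 0) (prof 0) = ?F ell"
    by (simp add: I_def prof_def integral_unique)
  moreover have "I (prof' 0) (prof' 0) = (g 0)\<^sup>2 * ell"
    using ell_pos by (simp add: I_def prof'_def power2_eq_square)
  ultimately show ?thesis
    by (simp add: h1energy_def)
qed

text \<open>Mode 0 is linear rather than hyperbolic, so its energy is estimated directly as a
  quadratic form in \<open>f 0\<close> and \<open>g 0\<close>: completing the square shows that it
  is positive definite.\<close>

lemma h1energy_0_bounds:
  "(f 0)\<^sup>2 + (g 0)\<^sup>2 \<le> (3 / ell + ell / 2) * h1energy 0 (prof 0) (prof' 0)"
  "h1energy 0 (prof 0) (prof' 0) \<le> (2 * ell + ell ^ 3) * ((f 0)\<^sup>2 + (g 0)\<^sup>2)"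
proof -
  define Q where "Q = h1energy 0 (prof 0) (prof' 0)"
  \<comment> \<open>The mean of the linear profile over \<open>(0, ell)\<close>; expanding around it
    removes the mixed term.\<close>
  define r where "r = f 0 - g 0 * ell / 2"
  have Q: "Q = ell * r\<^sup>2 + (g 0)\<^sup>2 * ell ^ 3 / 12 + (g 0)\<^sup>2 * ell"
    unfolding Q_def h1energy_0 r_def by (simp add: power2_eq_square power3_eq_cube field_simps)
  have "0 \<le> (g 0)\<^sup>2 * ell ^ 3" "0 \<le> ell * r\<^sup>2" "0 \<le> (g 0)\<^sup>2 * ell"
    using ell_pos by simp_all
  then have "ell * r\<^sup>2 \<le> Q" "(g 0)\<^sup>2 * ell \<le> Q"
    unfolding Q by linarith+
  then have r: "r\<^sup>2 \<le> Q / ell" and gQ: "(g 0)\<^sup>2 \<le> Q / ell"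
    using ell_pos by (simp_all add: field_simps)
  have "(f 0)\<^sup>2 \<le> 2 * r\<^sup>2 + 2 * (g 0 * ell / 2)\<^sup>2"
    using zero_le_power2[of "r - g 0 * ell / 2"] unfolding r_def by (simp add: power2_eq_square algebra_simps)
  then have "(f 0)\<^sup>2 + (g 0)\<^sup>2 \<le> 2 * r\<^sup>2 + (1 + ell\<^sup>2 / 2) * (g 0)\<^sup>2"
    by (simp add: power_mult_distrib power_divide field_simps)
  also have "\<dots> \<le> 2 * (Q / ell) + (1 + ell\<^sup>2 / 2) * (Q / ell)"
    by (intro add_mono mult_left_mono r gQ) auto
  also have "\<dots> = (3 / ell + ell / 2) * Q"
    using ell_pos by (simp add: field_simps power2_eq_square)
  finally show "(f 0)\<^sup>2 + (g 0)\<^sup>2 \<le> (3 / ell + ell / 2) * h1energy 0 (prof 0) (prof' 0)"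
    by (simp add: Q_def)
  have "0 \<le> ell * (f 0 + g 0 * ell)\<^sup>2"
    using ell_pos by simp
  then have "- (f 0 * g 0 * ell\<^sup>2) \<le> ((f 0)\<^sup>2 * ell + (g 0)\<^sup>2 * ell ^ 3) / 2"
    by (simp add: power2_eq_square power3_eq_cube field_simps)
  moreover have "0 \<le> (f 0)\<^sup>2 * ell" "0 \<le> (g 0)\<^sup>2 * ell" "0 \<le> (f 0)\<^sup>2 * ell ^ 3" "0 \<le> (g 0)\<^sup>2 * ell ^ 3"
    using ell_pos by simp_all
  ultimately show "h1energy 0 (prof 0) (prof' 0) \<le> (2 * ell + ell ^ 3) * ((f 0)\<^sup>2 + (g 0)\<^sup>2)"
    unfolding h1energy_0 by (simp add: distrib_left distrib_right mult.commute)
qed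

text \<open>The squared norm is the sum of the mode energies. Each constant combines the bound for
  mode 0 with the bound for all \<open>k \<ge> 1\<close>, which is uniform because
  \<open>tanh ell \<le> tanh (k ell) \<le> 1\<close>.\<close>

lemma solution_norm:
  assumes comp: "compatible ell f0 g0" and u: "cauchy_solution ell f0 g0 u"
  shows "min (1 / (3 / ell + ell / 2)) (tanh ell) * star_norm_sq ell f0 g0 \<le> (H1_norm \<Omega> u)\<^sup>2"
    "(H1_norm \<Omega> u)\<^sup>2 \<le> max (2 * ell + ell ^ 3) 2 * star_norm_sq ell f0 g0"
proof -
  let ?e = "\<lambda>k. h1energy k (prof k) (prof' k)"
  let ?X = "\<lambda>j. real (Suc j) * (f (Suc j))\<^sup>2 + compat_term ell f0 g0 (Suc j)"
  define c1 c2 where "c1 = min (1 / (3 / ell + ell / 2)) (tanh ell)" and "c2 = max (2 * ell + ell ^ 3) 2"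
  define N where "N = (f 0)\<^sup>2 + (g 0)\<^sup>2"
  obtain s where s: "cauchy_solution ell f0 g0 s" "(H1_norm \<Omega> s)\<^sup>2 = (\<Sum>k. ?e k)"
    using solution_existence[OF comp] by blast
  have "(H1_norm \<Omega> u)\<^sup>2 = (\<Sum>k. ?e k)"
    using H1_norm_cong_AE[OF solutionD(1)[OF u] solutionD(1)[OF s(1)] solution_unique[OF u s(1)]] s(2) by simp
  also have "\<dots> = ?e 0 + (\<Sum>j. ?e (Suc j))"
    using suminf_split_head[OF prof_summable[OF comp]] by simp
  finally have H: "(H1_norm \<Omega> u)\<^sup>2 = ?e 0 + (\<Sum>j. ?e (Suc j))" .
  have Xs: "summable ?X"
    by (rule X_summable[OF comp])
  have fs: "summable (\<lambda>j. real (Suc j) * (f (Suc j))\<^sup>2)"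
    using f_summable by (simp only: summable_Suc_iff[of "\<lambda>k. real k * (f k)\<^sup>2"])
  have star: "star_norm_sq ell f0 g0 = N + suminf ?X"
    unfolding suminf_add[OF fs comp[unfolded compatible_def], symmetric] by (simp add: star_norm_sq_def N_def)
  have es: "summable (\<lambda>j. ?e (Suc j))"
    using prof_summable[OF comp] by (simp only: summable_Suc_iff[of ?e])
  have B: "tanh ell * suminf ?X \<le> (\<Sum>j. ?e (Suc j))" "(\<Sum>j. ?e (Suc j)) \<le> 2 * suminf ?X"
    by (rule suminf_bounds[OF Xs prof_h1energy(1) prof_h1energy(2) es]; simp)+
  have X0: "0 \<le> suminf ?X"
    by (rule suminf_nonneg[OF Xs]) (simp add: compat_term_def)
  have N0: "0 \<le> N"
    by (simp add: N_def)
  have K: "3 / ell + ell / 2 > 0"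
    using ell_pos by (intro add_pos_pos) auto
  have "c1 * (N + suminf ?X) \<le> 1 / (3 / ell + ell / 2) * N + tanh ell * suminf ?X"
    unfolding distrib_left c1_def by (intro add_mono mult_right_mono N0 X0) auto
  also have "1 / (3 / ell + ell / 2) * N \<le> ?e 0"
    using h1energy_0_bounds(1) K by (simp add: N_def pos_divide_le_eq mult.commute)
  finally show "min (1 / (3 / ell + ell / 2)) (tanh ell) * star_norm_sq ell f0 g0 \<le> (H1_norm \<Omega> u)\<^sup>2"
    unfolding H star c1_def[symmetric] using B(1) by linarith
  have "(H1_norm \<Omega> u)\<^sup>2 \<le> (2 * ell + ell ^ 3) * N + 2 * suminf ?X"
    unfolding H using h1energy_0_bounds(2) B(2) by (simp add: N_def)
  also have "\<dots> \<le> c2 * (N + suminf ?X)"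
    unfolding distrib_left c2_def by (intro add_mono mult_right_mono N0 X0) auto
  finally show "(H1_norm \<Omega> u)\<^sup>2 \<le> max (2 * ell + ell ^ 3) 2 * star_norm_sq ell f0 g0"
    unfolding star c2_def .
qed

end

text \<open>Two solutions agree almost everywhere for any data, so compatibility decides existence
  alone. The solution formula is split into two sums in \<open>H1\<close> because its two series
  converge separately.\<close>

theorem proposition4p3:
  fixes ell :: real
  assumes "ell > 0"
  shows
    "(\<forall>f0\<in>H_half {0..pi}. \<forall>g0\<in>H_minus_half {0..pi}.
        ((\<exists>u. cauchy_solution ell f0 g0 u \<and>
            (\<forall>v. cauchy_solution ell f0 g0 v \<longrightarrow> (AE z in lebesgue_on (Omega ell). v z = u z)))
          \<longleftrightarrow> compatible ell f0 g0))
     \<and>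
     (\<forall>f0\<in>H_half {0..pi}. \<forall>g0\<in>H_minus_half {0..pi}. \<forall>u.
        compatible ell f0 g0 \<and> cauchy_solution ell f0 g0 u \<longrightarrow>
        (\<exists>a b.
           H1_sums (Omega ell) (\<lambda>k z. f_coeff ell f0 k * psi0 ell k z) a \<and>
           H1_sums (Omega ell)
             (\<lambda>j z. (sinh (Suc j * ell))\<^sup>2 / cosh (Suc j * ell) * defect ell f0 g0 (Suc j)
                     * psi1 ell (Suc j) z) b \<and>
           (AE z in lebesgue_on (Omega ell).
              u z = a z - ell * g_coeff ell g0 0 * psi1 ell 0 z + b z)))
     \<and>
     (\<exists>c1>0. \<exists>c2>0. \<forall>f0\<in>H_half {0..pi}. \<forall>g0\<in>H_minus_half {0..pi}. \<forall>u.
        compatible ell f0 g0 \<and> cauchy_solution ell f0 g0 u \<longrightarrow>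
          summable (\<lambda>j. Suc j * \<bar>f_coeff ell f0 (Suc j)\<bar>\<^sup>2) \<and>
          c1 * star_norm_sq ell f0 g0 \<le> (H1_norm (Omega ell) u)\<^sup>2 \<and>
          (H1_norm (Omega ell) u)\<^sup>2 \<le> c2 * star_norm_sq ell f0 g0)"
proof -
  have data: "cauchy_data ell f0 g0" if "f0 \<in> H_half {0..pi}" "g0 \<in> H_minus_half {0..pi}" for f0 g0
    using that assms by unfold_locales
  show ?thesis
  proof (intro conjI ballI allI impI)
    fix f0 g0
    assume "f0 \<in> H_half {0..pi}" "g0 \<in> H_minus_half {0..pi}"
    then interpret cauchy_data ell f0 g0
      by (rule data)
    show "(\<exists>u. cauchy_solution ell f0 g0 u \<and>
            (\<forall>v. cauchy_solution ell f0 g0 v \<longrightarrow> (AE z in lebesgue_on (Omega ell). v z = u z)))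
          \<longleftrightarrow> compatible ell f0 g0"
      using solution_existence solution_unique solution_imp_compatible by blast
  next
    fix f0 g0 u
    assume "f0 \<in> H_half {0..pi}" "g0 \<in> H_minus_half {0..pi}"
    then interpret cauchy_data ell f0 g0
      by (rule data)
    assume "compatible ell f0 g0 \<and> cauchy_solution ell f0 g0 u"
    then show "\<exists>a b.
           H1_sums (Omega ell) (\<lambda>k z. f_coeff ell f0 k * psi0 ell k z) a \<and>
           H1_sums (Omega ell)
             (\<lambda>j z. (sinh (Suc j * ell))\<^sup>2 / cosh (Suc j * ell) * defect ell f0 g0 (Suc j)
                     * psi1 ell (Suc j) z) b \<and>
           (AE z in lebesgue_on (Omega ell).
              u z = a z - ell * g_coeff ell g0 0 * psi1 ell 0 z + b z)"
      by (intro solution_series) simp_all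
  next
    \<comment> \<open>Both constants depend on \<open>ell\<close> alone, so they can be fixed before
      the data are introduced.\<close>
    have c1: "0 < min (1 / (3 / ell + ell / 2)) (tanh ell)"
      using assms by (simp add: add_pos_pos)
    have c2: "0 < max (2 * ell + ell ^ 3) 2"
      by simp
    have bounds: "summable (\<lambda>j. Suc j * \<bar>f_coeff ell f0 (Suc j)\<bar>\<^sup>2) \<and>
          min (1 / (3 / ell + ell / 2)) (tanh ell) * star_norm_sq ell f0 g0 \<le> (H1_norm (Omega ell) u)\<^sup>2 \<and>
          (H1_norm (Omega ell) u)\<^sup>2 \<le> max (2 * ell + ell ^ 3) 2 * star_norm_sq ell f0 g0"
      if "f0 \<in> H_half {0..pi}" "g0 \<in> H_minus_half {0..pi}"
        "compatible ell f0 g0 \<and> cauchy_solution ell f0 g0 u" for f0 g0 u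
    proof -
      interpret cauchy_data ell f0 g0
        using that(1,2) by (rule data)
      have "summable (\<lambda>j. Suc j * (f_coeff ell f0 (Suc j))\<^sup>2)"
        using f_summable by (simp only: summable_Suc_iff[of "\<lambda>k. real k * (f_coeff ell f0 k)\<^sup>2"])
      then show ?thesis
        using solution_norm that(3) by simp
    qed
    show "\<exists>c1>0. \<exists>c2>0. \<forall>f0\<in>H_half {0..pi}. \<forall>g0\<in>H_minus_half {0..pi}. \<forall>u.
        compatible ell f0 g0 \<and> cauchy_solution ell f0 g0 u \<longrightarrow>
          summable (\<lambda>j. Suc j * \<bar>f_coeff ell f0 (Suc j)\<bar>\<^sup>2) \<and>
          c1 * star_norm_sq ell f0 g0 \<le> (H1_norm (Omega ell) u)\<^sup>2 \<and>
          (H1_norm (Omega ell) u)\<^sup>2 \<le> c2 * star_norm_sq ell f0 g0"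
      using c1 c2 bounds by (intro exI conjI ballI allI impI; blast)
  qed
qed

end
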